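(* Let $L$ be the algebraic closure of $\mathbb{Z}/(2)$ and let $P = z^4+xyz^2+x^3z+y^3z$. Set $A = L[x,y,z,t]/(P+t x^2y^2)$, $I=(x^4,y^4,z^4)$ (ideal of $A$), $f = y^3z^3 \in A$, and $S = L[t]\setminus\{0\}$. Then $f \in (S^{-1}I)^*$ in $S^{-1}A$; but for each $\alpha \in L$, $\alpha \neq 0$, one has $f \notin I^*$ (for the image of $f$ and the extension of $I$) in the ring $R_\alpha = A\otimes_{L[t]} L = L[x,y,z]/(P+\alpha x^2y^2)$, where $L[t]$ acts on $L$ by $t\mapsto \alpha$. Hence tight closure does not commute with localization: $f\notin S^{-1}(I^* )$, so $(S^{-1}I)^* \neq S^{-1}(I^* )$.
   Context: For a commutative noetherian domain $R$ containing a field of characteristic $p>0$ and an ideal $I\subseteq R$, the tight closure of $I$ is $I^*=\{f\in R : \text{there exists } t\neq 0 \text{ in } R \text{ with } t f^{q}\in I^{[q]} \text{ for all } q=p^e,\ e\ge 0\}$, where $I^{[q]}=(f^q : f\in I)$ is the ideal generated by all $q$-th powers of elements of $I$. "Tight closure commutes with localization" means $(S^{-1}I)^*=S^{-1}(I^* )$ for ideals $I$ and multiplicative systems $S$. *)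

theory Defs
  imports "HOL-Algebra.Algebraic_Closure_Type" "HOL-Algebra.QuotRing" "HOL-Library.Z2"
begin

section \<open>Localization of a commutative ring at a multiplicative system\<close>

definition loc_rel :: "('a, 'm) ring_scheme \<Rightarrow> 'a set \<Rightarrow> (('a \<times> 'a) \<times> ('a \<times> 'a)) set" where
  "loc_rel R S = {((a, s), (b, t)). a \<in> carrier R \<and> s \<in> S \<and> b \<in> carrier R \<and> t \<in> S \<and>
     (\<exists>u\<in>S. u \<otimes>\<^bsub>R\<^esub> (t \<otimes>\<^bsub>R\<^esub> a \<ominus>\<^bsub>R\<^esub> s \<otimes>\<^bsub>R\<^esub> b) = \<zero>\<^bsub>R\<^esub>)}"

text \<open>The fraction \<open>a / s\<close>, as an equivalence class of pairs.\<close>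

definition loc_frac :: "('a, 'm) ring_scheme \<Rightarrow> 'a set \<Rightarrow> 'a \<Rightarrow> 'a \<Rightarrow> ('a \<times> 'a) set" where
  "loc_frac R S a s = loc_rel R S `` {(a, s)}"

definition localization :: "('a, 'm) ring_scheme \<Rightarrow> 'a set \<Rightarrow> ('a \<times> 'a) set ring" where
  "localization R S =
    \<lparr>carrier = (carrier R \<times> S) // loc_rel R S,
     monoid.mult = (\<lambda>U V. \<Union>(a, s)\<in>U. \<Union>(b, t)\<in>V. loc_frac R S (a \<otimes>\<^bsub>R\<^esub> b) (s \<otimes>\<^bsub>R\<^esub> t)),
     one = loc_frac R S \<one>\<^bsub>R\<^esub> \<one>\<^bsub>R\<^esub>,
     ring.zero = loc_frac R S \<zero>\<^bsub>R\<^esub> \<one>\<^bsub>R\<^esub>,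
     add = (\<lambda>U V. \<Union>(a, s)\<in>U. \<Union>(b, t)\<in>V.
       loc_frac R S (t \<otimes>\<^bsub>R\<^esub> a \<oplus>\<^bsub>R\<^esub> s \<otimes>\<^bsub>R\<^esub> b) (s \<otimes>\<^bsub>R\<^esub> t))\<rparr>"

definition loc_ideal :: "('a, 'm) ring_scheme \<Rightarrow> 'a set \<Rightarrow> 'a set \<Rightarrow> ('a \<times> 'a) set set" where
  "loc_ideal R S I = {loc_frac R S a s |a s. a \<in> I \<and> s \<in> S}"

text \<open>The operations do not depend on representatives, the result is a
  commutative ring, and \<open>a \<mapsto> a / 1\<close> is a ring homomorphism making \<open>S\<close> invertible.\<close>

lemma UN_pair_const:
  assumes "p \<in> A" "q \<in> B" and "\<And>a s b t. (a, s) \<in> A \<Longrightarrow> (b, t) \<in> B \<Longrightarrow> F a s b t = C"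
  shows "(\<Union>(a, s)\<in>A. \<Union>(b, t)\<in>B. F a s b t) = C"
proof -
  have "(\<Union>(b, t)\<in>B. F a s b t) = C" if "(a, s) \<in> A" for a s
  proof -
    have "(\<Union>(b, t)\<in>B. F a s b t) = (\<Union>q\<in>B. C)"
      using assms(3)[OF that] by (intro SUP_cong) auto
    then show ?thesis using assms(2) by auto
  qed
  note inner = this
  have "(\<Union>(a, s)\<in>A. \<Union>(b, t)\<in>B. F a s b t) = (\<Union>p\<in>A. C)"
  proof (rule SUP_cong[OF refl])
    fix p assume "p \<in> A"
    with inner show "(case p of (a, s) \<Rightarrow> \<Union>(b, t)\<in>B. F a s b t) = C"
      by (cases p) (simp only: prod.case)
  qed
  then show ?thesis using assms(1) by auto
qed

locale localization_at = cring R + submonoid S R for R (structure) and S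
begin

lemma S_carr: "s \<in> S \<Longrightarrow> s \<in> carrier R"
  using subset by blast

lemma equiv_loc_rel: "equiv (carrier R \<times> S) (loc_rel R S)"
proof (rule equivI)
  show "loc_rel R S \<subseteq> (carrier R \<times> S) \<times> (carrier R \<times> S)"
    by (auto simp: loc_rel_def)
  have "\<exists>u\<in>S. u \<otimes> (s \<otimes> a \<ominus> s \<otimes> a) = \<zero>" if "a \<in> carrier R" "s \<in> S" for a s
  proof -
    have "\<one> \<otimes> (s \<otimes> a \<ominus> s \<otimes> a) = \<zero>"
      using that S_carr[of s] by algebra
    then show ?thesis using one_closed by blast
  qed
  then show "refl_on (carrier R \<times> S) (loc_rel R S)"
    by (auto simp: refl_on_def loc_rel_def)
  show "sym (loc_rel R S)"
  proof (rule symI, clarsimp simp: loc_rel_def)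
    fix a s b t u
    assume h: "a \<in> carrier R" "s \<in> S" "b \<in> carrier R" "t \<in> S" "u \<in> S"
      and e: "u \<otimes> (t \<otimes> a \<ominus> s \<otimes> b) = \<zero>"
    note c = h S_carr[OF h(2)] S_carr[OF h(4)] S_carr[OF h(5)]
    have "u \<otimes> (s \<otimes> b \<ominus> t \<otimes> a) = \<ominus> (u \<otimes> (t \<otimes> a \<ominus> s \<otimes> b))"
      using c by algebra
    then show "\<exists>u\<in>S. u \<otimes> (s \<otimes> b \<ominus> t \<otimes> a) = \<zero>"
      using e h by auto
  qed
  show "trans (loc_rel R S)"
  proof (rule transI, clarsimp simp: loc_rel_def)
    fix a s b t d r u v
    assume h: "a \<in> carrier R" "s \<in> S" "b \<in> carrier R" "t \<in> S" "d \<in> carrier R" "r \<in> S"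
      "u \<in> S" "v \<in> S"
      and e: "u \<otimes> (t \<otimes> a \<ominus> s \<otimes> b) = \<zero>" "v \<otimes> (r \<otimes> b \<ominus> t \<otimes> d) = \<zero>"
    note c = h S_carr[OF h(2)] S_carr[OF h(4)] S_carr[OF h(6)] S_carr[OF h(7)] S_carr[OF h(8)]
    have "u \<otimes> v \<otimes> t \<otimes> (r \<otimes> a \<ominus> s \<otimes> d)
        = v \<otimes> r \<otimes> (u \<otimes> (t \<otimes> a \<ominus> s \<otimes> b)) \<oplus> u \<otimes> s \<otimes> (v \<otimes> (r \<otimes> b \<ominus> t \<otimes> d))"
      using c by algebra
    also have "\<dots> = \<zero>" using c by (simp add: e)
    finally show "\<exists>u\<in>S. u \<otimes> (r \<otimes> a \<ominus> s \<otimes> d) = \<zero>"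
      using h by (meson m_closed)
  qed
qed

lemma loc_frac_eq_iff:
  assumes "a \<in> carrier R" "s \<in> S" "b \<in> carrier R" "t \<in> S"
  shows "loc_frac R S a s = loc_frac R S b t \<longleftrightarrow>
    (\<exists>u\<in>S. u \<otimes> (t \<otimes> a \<ominus> s \<otimes> b) = \<zero>)"
  using eq_equiv_class_iff[OF equiv_loc_rel, of "(a, s)" "(b, t)"] assms
  by (auto simp: loc_frac_def loc_rel_def)

lemma loc_frac_eqI:
  assumes "a \<in> carrier R" "s \<in> S" "b \<in> carrier R" "t \<in> S" "t \<otimes> a = s \<otimes> b"
  shows "loc_frac R S a s = loc_frac R S b t"
proof -
  have "\<one> \<otimes> (t \<otimes> a \<ominus> s \<otimes> b) = \<zero>"
    using assms S_carr[of s] S_carr[of t] by (simp add: minus_eq r_neg)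
  then show ?thesis
    using loc_frac_eq_iff[OF assms(1-4)] one_closed by blast
qed

lemma mem_loc_frac:
  "(b, t) \<in> loc_frac R S a s \<longleftrightarrow> a \<in> carrier R \<and> s \<in> S \<and> b \<in> carrier R \<and> t \<in> S \<and>
     loc_frac R S a s = loc_frac R S b t"
proof (cases "a \<in> carrier R \<and> s \<in> S \<and> b \<in> carrier R \<and> t \<in> S")
  case True
  then show ?thesis
    by (auto simp: loc_frac_eq_iff) (auto simp: loc_frac_def loc_rel_def)
qed (auto simp: loc_frac_def loc_rel_def)

lemma carrier_localization:
  "carrier (localization R S) = {loc_frac R S a s |a s. a \<in> carrier R \<and> s \<in> S}"
  by (auto simp: localization_def loc_frac_def quotient_def)

lemma loc_frac_closed:
  "a \<in> carrier R \<Longrightarrow> s \<in> S \<Longrightarrow> loc_frac R S a s \<in> carrier (localization R S)"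
  by (auto simp: carrier_localization)

lemma loc_mult: "U \<otimes>\<^bsub>localization R S\<^esub> V =
    (\<Union>(a, s)\<in>U. \<Union>(b, t)\<in>V. loc_frac R S (a \<otimes> b) (s \<otimes> t))"
  and loc_add: "U \<oplus>\<^bsub>localization R S\<^esub> V =
    (\<Union>(a, s)\<in>U. \<Union>(b, t)\<in>V. loc_frac R S (t \<otimes> a \<oplus> s \<otimes> b) (s \<otimes> t))"
  by (simp_all add: localization_def)

lemma mult_loc_frac:
  assumes h: "a \<in> carrier R" "s \<in> S" "b \<in> carrier R" "t \<in> S"
  shows "loc_frac R S a s \<otimes>\<^bsub>localization R S\<^esub> loc_frac R S b t = loc_frac R S (a \<otimes> b) (s \<otimes> t)"
proof -
  have "loc_frac R S (a' \<otimes> b') (s' \<otimes> t') = loc_frac R S (a \<otimes> b) (s \<otimes> t)"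
    if m: "(a', s') \<in> loc_frac R S a s" "(b', t') \<in> loc_frac R S b t" for a' s' b' t'
  proof -
    have k: "a' \<in> carrier R" "s' \<in> S" "b' \<in> carrier R" "t' \<in> S"
      using m by (auto simp: mem_loc_frac)
    obtain u v where uv: "u \<in> S" "v \<in> S"
        "u \<otimes> (s \<otimes> a' \<ominus> s' \<otimes> a) = \<zero>" "v \<otimes> (t \<otimes> b' \<ominus> t' \<otimes> b) = \<zero>"
      using m h k by (metis loc_frac_eq_iff mem_loc_frac)
    note c = h k uv(1,2) S_carr[OF h(2)] S_carr[OF h(4)] S_carr[OF k(2)] S_carr[OF k(4)]
      S_carr[OF uv(1)] S_carr[OF uv(2)]
    have "u \<otimes> v \<otimes> (s \<otimes> t \<otimes> (a' \<otimes> b') \<ominus> s' \<otimes> t' \<otimes> (a \<otimes> b))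
      = v \<otimes> t \<otimes> b' \<otimes> (u \<otimes> (s \<otimes> a' \<ominus> s' \<otimes> a)) \<oplus> u \<otimes> s' \<otimes> a \<otimes> (v \<otimes> (t \<otimes> b' \<ominus> t' \<otimes> b))"
      using c by algebra
    also have "\<dots> = \<zero>" using c by (simp add: uv)
    finally show ?thesis
      using c uv by (subst loc_frac_eq_iff) (auto intro: m_closed)
  qed
  note wd = this
  have "(a, s) \<in> loc_frac R S a s" "(b, t) \<in> loc_frac R S b t"
    using h by (simp_all add: mem_loc_frac)
  then show ?thesis
    unfolding loc_mult by (rule UN_pair_const) (rule wd)
qed

lemma add_loc_frac:
  assumes h: "a \<in> carrier R" "s \<in> S" "b \<in> carrier R" "t \<in> S"
  shows "loc_frac R S a s \<oplus>\<^bsub>localization R S\<^esub> loc_frac R S b t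
    = loc_frac R S (t \<otimes> a \<oplus> s \<otimes> b) (s \<otimes> t)"
proof -
  have "loc_frac R S (t' \<otimes> a' \<oplus> s' \<otimes> b') (s' \<otimes> t') = loc_frac R S (t \<otimes> a \<oplus> s \<otimes> b) (s \<otimes> t)"
    if m: "(a', s') \<in> loc_frac R S a s" "(b', t') \<in> loc_frac R S b t" for a' s' b' t'
  proof -
    have k: "a' \<in> carrier R" "s' \<in> S" "b' \<in> carrier R" "t' \<in> S"
      using m by (auto simp: mem_loc_frac)
    obtain u v where uv: "u \<in> S" "v \<in> S"
        "u \<otimes> (s \<otimes> a' \<ominus> s' \<otimes> a) = \<zero>" "v \<otimes> (t \<otimes> b' \<ominus> t' \<otimes> b) = \<zero>"
      using m h k by (metis loc_frac_eq_iff mem_loc_frac)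
    note c = h k uv(1,2) S_carr[OF h(2)] S_carr[OF h(4)] S_carr[OF k(2)] S_carr[OF k(4)]
      S_carr[OF uv(1)] S_carr[OF uv(2)]
    have "u \<otimes> v \<otimes> (s \<otimes> t \<otimes> (t' \<otimes> a' \<oplus> s' \<otimes> b') \<ominus> s' \<otimes> t' \<otimes> (t \<otimes> a \<oplus> s \<otimes> b))
      = v \<otimes> t \<otimes> t' \<otimes> (u \<otimes> (s \<otimes> a' \<ominus> s' \<otimes> a)) \<oplus> u \<otimes> s \<otimes> s' \<otimes> (v \<otimes> (t \<otimes> b' \<ominus> t' \<otimes> b))"
      using c by algebra
    also have "\<dots> = \<zero>" using c by (simp add: uv)
    finally show ?thesis
      using c uv by (subst loc_frac_eq_iff) (auto intro: m_closed)
  qed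
  note wd = this
  have "(a, s) \<in> loc_frac R S a s" "(b, t) \<in> loc_frac R S b t"
    using h by (simp_all add: mem_loc_frac)
  then show ?thesis
    unfolding loc_add by (rule UN_pair_const) (rule wd)
qed

lemma one_loc: "\<one>\<^bsub>localization R S\<^esub> = loc_frac R S \<one> \<one>"
  and zero_loc: "\<zero>\<^bsub>localization R S\<^esub> = loc_frac R S \<zero> \<one>"
  by (simp_all add: localization_def)

lemma cring_localization: "cring (localization R S)"
proof (rule cringI)
  have loc_cases: "\<exists>a s. U = loc_frac R S a s \<and> a \<in> carrier R \<and> s \<in> S \<and> s \<in> carrier R"
    if "U \<in> carrier (localization R S)" for U
    using that S_carr by (fastforce simp: carrier_localization)
  note simps = mult_loc_frac add_loc_frac one_loc zero_loc loc_frac_closed one_closed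
  show "abelian_group (localization R S)"
  proof (rule abelian_groupI)
    fix U assume "U \<in> carrier (localization R S)"
    then obtain a s where U: "U = loc_frac R S a s" "a \<in> carrier R" "s \<in> S" "s \<in> carrier R"
      using loc_cases by blast
    have "loc_frac R S (\<ominus> a) s \<oplus>\<^bsub>localization R S\<^esub> U = \<zero>\<^bsub>localization R S\<^esub>"
    proof -
      have "s \<otimes> \<ominus> a \<oplus> s \<otimes> a = \<zero>" using U(2-) by algebra
      then show ?thesis
        unfolding U(1) using U(2-) by (simp add: simps) (rule loc_frac_eqI, simp_all add: one_closed)
    qed
    then show "\<exists>V\<in>carrier (localization R S). V \<oplus>\<^bsub>localization R S\<^esub> U = \<zero>\<^bsub>localization R S\<^esub>"
      using U by (meson loc_frac_closed a_inv_closed)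
    show "\<zero>\<^bsub>localization R S\<^esub> \<oplus>\<^bsub>localization R S\<^esub> U = U"
      unfolding U(1) using U(2-) by (simp add: simps)
  next
    fix U V assume "U \<in> carrier (localization R S)" "V \<in> carrier (localization R S)"
    then obtain a s b t where U: "U = loc_frac R S a s" "V = loc_frac R S b t"
      "a \<in> carrier R" "s \<in> S" "s \<in> carrier R" "b \<in> carrier R" "t \<in> S" "t \<in> carrier R"
      using loc_cases by meson
    show "U \<oplus>\<^bsub>localization R S\<^esub> V \<in> carrier (localization R S)"
      unfolding U(1,2) using U(3-) by (simp add: simps)
    show "U \<oplus>\<^bsub>localization R S\<^esub> V = V \<oplus>\<^bsub>localization R S\<^esub> U"
      unfolding U(1,2) using U(3-) by (simp add: simps a_comm m_comm)
    fix W assume "W \<in> carrier (localization R S)"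
    then obtain d r where W: "W = loc_frac R S d r" "d \<in> carrier R" "r \<in> S" "r \<in> carrier R"
      using loc_cases by meson
    show "U \<oplus>\<^bsub>localization R S\<^esub> V \<oplus>\<^bsub>localization R S\<^esub> W = U \<oplus>\<^bsub>localization R S\<^esub> (V \<oplus>\<^bsub>localization R S\<^esub> W)"
    proof -
      have "s \<otimes> (t \<otimes> r) \<otimes> (r \<otimes> (t \<otimes> a \<oplus> s \<otimes> b) \<oplus> s \<otimes> t \<otimes> d) =
          s \<otimes> t \<otimes> r \<otimes> (t \<otimes> r \<otimes> a \<oplus> s \<otimes> (r \<otimes> b \<oplus> t \<otimes> d))"
        using U(3-) W(2-) by algebra
      then show ?thesis
        unfolding U(1,2) W(1) using U(3-) W(2-) by (simp add: simps) (rule loc_frac_eqI, simp_all add: one_closed)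
    qed
  qed (simp add: simps)
  show "comm_monoid (localization R S)"
  proof (rule comm_monoidI)
    fix U V assume "U \<in> carrier (localization R S)" "V \<in> carrier (localization R S)"
    then obtain a s b t where U: "U = loc_frac R S a s" "V = loc_frac R S b t"
      "a \<in> carrier R" "s \<in> S" "s \<in> carrier R" "b \<in> carrier R" "t \<in> S" "t \<in> carrier R"
      using loc_cases by meson
    show "U \<otimes>\<^bsub>localization R S\<^esub> V \<in> carrier (localization R S)"
      unfolding U(1,2) using U(3-) by (simp add: simps)
    show "U \<otimes>\<^bsub>localization R S\<^esub> V = V \<otimes>\<^bsub>localization R S\<^esub> U"
      unfolding U(1,2) using U(3-) by (simp add: simps m_comm)
    show "\<one>\<^bsub>localization R S\<^esub> \<otimes>\<^bsub>localization R S\<^esub> U = U"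
      unfolding U(1,2) using U(3-) by (simp add: simps)
    fix W assume "W \<in> carrier (localization R S)"
    then obtain d r where W: "W = loc_frac R S d r" "d \<in> carrier R" "r \<in> S" "r \<in> carrier R"
      using loc_cases by meson
    show "U \<otimes>\<^bsub>localization R S\<^esub> V \<otimes>\<^bsub>localization R S\<^esub> W = U \<otimes>\<^bsub>localization R S\<^esub> (V \<otimes>\<^bsub>localization R S\<^esub> W)"
      unfolding U(1,2) W(1) using U(3-) W(2-) by (simp add: simps m_assoc)
  qed (simp add: simps)
  fix U V W assume "U \<in> carrier (localization R S)" "V \<in> carrier (localization R S)"
    "W \<in> carrier (localization R S)"
  then obtain a s b t d r where U: "U = loc_frac R S a s" "V = loc_frac R S b t" "W = loc_frac R S d r"
    "a \<in> carrier R" "s \<in> S" "s \<in> carrier R" "b \<in> carrier R" "t \<in> S" "t \<in> carrier R"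
    "d \<in> carrier R" "r \<in> S" "r \<in> carrier R"
    using loc_cases by meson
  show "(U \<oplus>\<^bsub>localization R S\<^esub> V) \<otimes>\<^bsub>localization R S\<^esub> W
      = U \<otimes>\<^bsub>localization R S\<^esub> W \<oplus>\<^bsub>localization R S\<^esub> V \<otimes>\<^bsub>localization R S\<^esub> W"
  proof -
    have "s \<otimes> r \<otimes> (t \<otimes> r) \<otimes> ((t \<otimes> a \<oplus> s \<otimes> b) \<otimes> d) =
        s \<otimes> t \<otimes> r \<otimes> (t \<otimes> r \<otimes> (a \<otimes> d) \<oplus> s \<otimes> r \<otimes> (b \<otimes> d))"
      using U(4-) by algebra
    then show ?thesis
      unfolding U(1-3) using U(4-) by (simp add: simps) (rule loc_frac_eqI, simp_all add: one_closed)
  qed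
qed

lemma loc_map_ring_hom: "(\<lambda>a. loc_frac R S a \<one>) \<in> ring_hom R (localization R S)"
  by (rule ring_hom_memI)
    (simp_all add: mult_loc_frac add_loc_frac one_loc loc_frac_closed one_closed)

lemma loc_map_unit:
  assumes "s \<in> S"
  shows "loc_frac R S s \<one> \<otimes>\<^bsub>localization R S\<^esub> loc_frac R S \<one> s = \<one>\<^bsub>localization R S\<^esub>"
  using assms S_carr[OF assms]
  by (simp add: mult_loc_frac one_loc one_closed) (rule loc_frac_eqI, simp_all add: one_closed)

end

section \<open>Tight closure\<close>

definition frobenius_power :: "('a, 'm) ring_scheme \<Rightarrow> nat \<Rightarrow> 'a set \<Rightarrow> 'a set" where
  "frobenius_power R q I = genideal R {g [^]\<^bsub>R\<^esub> q |g. g \<in> I}"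

text \<open>Intended for a noetherian domain \<open>R\<close> containing a field of characteristic \<open>p\<close>;
  only there does the condition on \<open>t\<close> reduce to \<open>t \<noteq> 0\<close>.\<close>

definition tight_closure :: "nat \<Rightarrow> ('a, 'm) ring_scheme \<Rightarrow> 'a set \<Rightarrow> 'a set" where
  "tight_closure p R I = {f \<in> carrier R. \<exists>t\<in>carrier R. t \<noteq> \<zero>\<^bsub>R\<^esub> \<and>
     (\<forall>e::nat. t \<otimes>\<^bsub>R\<^esub> f [^]\<^bsub>R\<^esub> (p ^ e) \<in> frobenius_power R (p ^ e) I)}"

section \<open>The family of quartics\<close>

type_synonym L = "bit alg_closure"

lemma CHAR_L: "CHAR(L) = 2"
proof -
  have "(2::L) = to_ac (2::bit)" by (simp only: to_ac_numeral)
  then have "of_nat 2 = (0::L)" by simp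
  then have "CHAR(L) dvd 2" by (simp only: of_nat_eq_0_iff_char_dvd)
  moreover have "CHAR(L) \<noteq> 1" by simp
  ultimately show ?thesis
    using prime_nat_iff two_is_prime_nat by metis
qed

text \<open>Iterated polynomials represent \<open>L[x,y,z] = L[x][y][z]\<close>, with \<open>x\<close> innermost, and
  \<open>L[x,y,z,t] = L[x,y,z][t]\<close>.\<close>

type_synonym L_xyz = "L poly poly poly"
type_synonym L_xyzt = "L_xyz poly"

definition var_x :: L_xyz where "var_x = [:[:[:0, 1:]:]:]"
definition var_y :: L_xyz where "var_y = [:[:0, 1:]:]"
definition var_z :: L_xyz where "var_z = [:0, 1:]"
definition var_t :: L_xyzt where "var_t = [:0, 1:]"

definition constL :: "L \<Rightarrow> L_xyz" where "constL c = [:[:[:c:]:]:]"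

definition quartic :: L_xyz where
  "quartic = var_z ^ 4 + var_x * var_y * var_z ^ 2 + var_x ^ 3 * var_z + var_y ^ 3 * var_z"

definition relA :: "L_xyzt set" where
  "relA = genideal ring_of_type_algebra {[:quartic:] + var_t * [:var_x ^ 2 * var_y ^ 2:]}"

definition ringA :: "L_xyzt set ring" where
  "ringA = ring_of_type_algebra Quot relA"

definition clsA :: "L_xyzt \<Rightarrow> L_xyzt set" where
  "clsA g = relA +>\<^bsub>ring_of_type_algebra\<^esub> g"

definition idealI :: "L_xyzt set set" where
  "idealI = genideal ringA {clsA ([:var_x:] ^ 4), clsA ([:var_y:] ^ 4), clsA ([:var_z:] ^ 4)}"

definition elemf :: "L_xyzt set" where
  "elemf = clsA ([:var_y:] ^ 3 * [:var_z:] ^ 3)"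

text \<open>The image of \<open>L[t] - {0}\<close> in \<open>A\<close>.\<close>

definition multS :: "L_xyzt set set" where
  "multS = {clsA (map_poly constL c) |c :: L poly. c \<noteq> 0}"

definition relR :: "L \<Rightarrow> L_xyz set" where
  "relR \<alpha> = genideal ring_of_type_algebra {quartic + constL \<alpha> * var_x ^ 2 * var_y ^ 2}"

definition ringR :: "L \<Rightarrow> L_xyz set ring" where
  "ringR \<alpha> = ring_of_type_algebra Quot relR \<alpha>"

definition clsR :: "L \<Rightarrow> L_xyz \<Rightarrow> L_xyz set" where
  "clsR \<alpha> g = relR \<alpha> +>\<^bsub>ring_of_type_algebra\<^esub> g"

text \<open>With \<open>t\<close> as the outermost variable, substituting \<open>t = \<alpha>\<close> is polynomial evaluation.
  The map \<open>A \<rightarrow> R\<^sub>\<alpha>\<close> induced by \<open>t \<mapsto> \<alpha>\<close>; independence of the representative is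
  \<open>specialize_clsA\<close> below.\<close>

definition specialize :: "L \<Rightarrow> L_xyzt set \<Rightarrow> L_xyz set" where
  "specialize \<alpha> U = the_elem ((\<lambda>g. clsR \<alpha> (poly g (constL \<alpha>))) ` U)"

lemma ring_of_type_algebra_simps [simp]:
  "carrier (ring_of_type_algebra :: 'a :: ring_1 ring) = UNIV"
  "x \<otimes>\<^bsub>ring_of_type_algebra\<^esub> y = x * y"
  "x \<oplus>\<^bsub>ring_of_type_algebra\<^esub> y = x + y"
  "\<one>\<^bsub>ring_of_type_algebra\<^esub> = 1"
  "\<zero>\<^bsub>ring_of_type_algebra\<^esub> = 0"
  by (simp_all add: ring_of_type_algebra_def)

lemma genideal_singleton_type:
  "genideal ring_of_type_algebra {a :: 'a :: comm_ring_1} = {g. a dvd g}"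
proof -
  interpret cring "ring_of_type_algebra :: 'a ring" by (rule cring_from_type_algebra)
  show ?thesis
    by (subst cgenideal_eq_genideal[symmetric])
      (auto simp: cgenideal_def dvd_def mult.commute)
qed

lemma coset_type: "I +>\<^bsub>ring_of_type_algebra\<^esub> (g :: 'a :: comm_ring_1) = {h + g |h. h \<in> I}"
  by (auto simp: a_r_coset_def' )

lemma mem_principal_coset:
  fixes a g h :: "'a :: comm_ring_1"
  shows "h \<in> genideal ring_of_type_algebra {a} +>\<^bsub>ring_of_type_algebra\<^esub> g \<longleftrightarrow> a dvd h - g"
  unfolding coset_type genideal_singleton_type
  by (auto intro!: exI[of _ "h - g"])

lemma principal_coset_eq_iff:
  fixes a g h :: "'a :: comm_ring_1"
  shows "genideal ring_of_type_algebra {a} +>\<^bsub>ring_of_type_algebra\<^esub> g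
      = genideal ring_of_type_algebra {a} +>\<^bsub>ring_of_type_algebra\<^esub> h \<longleftrightarrow> a dvd g - h"
proof -
  have "a dvd y - g \<longleftrightarrow> a dvd y - h" if "a dvd g - h" for y
    using dvd_add[OF _ that, of "y - g"] dvd_diff[OF _ that, of "y - h"] by auto
  moreover have "a dvd g - h" if "\<And>y. a dvd y - g \<longleftrightarrow> a dvd y - h"
    using that[of g] by simp
  ultimately show ?thesis
    unfolding set_eq_iff mem_principal_coset by blast
qed

lemma ideal_relA: "ideal relA ring_of_type_algebra"
  unfolding relA_def
  by (intro ring.genideal_ideal ring_from_type_algebra) simp

lemma ideal_relR: "ideal (relR \<alpha>) ring_of_type_algebra"
  unfolding relR_def
  by (intro ring.genideal_ideal ring_from_type_algebra) simp

lemma cring_ringA: "cring ringA"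
  unfolding ringA_def by (rule ideal.quotient_is_cring[OF ideal_relA cring_from_type_algebra])

lemma cring_ringR: "cring (ringR \<alpha>)"
  unfolding ringR_def by (rule ideal.quotient_is_cring[OF ideal_relR cring_from_type_algebra])

lemma clsA_hom: "clsA \<in> ring_hom ring_of_type_algebra ringA"
  using ideal.rcos_ring_hom[OF ideal_relA] by (simp add: clsA_def[abs_def] ringA_def)

lemma clsR_hom: "clsR \<alpha> \<in> ring_hom ring_of_type_algebra (ringR \<alpha>)"
  using ideal.rcos_ring_hom[OF ideal_relR] by (simp add: clsR_def[abs_def] ringR_def)

lemma carrier_ringA: "carrier ringA = range clsA"
  by (auto simp: ringA_def FactRing_def A_RCOSETS_def' clsA_def)

lemma carrier_ringR: "carrier (ringR \<alpha>) = range (clsR \<alpha>)"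
  by (auto simp: ringR_def FactRing_def A_RCOSETS_def' clsR_def)

lemma clsA_eq_iff:
  "clsA g = clsA h \<longleftrightarrow> [:quartic:] + var_t * [:var_x ^ 2 * var_y ^ 2:] dvd g - h"
  unfolding clsA_def relA_def by (rule principal_coset_eq_iff)

lemma clsR_eq_iff:
  "clsR \<alpha> g = clsR \<alpha> h \<longleftrightarrow> quartic + constL \<alpha> * var_x ^ 2 * var_y ^ 2 dvd g - h"
  unfolding clsR_def relR_def by (rule principal_coset_eq_iff)

lemma image_eq_singletonI: "(\<And>x. x \<in> A \<Longrightarrow> f x = c) \<Longrightarrow> a \<in> A \<Longrightarrow> f ` A = {c}"
  by force

lemma specialize_clsA: "specialize \<alpha> (clsA g) = clsR \<alpha> (poly g (constL \<alpha>))"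
proof -
  have mem: "h \<in> clsA g \<longleftrightarrow> [:quartic:] + var_t * [:var_x ^ 2 * var_y ^ 2:] dvd h - g" for h
    unfolding clsA_def relA_def by (rule mem_principal_coset)
  have "clsR \<alpha> (poly h (constL \<alpha>)) = clsR \<alpha> (poly g (constL \<alpha>))" if h: "h \<in> clsA g" for h
  proof -
    obtain k where "h - g = ([:quartic:] + var_t * [:var_x ^ 2 * var_y ^ 2:]) * k"
      using h unfolding mem ..
    then have "poly (h - g) (constL \<alpha>)
        = poly (([:quartic:] + var_t * [:var_x ^ 2 * var_y ^ 2:]) * k) (constL \<alpha>)"
      by (rule arg_cong)
    then have "poly h (constL \<alpha>) - poly g (constL \<alpha>)
        = (quartic + constL \<alpha> * var_x ^ 2 * var_y ^ 2) * poly k (constL \<alpha>)"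
      by (simp only: poly_diff poly_mult poly_add) (simp add: var_t_def mult.assoc)
    then show ?thesis
      by (simp only: clsR_eq_iff dvd_triv_left)
  qed
  moreover have "g \<in> clsA g"
    unfolding mem by (simp only: diff_self dvd_0_right)
  ultimately have "(\<lambda>g. clsR \<alpha> (poly g (constL \<alpha>))) ` clsA g = {clsR \<alpha> (poly g (constL \<alpha>))}"
    by (rule image_eq_singletonI)
  then show ?thesis unfolding specialize_def by (simp only: the_elem_eq)
qed

text \<open>Specialization is a surjective ring homomorphism with kernel \<open>(t - \<alpha>)\<close>; hence it identifies
  \<open>R\<^sub>\<alpha>\<close> with the base change of \<open>A\<close> along \<open>L[t] \<rightarrow> L[t]/(t - \<alpha>) = L\<close>.\<close>

lemma clsA_ops:
  "clsA g \<otimes>\<^bsub>ringA\<^esub> clsA h = clsA (g * h)" "clsA g \<oplus>\<^bsub>ringA\<^esub> clsA h = clsA (g + h)"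
  "\<one>\<^bsub>ringA\<^esub> = clsA 1"
  using ring_hom_mult[OF clsA_hom, of g h] ring_hom_add[OF clsA_hom, of g h] ring_hom_one[OF clsA_hom]
  by simp_all

lemma clsR_ops:
  "clsR \<alpha> g \<otimes>\<^bsub>ringR \<alpha>\<^esub> clsR \<alpha> h = clsR \<alpha> (g * h)"
  "clsR \<alpha> g \<oplus>\<^bsub>ringR \<alpha>\<^esub> clsR \<alpha> h = clsR \<alpha> (g + h)"
  "\<one>\<^bsub>ringR \<alpha>\<^esub> = clsR \<alpha> 1"
  using ring_hom_mult[OF clsR_hom, of g h] ring_hom_add[OF clsR_hom, of g h] ring_hom_one[OF clsR_hom]
  by simp_all

lemma specialize_hom: "specialize \<alpha> \<in> ring_hom ringA (ringR \<alpha>)"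
proof (rule ring_hom_memI)
  fix U V assume "U \<in> carrier ringA" "V \<in> carrier ringA"
  then obtain g h where gh: "U = clsA g" "V = clsA h"
    unfolding carrier_ringA by (elim rangeE)
  show "specialize \<alpha> U \<in> carrier (ringR \<alpha>)"
    unfolding gh specialize_clsA carrier_ringR by (rule rangeI)
  show "specialize \<alpha> (U \<otimes>\<^bsub>ringA\<^esub> V) = specialize \<alpha> U \<otimes>\<^bsub>ringR \<alpha>\<^esub> specialize \<alpha> V"
    by (simp only: gh clsA_ops specialize_clsA clsR_ops poly_mult)
  show "specialize \<alpha> (U \<oplus>\<^bsub>ringA\<^esub> V) = specialize \<alpha> U \<oplus>\<^bsub>ringR \<alpha>\<^esub> specialize \<alpha> V"
    by (simp only: gh clsA_ops specialize_clsA clsR_ops poly_add)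
next
  show "specialize \<alpha> \<one>\<^bsub>ringA\<^esub> = \<one>\<^bsub>ringR \<alpha>\<^esub>"
    by (simp only: clsA_ops specialize_clsA clsR_ops poly_1)
qed

lemma specialize_surj: "specialize \<alpha> ` carrier ringA = carrier (ringR \<alpha>)"
proof -
  have "clsR \<alpha> g \<in> range (\<lambda>h. clsR \<alpha> (poly h (constL \<alpha>)))" for g
    by (rule range_eqI[where x = "[:g:]"]) (simp only: poly_pCons poly_0 mult_zero_right add_0_right)
  then show ?thesis
    unfolding carrier_ringA carrier_ringR image_image specialize_clsA
    by (intro equalityI image_subsetI rangeI)
qed

lemma range_setcompr: "{F x |x. x \<in> range c} = {F (c h) |h. True}"
  by auto

lemma range_filter: "{x \<in> range c. Q x} = {c g |g. Q (c g)}"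
  by auto

lemma setcompr_eq:
  assumes "\<And>g. Q (c g) \<longleftrightarrow> (\<exists>h. c g = F h)" "\<And>h. F h = c (G h)"
  shows "{c g |g. Q (c g)} = {F h |h. True}"
proof -
  have "Q (F h)" for h
    unfolding assms(2) assms(1)[of "G h"] using assms(2)[of h] by metis
  then show ?thesis
    unfolding set_eq_iff mem_Collect_eq using assms by metis
qed

lemma specialize_kernel:
  "a_kernel ringA (ringR \<alpha>) (specialize \<alpha>) = genideal ringA {clsA (var_t - [:constL \<alpha>:])}"
proof -
  interpret A: cring ringA by (rule cring_ringA)
  have zero: "\<zero>\<^bsub>ringR \<alpha>\<^esub> = clsR \<alpha> 0" for \<alpha>
    by (simp add: clsR_def ringR_def FactRing_def coset_type)
  have "(quartic + constL \<alpha> * var_x ^ 2 * var_y ^ 2 dvd poly g (constL \<alpha>)) \<longleftrightarrow>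
      (\<exists>h. clsA g = clsA (h * (var_t - [:constL \<alpha>:])))" for g
  proof
    assume "quartic + constL \<alpha> * var_x ^ 2 * var_y ^ 2 dvd poly g (constL \<alpha>)"
    then obtain k where k: "poly g (constL \<alpha>) = (quartic + constL \<alpha> * var_x ^ 2 * var_y ^ 2) * k" by (elim dvdE)
    define g' where "g' = g - ([:quartic:] + var_t * [:var_x ^ 2 * var_y ^ 2:]) * [:k:]"
    have "poly g' (constL \<alpha>) = 0"
      by (simp only: g'_def poly_diff poly_mult poly_add k) (simp add: var_t_def mult.assoc)
    then have "[:- constL \<alpha>, 1:] dvd g'"
      by (simp only: poly_eq_0_iff_dvd)
    then obtain h where h: "g' = [:- constL \<alpha>, 1:] * h" ..
    have vt: "[:- constL \<alpha>, 1:] = var_t - [:constL \<alpha>:]" by (simp add: var_t_def)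
    have "[:quartic:] + var_t * [:var_x ^ 2 * var_y ^ 2:] dvd g - h * (var_t - [:constL \<alpha>:])"
    proof (rule dvdI)
      have "h * (var_t - [:constL \<alpha>:]) = g'"
        unfolding h vt by (rule mult.commute)
      then show "g - h * (var_t - [:constL \<alpha>:])
          = ([:quartic:] + var_t * [:var_x ^ 2 * var_y ^ 2:]) * [:k:]"
        by (simp only: g'_def diff_diff_eq2) (simp only: add_diff_cancel_left')
    qed
    then have "clsA g = clsA (h * (var_t - [:constL \<alpha>:]))"
      by (simp only: clsA_eq_iff)
    then show "\<exists>h. clsA g = clsA (h * (var_t - [:constL \<alpha>:]))" ..
  next
    assume "\<exists>h. clsA g = clsA (h * (var_t - [:constL \<alpha>:]))"
    then obtain h where "clsA g = clsA (h * (var_t - [:constL \<alpha>:]))" ..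
    then have "specialize \<alpha> (clsA g) = specialize \<alpha> (clsA (h * (var_t - [:constL \<alpha>:])))"
      by (rule arg_cong)
    then have "clsR \<alpha> (poly g (constL \<alpha>)) = clsR \<alpha> 0"
      by (simp only: specialize_clsA) (simp add: var_t_def)
    then show "quartic + constL \<alpha> * var_x ^ 2 * var_y ^ 2 dvd poly g (constL \<alpha>)"
      by (simp add: clsR_eq_iff)
  qed
  note iff = this
  have "specialize \<alpha> (clsA g) = \<zero>\<^bsub>ringR \<alpha>\<^esub> \<longleftrightarrow>
      (\<exists>h. clsA g = clsA h \<otimes>\<^bsub>ringA\<^esub> clsA (var_t - [:constL \<alpha>:]))" for g
    unfolding zero specialize_clsA clsR_eq_iff diff_0_right iff
    by (simp only: clsA_ops)
  note iff0 = this
  have carr: "clsA g \<in> carrier ringA" for g by (simp add: carrier_ringA)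
  have gen: "genideal ringA {clsA (var_t - [:constL \<alpha>:])}
      = {clsA h \<otimes>\<^bsub>ringA\<^esub> clsA (var_t - [:constL \<alpha>:]) |h. True}"
    unfolding A.cgenideal_eq_genideal[symmetric, OF carr] cgenideal_def carrier_ringA
    by (rule range_setcompr)
  have ker: "a_kernel ringA (ringR \<alpha>) (specialize \<alpha>)
      = {clsA g |g. specialize \<alpha> (clsA g) = \<zero>\<^bsub>ringR \<alpha>\<^esub>}"
    unfolding a_kernel_def' carrier_ringA by (rule range_filter)
  have "{clsA g |g. specialize \<alpha> (clsA g) = \<zero>\<^bsub>ringR \<alpha>\<^esub>}
      = {clsA h \<otimes>\<^bsub>ringA\<^esub> clsA (var_t - [:constL \<alpha>:]) |h. True}"
    by (rule setcompr_eq[where Q = "\<lambda>U. specialize \<alpha> U = \<zero>\<^bsub>ringR \<alpha>\<^esub>"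
          and G = "\<lambda>h. h * (var_t - [:constL \<alpha>:])"]) (rule iff0, rule clsA_ops(1))
  from trans[OF trans[OF ker this] gen[symmetric]] show ?thesis .
qed

lemma map_poly_constL_mult:
  "map_poly constL (c * d) = map_poly constL c * map_poly constL d"
proof -
  have 0: "constL 0 = 0" and add: "constL (a + b) = constL a + constL b"
    and mult: "constL (a * b) = constL a * constL b" for a b
    by (simp_all add: constL_def)
  have "constL (sum k A) = (\<Sum>i\<in>A. constL (k i))" for k and A :: "nat set"
    by (induction A rule: infinite_finite_induct) (simp_all add: 0 add)
  then show ?thesis
    by (intro poly_eqI) (simp add: coeff_map_poly coeff_mult 0 mult)
qed

lemma submonoid_multS: "submonoid multS ringA"
proof
  show "multS \<subseteq> carrier ringA"
    unfolding multS_def carrier_ringA by (intro subsetI; elim CollectE exE conjE; hypsubst; rule rangeI)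
  have "clsA (map_poly constL 1) \<in> multS"
    unfolding multS_def by (intro CollectI exI[of _ 1] conjI refl one_neq_zero)
  moreover have "map_poly constL 1 = 1"
    by (simp add: map_poly_pCons constL_def one_pCons)
  ultimately show "\<one>\<^bsub>ringA\<^esub> \<in> multS"
    by (simp only: clsA_ops)
  fix s t assume "s \<in> multS" "t \<in> multS"
  then obtain c d where cd: "s = clsA (map_poly constL c)" "t = clsA (map_poly constL d)"
      "c \<noteq> 0" "d \<noteq> 0"
    unfolding multS_def mem_Collect_eq by (elim exE conjE)
  show "s \<otimes>\<^bsub>ringA\<^esub> t \<in> multS"
    unfolding multS_def
    using cd by (intro CollectI exI[of _ "c * d"] conjI)
      (simp_all only: clsA_ops map_poly_constL_mult no_zero_divisors not_False_eq_True)
qed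

lemma localization_at_multS: "localization_at ringA multS"
  by (intro localization_at.intro cring_ringA submonoid_multS)

end

theory Submission
  imports Defs
begin

text \<open>
  Put \<open>A = x y\<close>, \<open>B = x\<^sup>3 + y\<^sup>3\<close>, so that the quartics are \<open>z\<^sup>4 + A z\<^sup>2 + B z + C\<close> with \<open>C = t A\<^sup>2\<close> or
  \<open>C = \<alpha> A\<^sup>2\<close>.  Being additive in \<open>z\<close> up to a constant, they give \<open>z\<^sup>N = a z\<^sup>2 + b z + c\<close> for \<open>N = 2\<^sup>n\<close>, with
  forms \<open>a, b, c\<close> in \<open>x, y\<close> such that \<open>B a\<close> and \<open>B b\<close> lie in \<open>(x\<^sup>N, y\<^sup>N)\<close>.  Membership in
  \<open>(x\<^sup>N, y\<^sup>N, z\<^sup>N)\<close> is thereby governed by multiplication by \<open>c\<close> modulo \<open>(x\<^sup>N, y\<^sup>N)\<close>, a Toeplitz matrix.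

  If \<open>t\<close> is transcendental, the coefficient of \<open>A\<^bsup>N / 2\<^esup>\<close> in \<open>c\<close> has larger degree in \<open>t\<close> than all others,
  so multiplication by \<open>c\<close> from degree \<open>N / 2 - 1\<close> to degree \<open>3 N / 2 - 1\<close> is bijective over \<open>L(t)\<close>; hence
  \<open>B x\<^sup>3 f\<^sup>q\<close> lies in \<open>(x\<^bsup>4 q\<^esup>, y\<^bsup>4 q\<^esup>, z\<^bsup>4 q\<^esup>)\<close> for all \<open>q\<close>.

  If \<open>\<alpha> = \<delta>\<^sup>2\<close> is algebraic, then \<open>c\<close> is the square of a form \<open>e\<close> with middle coefficient
  \<open>\<delta> + \<delta>\<^sup>2 + \<delta>\<^sup>4 + \<dots>\<close>, and this sum vanishes for some number of terms because \<open>\<delta>\<close> lies in a finite field.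
  At the first such stage \<open>e\<close>, of degree \<open>q = N / 2\<close>, is annihilated modulo \<open>(x\<^sup>q, y\<^sup>q)\<close> by a form \<open>v\<close> of degree
  \<open>q / 2 - 2\<close> whose middle coefficient does not vanish.  So \<open>w = B v\<^sup>2\<close> multiplies \<open>z\<^bsup>2 q\<^esup>\<close> into
  \<open>(x\<^bsup>2 q\<^esup>, y\<^bsup>2 q\<^esup>)\<close>, and if \<open>f\<close> were in the tight closure of \<open>I\<close>, then \<open>w f\<^bsup>q / 2\<^esup>\<close> would be in that of
  \<open>(x\<^bsup>2 q\<^esup>, y\<^bsup>2 q\<^esup>)\<close>.  Since \<open>B\<close>, the derivative of the quartic, is a test element and Frobenius is
  explicit on the basis \<open>1, z, z\<^sup>2, z\<^sup>3\<close>, this forces the middle coefficient of \<open>v\<close> to vanish.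
\<close>

section \<open>Commutative rings of characteristic two\<close>

text \<open>Characteristic two as the equation \<open>1 + 1 = 0\<close>, which polynomial rings and
  algebraic closures inherit. Minus signs disappear and squaring becomes additive.\<close>

class comm_ring_char2 = comm_ring_1 +
  assumes one_add_one_char2: "1 + 1 = 0"
begin

lemma add_self_char2 [simp]: "x + x = 0"
proof -
  have "x + x = (1 + 1) * x" by (simp only: distrib_right mult_1_left)
  then show ?thesis by (simp only: one_add_one_char2 mult_zero_left)
qed

lemma add_self_left_char2 [simp]: "x + (x + y) = y"
  by (simp add: add.assoc[symmetric])

lemma uminus_char2 [simp]: "- x = x"
  by (rule minus_unique) simp

lemma diff_char2 [simp]: "x - y = x + y"
  using diff_conv_add_uminus[of x y] by simp

lemma two_eq_0_char2 [simp]: "2 = 0"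
  by (simp only: one_add_one[symmetric] one_add_one_char2)

lemma add_eq_0_char2: "x + y = 0 \<longleftrightarrow> x = y"
  by (metis add_self_char2 add_self_left_char2 add_0_right)

lemma power2_add_char2: "(x + y) ^ 2 = x ^ 2 + y ^ 2"
  by (simp add: power2_sum)

lemma power2_sum_char2: "(sum f A) ^ 2 = (\<Sum>i\<in>A. (f i) ^ 2)"
  by (induction A rule: infinite_finite_induct) (simp_all add: power2_add_char2)

end

lemma frobenius_add_char2:
  fixes x y :: "'a :: comm_ring_char2"
  shows "(x + y) ^ 2 ^ k = x ^ 2 ^ k + y ^ 2 ^ k"
proof (induction k)
  case (Suc k)
  have "c ^ 2 ^ Suc k = (c ^ 2 ^ k) ^ 2" for c :: 'a by (simp only: power_Suc2 power_mult)
  then show ?case by (simp only: Suc.IH power2_add_char2)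
qed simp

instance poly :: (comm_ring_char2) comm_ring_char2
  by standard (simp add: one_pCons)

instance bit :: comm_ring_char2
  by standard simp

instance alg_closure :: ("{field, comm_ring_char2}") comm_ring_char2
proof
  have "to_ac (1 + 1 :: 'a) = 0" by (simp only: one_add_one_char2 to_ac_0)
  then show "1 + 1 = (0 :: 'a alg_closure)" by (simp only: to_ac_add to_ac_1)
qed

lemma sqrt_exists_alg_closed:
  fixes c :: "'a :: alg_closed_field"
  shows "\<exists>d. d ^ 2 = c"
  using nth_root_exists[of 2 c] by auto

text \<open>The off-diagonal terms cancel in pairs \<open>M a b + M b a\<close>.\<close>

lemma sum_symmetric_char2:
  fixes M :: "nat \<Rightarrow> nat \<Rightarrow> 'a :: comm_ring_char2"
  assumes "\<And>a b. a < n \<Longrightarrow> b < n \<Longrightarrow> M a b = M b a"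
  shows "(\<Sum>a<n. \<Sum>b<n. M a b) = (\<Sum>a<n. M a a)"
  using assms
proof (induction n)
  case (Suc n)
  have "(\<Sum>a<Suc n. \<Sum>b<Suc n. M a b)
      = (\<Sum>a<n. \<Sum>b<n. M a b) + (\<Sum>a<n. M a n) + ((\<Sum>b<n. M n b) + M n n)"
    by (simp add: sum.distrib)
  also have "(\<Sum>a<n. M a n) = (\<Sum>b<n. M n b)"
    using Suc.prems by (intro sum.cong) auto
  also have "(\<Sum>a<n. \<Sum>b<n. M a b) = (\<Sum>a<n. M a a)"
    using Suc.prems by (intro Suc.IH) auto
  finally show ?case by (simp add: add.assoc)
qed simp

section \<open>Linear systems over a domain\<close>

text \<open>Gaussian elimination on the last row, carried out without division so that it stays
  inside the domain.\<close>

lemma nontrivial_solution: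
  fixes M :: "nat \<Rightarrow> nat \<Rightarrow> 'a :: idom"
  shows "\<exists>x. (\<exists>j\<le>n. x j \<noteq> 0) \<and> (\<forall>i<n. (\<Sum>j\<le>n. M i j * x j) = 0)"
proof (induction n arbitrary: M)
  case 0
  show ?case by (intro exI[of _ "\<lambda>_. 1"]) auto
next
  case (Suc n)
  show ?case
  proof (cases "\<forall>j\<le>Suc n. M n j = 0")
    case True
    from Suc.IH[of "\<lambda>i j. M i j"] obtain x where x: "\<exists>j\<le>n. x j \<noteq> 0"
      "\<And>i. i < n \<Longrightarrow> (\<Sum>j\<le>n. M i j * x j) = 0" by blast
    define x' where "x' j = (if j \<le> n then x j else 0)" for j
    have "(\<Sum>j\<le>Suc n. M i j * x' j) = (\<Sum>j\<le>n. M i j * x j)" for i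
      by (simp add: x'_def)
    moreover have "(\<Sum>j\<le>Suc n. M n j * x' j) = 0" using True by simp
    ultimately show ?thesis using x
      by (intro exI[of _ x']) (auto simp: less_Suc_eq x'_def)
  next
    case False
    then obtain k where k: "k \<le> Suc n" "M n k \<noteq> 0" by auto
    \<comment> \<open>relabel the unknowns so that the pivot comes last\<close>
    define \<pi> where "\<pi> j = (if j = k then Suc n else if j = Suc n then k else j)" for j
    have \<pi>: "\<pi> (\<pi> j) = j" for j by (auto simp: \<pi>_def)
    have bij: "bij_betw \<pi> {..Suc n} {..Suc n}"
      by (rule bij_betwI[of _ _ _ \<pi>]) (use k(1) in \<open>auto simp: \<pi>_def\<close>)
    define K where "K i j = M i (\<pi> j)" for i j
    have p: "K n (Suc n) \<noteq> 0" using k by (simp add: K_def \<pi>_def)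
    \<comment> \<open>Cross-multiplication with the pivot row eliminates the last unknown. The other
      unknowns are then scaled by the pivot, so that the pivot row determines the last one without
      division.\<close>
    from Suc.IH[of "\<lambda>i j. K n (Suc n) * K i j - K i (Suc n) * K n j"] obtain x where
      x: "\<exists>j\<le>n. x j \<noteq> 0" "\<And>i. i < n \<Longrightarrow>
        (\<Sum>j\<le>n. (K n (Suc n) * K i j - K i (Suc n) * K n j) * x j) = 0" by blast
    define x' where "x' j = (if j \<le> n then K n (Suc n) * x j else - (\<Sum>j\<le>n. K n j * x j))" for j
    have s: "(\<Sum>j\<le>Suc n. K i j * x' j)
        = (\<Sum>j\<le>n. (K n (Suc n) * K i j - K i (Suc n) * K n j) * x j)" for i
      by (simp add: x'_def sum_distrib_left sum_subtractf algebra_simps)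
    have "(\<Sum>j\<le>Suc n. K n j * x' j) = 0"
      unfolding s by (simp add: mult.commute)
    then have z: "(\<Sum>j\<le>Suc n. K i j * x' j) = 0" if "i < Suc n" for i
      using that x(2) s by (cases "i = n") auto
    have "(\<Sum>j\<le>Suc n. M i j * x' (\<pi> j)) = (\<Sum>j\<le>Suc n. K i j * x' j)" for i
      using sum.reindex_bij_betw[OF bij, of "\<lambda>j. M i j * x' (\<pi> j)"] by (simp add: K_def \<pi>)
    moreover obtain j where "j \<le> n" "x j \<noteq> 0" using x(1) by blast
    then have "\<pi> j \<le> Suc n \<and> x' (\<pi> (\<pi> j)) \<noteq> 0"
      using p bij_betw_apply[OF bij, of j] by (simp add: \<pi> x'_def)
    ultimately show ?thesis
      using z by (intro exI[of _ "x' \<circ> \<pi>"]) auto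
  qed
qed

section \<open>The Toeplitz systems\<close>

text \<open>\<open>eps \<delta> m i\<close> is the coefficient of \<open>x\<^sup>i y\<^bsup>q - i\<^esup>\<close>, \<open>q = 2\<^sup>m\<close>, in a form of degree \<open>q\<close>
  (lemma \<open>zc_plus_form_eps\<close>), and \<open>trs \<delta> m = \<delta> + \<delta>\<^sup>2 + \<delta>\<^sup>4 + \<dots>\<close> (\<open>m\<close> terms) is its middle coefficient.
  The Toeplitz matrix with entries \<open>eps \<delta> m (q / 2 + b - a)\<close>, \<open>a, b < q / 2\<close>, describes
  multiplication by this form from degree \<open>q / 2 - 1\<close> to degree \<open>3 q / 2 - 1\<close> modulo \<open>(x\<^sup>q, y\<^sup>q)\<close>.\<close>

fun eps :: "'a \<Rightarrow> nat \<Rightarrow> nat \<Rightarrow> 'a :: comm_ring_char2" where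
  "eps \<delta> 0 i = 0"
| "eps \<delta> (Suc m) i = (if 3 dvd i + 2 ^ Suc m then \<delta> else 0)
     + (if even i then (eps \<delta> m (i div 2)) ^ 2 else 0)"

fun trs :: "'a \<Rightarrow> nat \<Rightarrow> 'a :: comm_ring_char2" where
  "trs \<delta> 0 = 0"
| "trs \<delta> (Suc m) = \<delta> + (trs \<delta> m) ^ 2"

text \<open>Both \<open>x y\<close> and \<open>x^3 + y^3\<close> are unchanged when \<open>x\<close>
  is multiplied by a cube root of unity and \<open>y\<close> by its inverse. A form of degree
  \<open>2 ^ m\<close> built from them has its exponents of \<open>x\<close> in a single class mod
  3.\<close>

lemma eps_support: "\<not> 3 dvd i + 2 ^ m \<Longrightarrow> eps \<delta> m i = 0"
proof (induction m arbitrary: i)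
  case (Suc m)
  have "eps \<delta> m (i div 2) = 0" if "even i"
  proof (rule Suc.IH)
    from that obtain j where j: "i = 2 * j" by blast
    have "3 dvd (2::nat) * (j + 2 ^ m) \<longleftrightarrow> 3 dvd j + 2 ^ m"
      by (rule coprime_dvd_mult_right_iff) simp
    then show "\<not> 3 dvd i div 2 + 2 ^ m"
      using Suc.prems by (simp add: j)
  qed
  then show ?case using Suc.prems by simp
qed simp

text \<open>Reflects the symmetry of \<open>x y\<close> and \<open>x^3 + y^3\<close> under exchange
  of \<open>x\<close> and \<open>y\<close>; both summands of the recursion respect it.\<close>

lemma eps_reflect: "i \<le> 2 ^ m \<Longrightarrow> eps \<delta> m (2 ^ m - i) = eps \<delta> m i"
proof (induction m arbitrary: i)
  case (Suc m)
  have "3 dvd (2 ^ Suc m - i) + 2 ^ Suc m \<longleftrightarrow> 3 dvd i + (2::nat) ^ Suc m"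
  proof -
    have "(2 ^ Suc m - i) + 2 ^ Suc m + (i + 2 ^ Suc m) = 3 * (2::nat) ^ Suc m"
      using Suc.prems by simp
    then show ?thesis by (metis dvd_add_right_iff dvd_add_left_iff dvd_triv_left)
  qed
  moreover have "even (2 ^ Suc m - i) \<longleftrightarrow> even i"
    using Suc.prems by simp
  moreover have "eps \<delta> m ((2 ^ Suc m - i) div 2) = eps \<delta> m (i div 2)" if ev: "even i"
  proof -
    have "(2 ^ Suc m - i) div 2 = 2 ^ m - i div 2" using ev by auto
    then show ?thesis using Suc.prems by (simp add: Suc.IH)
  qed
  ultimately show ?case by (auto simp del: power_Suc)
qed simp

text \<open>Beyond the first stage the middle index is even and halves to the middle index one stage
  below, so the recursion of \<open>eps\<close> becomes that of \<open>trs\<close>.\<close>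

lemma eps_middle: "eps \<delta> (Suc m) (2 ^ m) = trs \<delta> (Suc m)"
proof (induction m)
  case (Suc m)
  have "3 dvd (2::nat) ^ Suc m + 2 ^ Suc (Suc m)" by simp
  moreover have "even ((2::nat) ^ Suc m)" "(2::nat) ^ Suc m div 2 = 2 ^ m" by simp_all
  ultimately show ?case
    unfolding eps.simps(2)[of \<delta> "Suc m"] using Suc.IH by (simp del: eps.simps)
qed (simp add: numeral_3_eq_3[symmetric])

text \<open>Together with \<open>eps_support\<close>, for \<open>M = 2 ^ m\<close>: the Toeplitz
  matrix has no entries between different classes mod 3.\<close>

lemma dvd_3_shift_iff:
  fixes a b M :: nat
  assumes "a < M"
  shows "3 dvd (M + b - a) + 2 * M \<longleftrightarrow> a mod 3 = b mod 3"
proof -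
  have "int ((M + b - a) + 2 * M) = 3 * int M + (int b - int a)"
    using assms by (simp add: of_nat_diff)
  then have "int 3 dvd int ((M + b - a) + 2 * M) \<longleftrightarrow> 3 dvd int b - int a"
    by (simp only: of_nat_numeral dvd_add_right_iff[OF dvd_triv_left])
  also have "\<dots> \<longleftrightarrow> int b mod int 3 = int a mod int 3"
    by (simp only: mod_eq_dvd_iff of_nat_numeral)
  finally show ?thesis
    by (simp only: int_dvd_int_iff of_nat_mod[symmetric] of_nat_eq_iff eq_commute)
qed

text \<open>The quadratic form of a Toeplitz matrix with palindromic symbol is, in characteristic two, the
  diagonal entry times a square.\<close>

lemma toeplitz_class_sum:
  fixes \<delta> :: "'a :: {idom, comm_ring_char2}"
  assumes "trs \<delta> (Suc m) \<noteq> 0"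
    and ker: "\<And>b. b < 2 ^ m \<Longrightarrow> (\<Sum>a<2 ^ m. w a * eps \<delta> (Suc m) (2 ^ m + b - a)) = 0"
  shows "(\<Sum>a<2 ^ m. if a mod 3 = r then w a else 0) = 0"
proof -
  define u where "u a = (if a mod 3 = r then w a else 0)" for a
  define M where "M b a = u b * u a * eps \<delta> (Suc m) (2 ^ m + b - a)" for a b
  \<comment> \<open>A row in class \<open>r\<close> sees only the part \<open>u\<close> of
    \<open>w\<close>; all other rows are killed by the factor \<open>u b\<close>.\<close>
  have row: "(\<Sum>a<2 ^ m. M b a) = 0" if b: "b < 2 ^ m" for b
  proof (cases "b mod 3 = r")
    case True
    have "u a * eps \<delta> (Suc m) (2 ^ m + b - a) = w a * eps \<delta> (Suc m) (2 ^ m + b - a)"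
      if a: "a < 2 ^ m" for a
    proof (cases "a mod 3 = r")
      case False
      then have "\<not> 3 dvd (2 ^ m + b - a) + (2::nat) ^ Suc m"
        using dvd_3_shift_iff[OF a, of b] True by simp
      then show ?thesis using eps_support[of _ "Suc m" \<delta>] by (metis mult_zero_right)
    qed (simp add: u_def)
    then have "(\<Sum>a<2 ^ m. M b a) = u b * (\<Sum>a<2 ^ m. w a * eps \<delta> (Suc m) (2 ^ m + b - a))"
      unfolding M_def sum_distrib_left by (intro sum.cong refl) (simp only: lessThan_iff mult.assoc)
    then show ?thesis by (simp only: ker[OF b] mult_zero_right)
  qed (simp add: M_def u_def)
  have "0 = (\<Sum>b<2 ^ m. \<Sum>a<2 ^ m. M b a)" using row by simp
  also have "\<dots> = (\<Sum>a<2 ^ m. M a a)"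
  proof (rule sum_symmetric_char2)
    fix a b :: nat assume ab: "a < 2 ^ m" "b < 2 ^ m"
    have "2 ^ Suc m - (2 ^ m + b - a) = 2 ^ m + a - b" "2 ^ m + b - a \<le> 2 ^ Suc m" using ab by simp_all
    then have "eps \<delta> (Suc m) (2 ^ m + b - a) = eps \<delta> (Suc m) (2 ^ m + a - b)"
      using eps_reflect[of "2 ^ m + b - a" "Suc m" \<delta>] by (simp only:)
    then show "M a b = M b a" by (simp only: M_def mult.commute[of "u a"])
  qed
  also have "\<dots> = (\<Sum>a<2 ^ m. (u a) ^ 2 * trs \<delta> (Suc m))"
    unfolding M_def by (intro sum.cong refl)
      (simp only: add_diff_cancel_right' eps_middle power2_eq_square)
  also have "\<dots> = (\<Sum>a<2 ^ m. u a) ^ 2 * trs \<delta> (Suc m)"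
    by (simp only: power2_sum_char2 sum_distrib_right)
  finally show ?thesis using assms(1) unfolding u_def[symmetric] by simp
qed

lemma sum_parity_class:
  fixes f :: "nat \<Rightarrow> 'a :: comm_monoid_add"
  assumes "p < 2"
  shows "(\<Sum>a<2 * n. if even (a + p) then f a else 0) = (\<Sum>a<n. f (2 * a + p))"
proof (induction n)
  case (Suc n)
  have "(\<Sum>a<2 * Suc n. if even (a + p) then f a else 0)
     = (\<Sum>a<2 * n. if even (a + p) then f a else 0) + f (2 * n + p)"
    using assms by (cases "p = 0") (auto simp: less_2_cases_iff)
  then show ?case unfolding Suc.IH by simp
qed simp

text \<open>The summand \<open>\<delta>\<close> of \<open>eps\<close> contributes only class sums,
  which vanish. What remains couples indices of equal parity and is there the entrywise square of
  the matrix one stage below, so square roots of the even and the odd half of \<open>w\<close> each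
  solve the smaller system.\<close>

lemma toeplitz_parity_step:
  fixes \<delta> :: "'a :: {alg_closed_field, comm_ring_char2}"
  assumes inj: "\<And>w :: nat \<Rightarrow> 'a. (\<And>b. b < 2 ^ m \<Longrightarrow>
      (\<Sum>a<2 ^ m. w a * eps \<delta> (Suc m) (2 ^ m + b - a)) = 0) \<Longrightarrow> \<forall>a<2 ^ m. w a = 0"
    and classes: "\<And>r. (\<Sum>a<2 ^ Suc m. if a mod 3 = r then w a else 0) = 0"
    and ker: "\<And>b. b < 2 ^ Suc m \<Longrightarrow>
      (\<Sum>a<2 ^ Suc m. w a * eps \<delta> (Suc (Suc m)) (2 ^ Suc m + b - a)) = 0"
  shows "\<forall>a<2 ^ Suc m. w a = 0"
proof -
  define rt where "rt c = (SOME d. d ^ 2 = c)" for c :: 'a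
  have rt: "(rt c) ^ 2 = c" for c unfolding rt_def by (rule someI_ex) (rule sqrt_exists_alg_closed)
  have "\<forall>a<2 ^ m. w (2 * a + p) = 0" if p: "p < 2" for p
  proof -
    have "\<forall>a<2 ^ m. rt (w (2 * a + p)) = 0"
    proof (rule inj)
      fix b :: nat assume b: "b < 2 ^ m"
      define B where "B = 2 * b + p"
      have B: "B < 2 ^ Suc m" using b p by (simp add: B_def)
      define f where "f a = w a * (eps \<delta> (Suc m) ((2 ^ Suc m + B - a) div 2)) ^ 2" for a
      have summand: "w a * eps \<delta> (Suc (Suc m)) (2 ^ Suc m + B - a)
          = \<delta> * (if a mod 3 = B mod 3 then w a else 0) + (if even (a + p) then f a else 0)"
        if a: "a < 2 ^ Suc m" for a
      proof -
        have "3 dvd (2 ^ Suc m + B - a) + (2::nat) ^ Suc (Suc m) \<longleftrightarrow> a mod 3 = B mod 3"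
          using dvd_3_shift_iff[OF a, of B] by (simp only: power_Suc)
        moreover have "even (2 ^ Suc m + B - a) \<longleftrightarrow> even (a + p)"
          using a by (auto simp: B_def even_diff_nat)
        ultimately show ?thesis
          unfolding eps.simps(2)[of \<delta> "Suc m"] f_def by (simp add: distrib_left mult.commute)
      qed
      have "0 = (\<Sum>a<2 ^ Suc m. w a * eps \<delta> (Suc (Suc m)) (2 ^ Suc m + B - a))"
        using ker[OF B] by simp
      also have "\<dots> = \<delta> * (\<Sum>a<2 ^ Suc m. if a mod 3 = B mod 3 then w a else 0)
          + (\<Sum>a<2 ^ Suc m. if even (a + p) then f a else 0)"
        unfolding sum_distrib_left sum.distrib[symmetric]
        by (intro sum.cong refl) (simp only: lessThan_iff summand)
      also have "\<dots> = (\<Sum>a<2 * 2 ^ m. if even (a + p) then f a else 0)"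
        by (simp only: classes) simp
      also have "\<dots> = (\<Sum>a<2 ^ m. f (2 * a + p))"
        by (rule sum_parity_class[OF p])
      also have "\<dots> = (\<Sum>a<2 ^ m. (rt (w (2 * a + p)) * eps \<delta> (Suc m) (2 ^ m + b - a)) ^ 2)"
      proof (intro sum.cong refl)
        fix a assume "a \<in> {..<(2::nat) ^ m}"
        then have "(2 ^ Suc m + B - (2 * a + p)) div 2 = 2 ^ m + b - a" by (simp add: B_def)
        then show "f (2 * a + p) = (rt (w (2 * a + p)) * eps \<delta> (Suc m) (2 ^ m + b - a)) ^ 2"
          by (simp only: f_def power_mult_distrib rt)
      qed
      finally show "(\<Sum>a<2 ^ m. rt (w (2 * a + p)) * eps \<delta> (Suc m) (2 ^ m + b - a)) = 0"
        by (simp only: power2_sum_char2[symmetric]) simp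
    qed
    then show ?thesis using rt by (metis zero_power2)
  qed
  note half = this
  show ?thesis
  proof (intro allI impI)
    fix a :: nat assume "a < 2 ^ Suc m"
    then have "a div 2 < 2 ^ m" by auto
    then show "w a = 0" using half[of "a mod 2"] by (auto simp: mult.commute)
  qed
qed

text \<open>Induction from the one-by-one matrix with entry \<open>\<delta>\<close>: the nonzero
  diagonal forces the class sums to vanish, and the parity step descends.\<close>

lemma toeplitz_injective:
  fixes \<delta> :: "'a :: {alg_closed_field, comm_ring_char2}"
  assumes "\<And>k. 1 \<le> k \<Longrightarrow> k \<le> Suc m \<Longrightarrow> trs \<delta> k \<noteq> 0"
    and "\<And>b. b < 2 ^ m \<Longrightarrow> (\<Sum>a<2 ^ m. w a * eps \<delta> (Suc m) (2 ^ m + b - a)) = 0"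
  shows "\<forall>a<2 ^ m. w a = 0"
  using assms
proof (induction m arbitrary: w)
  case 0
  have "trs \<delta> (Suc 0) \<noteq> 0" by (rule "0.prems"(1)) simp_all
  then have "\<delta> \<noteq> 0" by simp
  moreover have "w 0 * eps \<delta> (Suc 0) 1 = 0" using "0.prems"(2)[of 0] by (simp del: eps.simps)
  ultimately show ?case by (simp add: numeral_3_eq_3[symmetric])
next
  case (Suc m)
  show ?case
  proof (rule toeplitz_parity_step[of m \<delta> w])
    fix w' :: "nat \<Rightarrow> 'a"
    assume "\<And>b. b < 2 ^ m \<Longrightarrow> (\<Sum>a<2 ^ m. w' a * eps \<delta> (Suc m) (2 ^ m + b - a)) = 0"
    then show "\<forall>a<2 ^ m. w' a = 0"
    proof (intro Suc.IH)
      fix k assume "1 \<le> k" "k \<le> Suc m"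
      then show "trs \<delta> k \<noteq> 0" using Suc.prems(1)[of k] by linarith
    qed
  next
    show "(\<Sum>a<2 ^ Suc m. if a mod 3 = r then w a else 0) = 0" for r
    proof (rule toeplitz_class_sum)
      show "trs \<delta> (Suc (Suc m)) \<noteq> 0" by (rule Suc.prems(1)) simp_all
    qed (rule Suc.prems(2))
  qed (rule Suc.prems(2))
qed

section \<open>The Toeplitz kernel at the first zero of the trace sequence\<close>

lemma sum_int_symmetric:
  fixes f :: "int \<Rightarrow> 'a :: comm_monoid_add"
  shows "(\<Sum>j = - int J..int J. f j) = f 0 + (\<Sum>j<J. f (int (Suc j)) + f (- int (Suc j)))"
proof (induction J)
  case (Suc J)
  have "{- int (Suc J)..int (Suc J)} = insert (- int (Suc J)) (insert (int (Suc J)) {- int J..int J})"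
    by auto
  then show ?case by (simp add: Suc.IH add_ac)
qed simp

lemma not_3_dvd_power_2: "\<not> 3 dvd (2::int) ^ n"
proof (induction n)
  case (Suc n)
  have "3 dvd (2::int) * 2 ^ n \<longleftrightarrow> 3 dvd (2::int) ^ n"
    by (rule coprime_dvd_mult_right_iff) simp
  then show ?case using Suc by simp
qed simp

lemma mod_3_eq_iff_dvd: "a mod 3 = b mod 3 \<longleftrightarrow> 3 dvd int a - int b"
proof -
  have "int a mod int 3 = int b mod int 3 \<longleftrightarrow> 3 dvd int a - int b"
    by (simp only: mod_eq_dvd_iff of_nat_numeral)
  then show ?thesis by (simp only: of_nat_mod[symmetric] of_nat_eq_iff)
qed

text \<open>On symmetric vectors the equation in the middle row holds automatically, which leaves one
  equation less than there are unknowns.  If the middle entry of the solution vanished, then so would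
  its class sums, and the parity reduction would force it to be zero.\<close>

lemma toeplitz_kernel:
  fixes \<delta> :: "'a :: {alg_closed_field, comm_ring_char2}"
  assumes nz: "\<And>k. 1 \<le> k \<Longrightarrow> k \<le> Suc n \<Longrightarrow> trs \<delta> k \<noteq> 0"
    and zero: "trs \<delta> (Suc (Suc n)) = 0"
  obtains v :: "nat \<Rightarrow> 'a" where "v (2 ^ n - 1) \<noteq> 0"
    "\<And>p. 2 ^ Suc n - 1 \<le> p \<Longrightarrow> p < 2 ^ Suc (Suc n) \<Longrightarrow>
       (\<Sum>a<2 ^ Suc n - 1. v a * eps \<delta> (Suc (Suc n)) (p - a)) = 0"
proof -
  \<comment> \<open>The middle of the index range \<open>0..2 * c\<close> of \<open>v\<close>. The
    solution is supported on the class of \<open>c\<close> mod 3, that is on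
    \<open>c + 3 * j\<close> with \<open>\<bar>j\<bar> \<le> J\<close>.\<close>
  define c where "c = int (2 ^ n) - 1"
  define J where "J = nat (c div 3)"
  have c0: "c \<ge> 0" by (simp add: c_def)
  have J: "int J = c div 3" using c0 by (simp add: J_def)
  have J3: "3 * int J \<le> c" using J by presburger
  have leJ: "\<bar>l\<bar> \<le> int J" if "\<bar>3 * l\<bar> \<le> c" for l using that J by presburger
  \<comment> \<open>The coefficients indexed by their offset from the middle one.\<close>
  define E where "E z = eps \<delta> (Suc (Suc n)) (nat (2 ^ Suc n + z))" for z :: int
  have E_neg: "E (- z) = E z" if "\<bar>z\<bar> \<le> 2 ^ Suc n" for z
  proof -
    have "nat (2 ^ Suc n + z) \<le> 2 ^ Suc (Suc n)"
      using that by (subst nat_le_iff) simp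
    moreover have "int (nat (2 ^ Suc n + - z) + nat (2 ^ Suc n + z)) = int (2 ^ Suc (Suc n))"
      using that by (simp add: abs_le_iff)
    then have "nat (2 ^ Suc n + - z) + nat (2 ^ Suc n + z) = 2 ^ Suc (Suc n)"
      by (simp only: of_nat_eq_iff)
    then have "2 ^ Suc (Suc n) - nat (2 ^ Suc n + z) = nat (2 ^ Suc n + - z)"
      by linarith
    ultimately show ?thesis
      using eps_reflect[of "nat (2 ^ Suc n + z)" "Suc (Suc n)" \<delta>] by (simp only: E_def)
  qed
  have E_0: "E 0 = 0"
    using eps_middle[of \<delta> "Suc n"] zero unfolding E_def by (simp del: eps.simps trs.simps add: nat_power_eq nat_mult_distrib)
  have E_support: "E z = 0" if "\<not> 3 dvd z" "\<bar>z\<bar> \<le> 2 ^ Suc n" for z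
  proof -
    have "int (nat (2 ^ Suc n + z) + 2 ^ Suc (Suc n)) = 3 * 2 ^ Suc n + z"
      using that(2) by simp
    then have "\<not> 3 dvd int (nat (2 ^ Suc n + z) + 2 ^ Suc (Suc n))"
      using that(1) by (simp add: dvd_add_right_iff)
    then have "\<not> 3 dvd nat (2 ^ Suc n + z) + 2 ^ Suc (Suc n)" by presburger
    then show ?thesis unfolding E_def by (rule eps_support)
  qed
  have c_lt: "2 * c + 2 = 2 ^ Suc n" by (simp add: c_def)
  have lt_iff: "a < 2 ^ Suc n - 1 \<longleftrightarrow> int a \<le> 2 * c" for a
  proof -
    have "int (2 ^ Suc n - 1) = 2 * c + 1" using c_lt by (simp add: of_nat_diff)
    then have "int a < int (2 ^ Suc n - 1) \<longleftrightarrow> int a \<le> 2 * c" by linarith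
    then show ?thesis by (simp only: of_nat_less_iff)
  qed
  \<comment> \<open>The system folded by symmetry: \<open>u j\<close> stands for the entries at
    \<open>j\<close> and \<open>- j\<close>, and row \<open>i\<close> for the equation at
    \<open>i + 1\<close>. The equation at 0 is left out, so \<open>J\<close> equations face
    \<open>J + 1\<close> unknowns.\<close>
  define M where "M i j = (if j = 0 then E (3 * int (Suc i))
      else E (3 * (int (Suc i) - int j)) + E (3 * (int (Suc i) + int j)))" for i j
  obtain u where u: "\<exists>j\<le>J. u j \<noteq> 0" "\<And>i. i < J \<Longrightarrow> (\<Sum>j\<le>J. M i j * u j) = 0"
    using nontrivial_solution[of J M] by blast
  define V where "V j = u (nat \<bar>j\<bar>)" for j :: int
  have V_neg: "V (- j) = V j" for j by (simp add: V_def)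
  have eqs: "(\<Sum>j = - int J..int J. V j * E (3 * (l - j))) = 0" if l: "\<bar>l\<bar> \<le> int J" for l
  proof -
    have bd: "\<bar>3 * (i - j)\<bar> \<le> 2 ^ Suc n" if "\<bar>i\<bar> \<le> int J" "\<bar>j\<bar> \<le> int J" for i j
      using that[unfolded abs_le_iff] J3 unfolding c_lt[symmetric] abs_le_iff by auto
    have pos: "(\<Sum>j = - int J..int J. V j * E (3 * (l - j))) = 0" if l: "0 < l" "l \<le> int J" for l
    proof -
      define i where "i = nat l - 1"
      have i: "i < J" "l = int (Suc i)" using l by (auto simp: i_def)
      have "(\<Sum>j\<le>J. M i j * u j) = M i 0 * u 0 + (\<Sum>j<J. M i (Suc j) * u (Suc j))"
        by (simp add: sum.atMost_shift)
      also have "\<dots> = (\<Sum>j = - int J..int J. V j * E (3 * (l - j)))"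
      proof -
        have "nat (1 + int j) = Suc j" "nat \<bar>- 1 - int j\<bar> = Suc j" for j by auto
        then show ?thesis
          unfolding sum_int_symmetric by (simp add: M_def i V_def algebra_simps)
      qed
      finally show ?thesis using u(2)[OF i(1)] by simp
    qed
    consider "0 < l" | "l = 0" | "0 < - l" by linarith
    then show ?thesis
    proof cases
      case 2
      \<comment> \<open>In the middle row the terms at opposite indices are equal and cancel, and
        \<open>E 0\<close> is the vanishing trace.\<close>
      have "V (int (Suc j)) * E (3 * (l - int (Suc j))) + V (- int (Suc j)) * E (3 * (l - - int (Suc j))) = 0"
        if j: "j < J" for j
      proof -
        have "\<bar>3 * int (Suc j)\<bar> \<le> 2 ^ Suc n" using bd[of 0 "int (Suc j)"] j by simp
        from E_neg[OF this] show ?thesis unfolding V_neg 2 by (simp add: algebra_simps)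
      qed
      then show ?thesis unfolding sum_int_symmetric 2 by (simp add: E_0)
    next
      case 3
      have "(\<Sum>j = - int J..int J. V j * E (3 * (l - j)))
          = (\<Sum>j = - int J..int J. V j * E (3 * (- l - j)))"
      proof (rule sum.reindex_bij_witness[of _ uminus uminus])
        fix j assume "j \<in> {- int J..int J}"
        then have "E (- (3 * (l - j))) = E (3 * (l - j))"
          using l by (intro E_neg bd) auto
        then show "V (- j) * E (3 * (- l - - j)) = V j * E (3 * (l - j))"
          by (simp add: V_neg algebra_simps)
      qed auto
      then show ?thesis using pos[of "- l"] 3 l by simp
    qed (use l pos in auto)
  qed
  define v where "v a = (if int a \<le> 2 * c \<and> 3 dvd int a - c then V ((int a - c) div 3) else 0)" for a
  have v_at: "v (nat (c + 3 * j)) = V j" if "\<bar>j\<bar> \<le> int J" for j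
  proof -
    have "0 \<le> c + 3 * j" "c + 3 * j \<le> 2 * c" using that J3 by (auto simp: abs_le_iff)
    then show ?thesis by (simp add: v_def)
  qed
  have reindex: "(\<Sum>a<2 ^ Suc n - 1. if 3 dvd int a - c then f (int a) else 0)
      = (\<Sum>j = - int J..int J. f (c + 3 * j))" for f :: "int \<Rightarrow> 'a"
  proof -
    have "(\<Sum>a<2 ^ Suc n - 1. if 3 dvd int a - c then f (int a) else 0)
        = (\<Sum>a | a < 2 ^ Suc n - 1 \<and> 3 dvd int a - c. f (int a))"
      by (intro sum.mono_neutral_cong_right) auto
    also have "\<dots> = (\<Sum>j = - int J..int J. f (c + 3 * j))"
    proof (rule sum.reindex_bij_witness[of _ "\<lambda>j. nat (c + 3 * j)" "\<lambda>a. (int a - c) div 3"])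
      fix a assume a: "a \<in> {a. a < 2 ^ Suc n - 1 \<and> 3 dvd int a - c}"
      then obtain j where j: "int a - c = 3 * j" by (auto elim: dvdE)
      have ia: "c + 3 * j = int a" using j by simp
      have three: "(3::int) \<noteq> 0" by simp
      have "int a \<le> 2 * c" using a by (simp only: mem_Collect_eq lt_iff)
      then have "\<bar>j\<bar> \<le> int J" by (intro leJ) (use j in linarith)
      then show "(int a - c) div 3 \<in> {- int J..int J}" unfolding j by auto
      show "nat (c + 3 * ((int a - c) div 3)) = a" "f (c + 3 * ((int a - c) div 3)) = f (int a)"
        unfolding j nonzero_mult_div_cancel_left[OF three] ia by simp_all
    next
      fix j assume j: "j \<in> {- int J..int J}"
      then have b: "0 \<le> c + 3 * j" "c + 3 * j \<le> 2 * c" using J3 by auto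
      then show "(int (nat (c + 3 * j)) - c) div 3 = j" by simp
      have "nat (c + 3 * j) < 2 ^ Suc n - 1" unfolding lt_iff using b by simp
      then show "nat (c + 3 * j) \<in> {a. a < 2 ^ Suc n - 1 \<and> 3 dvd int a - c}" using b by simp
    qed
    finally show ?thesis .
  qed
  have ker: "(\<Sum>a<2 ^ Suc n - 1. v a * eps \<delta> (Suc (Suc n)) (p - a)) = 0"
    if p: "2 ^ Suc n - 1 \<le> p" "p < 2 ^ Suc (Suc n)" for p
  proof -
    define r where "r = int p - 2 ^ Suc n - c"
    have pw: "int (2 ^ Suc n) = 2 * c + 2" "int (2 ^ Suc (Suc n)) = 4 * c + 4" "(2::int) ^ Suc n = 2 * c + 2"
      using c_lt by simp_all
    have r: "- (c + 1) \<le> r" "r \<le> c + 1"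
      using p pw unfolding r_def by linarith+
    have summand: "v a * eps \<delta> (Suc (Suc n)) (p - a)
        = (if 3 dvd int a - c then V ((int a - c) div 3) * E (r - (int a - c)) else 0)"
      if a: "a < 2 ^ Suc n - 1" for a
    proof -
      have a': "int a \<le> 2 * c" using a by (simp only: lt_iff)
      have "p - a = nat (2 ^ Suc n + (r - (int a - c)))"
        using a p unfolding r_def by simp
      then show ?thesis using a' by (simp only: v_def E_def) simp
    qed
    have "(\<Sum>a<2 ^ Suc n - 1. v a * eps \<delta> (Suc (Suc n)) (p - a))
        = (\<Sum>a<2 ^ Suc n - 1. if 3 dvd int a - c
            then V ((int a - c) div 3) * E (r - (int a - c)) else 0)"
      by (intro sum.cong refl) (simp only: lessThan_iff summand)
    also have "\<dots> = (\<Sum>j = - int J..int J. V j * E (r - 3 * j))"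
      by (subst reindex[of "\<lambda>x. V ((x - c) div 3) * E (r - (x - c))"]) simp
    also have "\<dots> = 0"
    proof (cases "3 dvd r")
      case True
      then obtain l where l: "r = 3 * l" ..
      \<comment> \<open>The range of \<open>p\<close> lets \<open>\<bar>r\<bar>\<close> reach
        \<open>c + 1\<close>, but this is a power of two and so not a multiple of 3.\<close>
      have "\<bar>3 * l\<bar> \<noteq> c + 1"
        using not_3_dvd_power_2[of n] by (auto simp: c_def abs_if split: if_splits)
          (metis dvd_triv_left mult_minus_right)+
      then have "\<bar>l\<bar> \<le> int J" using r l by (intro leJ) linarith
      from eqs[OF this] show ?thesis by (simp add: l algebra_simps)
    next
      case False
      have "E (r - 3 * j) = 0" if "j \<in> {- int J..int J}" for j
      proof (rule E_support)
        show "\<not> 3 dvd r - 3 * j" using False by presburger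
        show "\<bar>r - 3 * j\<bar> \<le> 2 ^ Suc n" using that r J3 pw by auto
      qed
      then show ?thesis by simp
    qed
    finally show ?thesis .
  qed
  have "V 0 \<noteq> 0"
  proof
    assume V0: "V 0 = 0"
    \<comment> \<open>One more zero entry extends \<open>v\<close> to length
      \<open>2 ^ Suc n\<close>, to which the parity step applies.\<close>
    have top: "v (2 ^ Suc n - 1) = 0"
      using c_lt by (simp add: v_def of_nat_diff)
    have split: "(\<Sum>a<2 ^ Suc n. f a) = (\<Sum>a<2 ^ Suc n - 1. f a) + f (2 ^ Suc n - 1)"
      for f :: "nat \<Rightarrow> 'a"
      using sum.lessThan_Suc[of f "2 ^ Suc n - 1"] by simp
    have "\<forall>a<2 ^ Suc n. v a = 0"
    proof (rule toeplitz_parity_step)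
      show "\<forall>a<2 ^ n. w a = 0" if "\<And>b. b < 2 ^ n \<Longrightarrow>
          (\<Sum>a<2 ^ n. w a * eps \<delta> (Suc n) (2 ^ n + b - a)) = 0" for w
        using toeplitz_injective[OF _ that] nz by blast
      show "(\<Sum>a<2 ^ Suc n. v a * eps \<delta> (Suc (Suc n)) (2 ^ Suc n + b - a)) = 0"
        if "b < 2 ^ Suc n" for b
      proof -
        have "2 ^ Suc n - 1 \<le> 2 ^ Suc n + b" "2 ^ Suc n + b < 2 ^ Suc (Suc n)" using that by simp_all
        from ker[OF this] show ?thesis unfolding split top by (simp only: mult_zero_left add_0_right)
      qed
      show "(\<Sum>a<2 ^ Suc n. if a mod 3 = r then v a else 0) = 0" for r
      proof (cases "r = nat c mod 3")
        case True
        have three: "(3::int) \<noteq> 0" by simp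
        have "(if a mod 3 = r then v a else 0)
            = (if 3 dvd int a - c then V ((int a - c) div 3) else 0)" if a: "a < 2 ^ Suc n - 1" for a
        proof -
          have "int a \<le> 2 * c" using a by (simp only: lt_iff)
          moreover have "a mod 3 = r \<longleftrightarrow> 3 dvd int a - c"
            unfolding True mod_3_eq_iff_dvd using c0 by simp
          ultimately show ?thesis by (simp add: v_def)
        qed
        then have "(\<Sum>a<2 ^ Suc n. if a mod 3 = r then v a else 0)
            = (\<Sum>j = - int J..int J. V ((c + 3 * j - c) div 3))"
          unfolding split top by (subst reindex[symmetric]) (auto intro: sum.cong)
        also have "\<dots> = 0"
          unfolding sum_int_symmetric
          by (simp only: add_diff_cancel_left' nonzero_mult_div_cancel_left[OF three] V0 V_neg
              add_self_char2 sum.neutral_const add_0_left)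
        finally show ?thesis .
      next
        case False
        have "(if a mod 3 = r then v a else 0) = 0" for a
        proof (cases "a mod 3 = r")
          case True
          then have "\<not> 3 dvd int a - c" using False c0 mod_3_eq_iff_dvd[of a "nat c"] by simp
          then show ?thesis by (simp add: v_def)
        qed simp
        then show ?thesis by (simp only: sum.neutral_const)
      qed
    qed
    moreover obtain j where j: "j \<le> J" "u j \<noteq> 0" using u(1) by blast
    then have "v (nat (c + 3 * int j)) \<noteq> 0" using v_at[of "int j"] by (simp add: V_def)
    moreover have "nat (c + 3 * int j) < 2 ^ Suc n"
      using j(1) J3 c_lt by (simp add: nat_less_iff)
    ultimately show False by blast
  qed
  moreover have "2 ^ n - 1 = nat (c + 3 * 0)" by (simp add: c_def nat_diff_distrib nat_power_eq)
  ultimately have "v (2 ^ n - 1) \<noteq> 0" using v_at[of 0] by simp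
  then show thesis using that ker by blast
qed

section \<open>Binary forms and Frobenius powers of the variable \<open>z\<close>\<close>

definition form :: "(nat \<Rightarrow> 'a) \<Rightarrow> nat \<Rightarrow> 'a \<Rightarrow> 'a \<Rightarrow> 'a :: comm_ring_1" where
  "form c d x y = (\<Sum>i\<le>d. c i * x ^ i * y ^ (d - i))"

lemma form_cong: "(\<And>i. i \<le> d \<Longrightarrow> c i = c' i) \<Longrightarrow> form c d x y = form c' d x y"
  by (simp add: form_def)

lemma form_0 [simp]: "form (\<lambda>i. 0) d x y = 0"
  by (simp add: form_def)

lemma form_add: "form c d x y + form c' d x y = form (\<lambda>i. c i + c' i) d x y"
  by (simp add: form_def sum.distrib algebra_simps)

lemma form_scale: "k * form c d x y = form (\<lambda>i. k * c i) d x y"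
  by (simp add: form_def sum_distrib_left mult.assoc)

lemma form_shift:
  "x ^ k * y ^ l * form c d x y = form (\<lambda>i. if k \<le> i \<and> i \<le> d + k then c (i - k) else 0) (d + k + l) x y"
proof -
  have "form (\<lambda>i. if k \<le> i \<and> i \<le> d + k then c (i - k) else 0) (d + k + l) x y
      = (\<Sum>i\<in>{k..d + k}. c (i - k) * x ^ i * y ^ (d + k + l - i))"
    unfolding form_def by (intro sum.mono_neutral_cong_right) auto
  also have "\<dots> = (\<Sum>i\<in>{0..d}. c i * x ^ (i + k) * y ^ (d + l - i))"
    using sum.shift_bounds_cl_nat_ivl[of "\<lambda>i. c (i - k) * x ^ i * y ^ (d + k + l - i)" 0 k d]
    by (simp add: add.commute)
  also have "\<dots> = x ^ k * y ^ l * form c d x y"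
    unfolding form_def sum_distrib_left atLeast0AtMost
  proof (intro sum.cong refl)
    fix i assume "i \<in> {..d}"
    then have "d + l - i = l + (d - i)" by simp
    then show "c i * x ^ (i + k) * y ^ (d + l - i) = x ^ k * y ^ l * (c i * x ^ i * y ^ (d - i))"
      by (simp only: power_add) (simp only: mult_ac)
  qed
  finally show ?thesis ..
qed

lemma form_square:
  fixes c :: "nat \<Rightarrow> 'a :: comm_ring_char2"
  shows "(form c d x y) ^ 2 = form (\<lambda>i. if even i then (c (i div 2)) ^ 2 else 0) (2 * d) x y"
proof -
  have "form (\<lambda>i. if even i then (c (i div 2)) ^ 2 else 0) (2 * d) x y
      = (\<Sum>i \<in> (\<lambda>i. 2 * i) ` {..d}. (c (i div 2)) ^ 2 * x ^ i * y ^ (2 * d - i))"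
    unfolding form_def by (intro sum.mono_neutral_cong_right) (auto elim!: evenE)
  also have "\<dots> = (\<Sum>i\<le>d. (c i * x ^ i * y ^ (d - i)) ^ 2)"
  proof (subst sum.reindex)
    show "inj_on ((*) 2) {..d}" by (simp add: inj_on_def)
    show "sum ((\<lambda>i. (c (i div 2)) ^ 2 * x ^ i * y ^ (2 * d - i)) \<circ> (*) 2) {..d}
        = (\<Sum>i\<le>d. (c i * x ^ i * y ^ (d - i)) ^ 2)"
    proof (intro sum.cong refl)
      fix i assume "i \<in> {..d}"
      have "2 * d - 2 * i = 2 * (d - i)" by simp
      then show "((\<lambda>i. (c (i div 2)) ^ 2 * x ^ i * y ^ (2 * d - i)) \<circ> (*) 2) i = (c i * x ^ i * y ^ (d - i)) ^ 2"
        by (simp only: o_apply power_even_eq power_mult_distrib) simp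
    qed
  qed
  finally show ?thesis by (simp add: form_def power2_sum_char2)
qed

lemma form_mult:
  "form c d x y * form c' d' x y
     = form (\<lambda>k. \<Sum>a\<le>d. if a \<le> k \<and> k \<le> a + d' then c a * c' (k - a) else 0) (d + d') x y"
proof -
  have "form c d x y * form c' d' x y = (\<Sum>a\<le>d. c a * (x ^ a * y ^ (d - a) * form c' d' x y))"
    unfolding form_def[of c] by (simp add: sum_distrib_right mult.assoc)
  also have "\<dots> = (\<Sum>a\<le>d. form (\<lambda>k. if a \<le> k \<and> k \<le> a + d' then c a * c' (k - a) else 0) (d + d') x y)"
  proof (intro sum.cong refl)
    fix a assume "a \<in> {..d}"
    then have "d' + a + (d - a) = d + d'" by simp
    then show "c a * (x ^ a * y ^ (d - a) * form c' d' x y)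
        = form (\<lambda>k. if a \<le> k \<and> k \<le> a + d' then c a * c' (k - a) else 0) (d + d') x y"
      by (subst form_shift, subst form_scale, simp only:) (rule form_cong, simp add: add.commute)
  qed
  also have "\<dots> = form (\<lambda>k. \<Sum>a\<le>d. if a \<le> k \<and> k \<le> a + d' then c a * c' (k - a) else 0) (d + d') x y"
    unfolding form_def by (subst sum.swap) (simp add: sum_distrib_right)
  finally show ?thesis .
qed

section \<open>Membership in the ideal \<open>(x^N, y^N)\<close>\<close>

definition in_pow :: "'a :: comm_ring_1 \<Rightarrow> 'a \<Rightarrow> nat \<Rightarrow> 'a \<Rightarrow> bool" where
  "in_pow x y N p \<longleftrightarrow> (\<exists>a b. p = a * x ^ N + b * y ^ N)"

lemma in_pow_0 [simp]: "in_pow x y N 0"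
  unfolding in_pow_def by (intro exI[of _ 0]) simp

lemma in_pow_add: "in_pow x y N p \<Longrightarrow> in_pow x y N p' \<Longrightarrow> in_pow x y N (p + p')"
proof -
  assume "in_pow x y N p" "in_pow x y N p'"
  then obtain a b a' b' where "p = a * x ^ N + b * y ^ N" "p' = a' * x ^ N + b' * y ^ N"
    unfolding in_pow_def by blast
  then have "p + p' = (a + a') * x ^ N + (b + b') * y ^ N" by (simp add: algebra_simps)
  then show ?thesis unfolding in_pow_def by blast
qed

lemma in_pow_mult: "in_pow x y N p \<Longrightarrow> in_pow x y N (r * p)"
proof -
  assume "in_pow x y N p"
  then obtain a b where "p = a * x ^ N + b * y ^ N" unfolding in_pow_def by blast
  then have "r * p = (r * a) * x ^ N + (r * b) * y ^ N" by (simp add: algebra_simps)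
  then show ?thesis unfolding in_pow_def by blast
qed

lemma in_pow_mult2: "in_pow x y N p \<Longrightarrow> in_pow x y N (p * r)"
  using in_pow_mult[of x y N p r] by (simp add: mult.commute)

lemma in_pow_sum: "(\<And>i. i \<in> I \<Longrightarrow> in_pow x y N (f i)) \<Longrightarrow> in_pow x y N (sum f I)"
  by (induction I rule: infinite_finite_induct) (auto intro: in_pow_add)

lemma in_pow_square:
  fixes p :: "'a :: comm_ring_char2"
  shows "in_pow x y N p \<Longrightarrow> in_pow x y (2 * N) (p ^ 2)"
proof -
  assume "in_pow x y N p"
  then obtain a b where "p = a * x ^ N + b * y ^ N" unfolding in_pow_def by blast
  then have "p ^ 2 = a ^ 2 * x ^ (2 * N) + b ^ 2 * y ^ (2 * N)"
    by (simp only: power2_add_char2 power_mult_distrib power_even_eq)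
  then show ?thesis unfolding in_pow_def by blast
qed

lemma in_pow_monomial:
  assumes "N \<le> i \<or> N \<le> j"
  shows "in_pow x y N (c * x ^ i * y ^ j)"
  using assms
proof
  assume "N \<le> i"
  then have "x ^ i = x ^ (i - N) * x ^ N" by (simp only: power_add[symmetric] le_add_diff_inverse2)
  then have "c * x ^ i * y ^ j = (c * x ^ (i - N) * y ^ j) * x ^ N + 0 * y ^ N" by (simp add: mult_ac)
  then show ?thesis unfolding in_pow_def by blast
next
  assume "N \<le> j"
  then have "y ^ j = y ^ (j - N) * y ^ N" by (simp only: power_add[symmetric] le_add_diff_inverse2)
  then have "c * x ^ i * y ^ j = 0 * x ^ N + (c * x ^ i * y ^ (j - N)) * y ^ N" by (simp add: mult_ac)
  then show ?thesis unfolding in_pow_def by blast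
qed

lemma in_pow_form:
  assumes "\<And>i. i \<le> d \<Longrightarrow> i < N \<Longrightarrow> d - i < N \<Longrightarrow> c i = 0"
  shows "in_pow x y N (form c d x y)"
  unfolding form_def
proof (rule in_pow_sum)
  fix i assume "i \<in> {..d}"
  then show "in_pow x y N (c i * x ^ i * y ^ (d - i))"
    using assms[of i] in_pow_monomial[of N i "d - i" x y "c i"] by (cases "i < N \<and> d - i < N") auto
qed

section \<open>Reduction of the powers \<open>z^(2^n)\<close> modulo the quartic\<close>

primrec zab :: "'a \<Rightarrow> 'a \<Rightarrow> nat \<Rightarrow> 'a \<times> 'a :: comm_ring_1" where
  "zab A B 0 = (0, 1)"
| "zab A B (Suc n) = (A * (fst (zab A B n)) ^ 2 + (snd (zab A B n)) ^ 2, B * (fst (zab A B n)) ^ 2)"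

definition za :: "'a \<Rightarrow> 'a \<Rightarrow> nat \<Rightarrow> 'a :: comm_ring_1" where "za A B n = fst (zab A B n)"
definition zb :: "'a \<Rightarrow> 'a \<Rightarrow> nat \<Rightarrow> 'a :: comm_ring_1" where "zb A B n = snd (zab A B n)"

lemma zab_simps [simp]:
  "za A B 0 = 0" "zb A B 0 = 1"
  "za A B (Suc n) = A * (za A B n) ^ 2 + (zb A B n) ^ 2" "zb A B (Suc n) = B * (za A B n) ^ 2"
  by (simp_all add: za_def zb_def)

primrec zc :: "'a \<Rightarrow> 'a \<Rightarrow> 'a \<Rightarrow> nat \<Rightarrow> 'a :: comm_ring_1" where
  "zc A B C 0 = 0"
| "zc A B C (Suc n) = (zc A B C n) ^ 2 + C * (za A B n) ^ 2"

text \<open>Squaring one stage gives \<open>a^2 z^4 + b^2 z^2 + c^2\<close>, and replacing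
  \<open>z^4\<close> by \<open>A z^2 + B z + C\<close> yields the recursions of \<open>zab\<close>
  and \<open>zc\<close>, which start from \<open>z\<close> itself.\<close>

lemma power_z_expansion:
  fixes z :: "'a :: comm_ring_char2"
  shows "z ^ 4 + A * z ^ 2 + B * z + C dvd z ^ 2 ^ n + (za A B n * z ^ 2 + zb A B n * z + zc A B C n)"
proof (induction n)
  case (Suc n)
  define a b c where abc: "a = za A B n" "b = zb A B n" "c = zc A B C n"
  let ?g = "z ^ 4 + A * z ^ 2 + B * z + C"
  obtain k where "z ^ 2 ^ n + (a * z ^ 2 + b * z + c) = ?g * k"
    using Suc.IH unfolding abc by blast
  then have "(z ^ 2 ^ n + (a * z ^ 2 + b * z + c)) ^ 2 = ?g * (?g * k ^ 2)"
    by (simp add: power_mult_distrib power2_eq_square algebra_simps)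
  moreover have "(z ^ 2 ^ n + (a * z ^ 2 + b * z + c)) ^ 2
      = z ^ 2 ^ Suc n + (a ^ 2 * z ^ 4 + b ^ 2 * z ^ 2 + c ^ 2)"
    by (simp add: power2_add_char2 power_mult_distrib mult.commute flip: power_mult)
  moreover have "z ^ 2 ^ Suc n + ((A * a ^ 2 + b ^ 2) * z ^ 2 + B * a ^ 2 * z + (c ^ 2 + C * a ^ 2))
      = (z ^ 2 ^ Suc n + (a ^ 2 * z ^ 4 + b ^ 2 * z ^ 2 + c ^ 2)) + ?g * a ^ 2"
    by (simp add: algebra_simps)
  ultimately have "z ^ 2 ^ Suc n + ((A * a ^ 2 + b ^ 2) * z ^ 2 + B * a ^ 2 * z + (c ^ 2 + C * a ^ 2))
      = ?g * (?g * k ^ 2 + a ^ 2)"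
    by (simp only: distrib_left)
  then show ?case by (simp only: abc zab_simps zc.simps dvd_triv_left)
qed simp

text \<open>Every monomial of the admissible class mod 3 occurs with coefficient 1. The induction
  separates parities of the exponent of \<open>x\<close>: in \<open>za\<close> the odd ones come
  from \<open>x y a^2\<close> and the even ones from \<open>b^2\<close>; in \<open>zb\<close> the
  odd ones come from \<open>x^3 a^2\<close> and the even ones from \<open>y^3 a^2\<close>.\<close>

lemma zab_form:
  fixes x y :: "'a :: comm_ring_char2"
  assumes "n \<ge> 1"
  shows "za (x * y) (x ^ 3 + y ^ 3) n = form (\<lambda>i. if 3 dvd i + 1 + 2 ^ n then 1 else 0) (2 ^ n - 2) x y"
    and "zb (x * y) (x ^ 3 + y ^ 3) n = form (\<lambda>i. if 3 dvd i + 2 + 2 ^ n then 1 else 0) (2 ^ n - 1) x y"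
  using assms
proof (induction n rule: dec_induct)
  case base
  show "za (x * y) (x ^ 3 + y ^ 3) 1 = form (\<lambda>i. if 3 dvd i + 1 + 2 ^ 1 then 1 else 0) (2 ^ 1 - 2) x y"
    by (simp add: form_def numeral_3_eq_3[symmetric])
  have "form (\<lambda>i. if 3 dvd i + 2 + 2 ^ 1 then 1 else 0) (2 ^ 1 - 1) x y = form (\<lambda>i. 0) (2 ^ 1 - 1) x y"
  proof (rule form_cong)
    fix i :: nat assume "i \<le> 2 ^ 1 - 1"
    then have "\<not> 3 dvd i + 2 + 2 ^ 1" by simp presburger
    then show "(if 3 dvd i + 2 + 2 ^ 1 then 1 else 0) = (0 :: 'a)" by (simp only: if_False)
  qed
  then show "zb (x * y) (x ^ 3 + y ^ 3) 1 = form (\<lambda>i. if 3 dvd i + 2 + 2 ^ 1 then 1 else 0) (2 ^ 1 - 1) x y"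
    by simp
next
  case (step n)
  define q where "q = (2::nat) ^ n"
  have q: "2 ^ Suc n = 2 * q" "even q" "q \<ge> 2" "\<not> 3 dvd q"
    using step.hyps not_3_dvd_power_2[of n] self_le_power[of 2 n]
    by (auto simp: q_def intro: order_trans[OF _ self_le_power] simp flip: int_dvd_int_iff)
  let ?a = "\<lambda>i. if 3 dvd i + 1 + q then 1 else 0 :: 'a"
  let ?b = "\<lambda>i. if 3 dvd i + 2 + q then 1 else 0 :: 'a"
  have dvd2: "3 dvd 2 * j \<longleftrightarrow> 3 dvd j" for j :: nat
    by (rule coprime_dvd_mult_right_iff) simp
  note IH = step.IH[folded q_def]
  have "za (x * y) (x ^ 3 + y ^ 3) (Suc n) = x ^ 1 * y ^ 1 * (form ?a (q - 2) x y) ^ 2 + (form ?b (q - 1) x y) ^ 2"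
    by (simp only: zab_simps IH power_one_right)
  also have "\<dots> = form (\<lambda>i. if 3 dvd i + 1 + 2 * q then 1 else 0) (2 * q - 2) x y"
  proof -
    have d: "2 * (q - 2) + 1 + 1 = 2 * q - 2" "2 * (q - 1) = 2 * q - 2" using q(3) by auto
    show ?thesis
      unfolding form_square form_shift d form_add
    proof (rule form_cong)
      fix i assume i: "i \<le> 2 * q - 2"
      have "(i - 1) div 2 + 1 + q = j \<Longrightarrow> 2 * j = i + 1 + 2 * q" if "odd i" for j
        using that by auto
      then have o: "3 dvd (i - 1) div 2 + 1 + q \<longleftrightarrow> 3 dvd i + 1 + 2 * q" if "odd i"
        using that dvd2 by metis
      have "i div 2 + 2 + q = j \<Longrightarrow> 2 * j = (i + 1 + 2 * q) + 3" if "even i" for j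
        using that by auto
      then have e: "3 dvd i div 2 + 2 + q \<longleftrightarrow> 3 dvd i + 1 + 2 * q" if "even i"
        using that dvd2 by (metis dvd_add_left_iff dvd_refl)
      show "(if 1 \<le> i \<and> i \<le> 2 * (q - 2) + 1 then if even (i - 1) then (?a ((i - 1) div 2)) ^ 2 else 0 else 0)
          + (if even i then (?b (i div 2)) ^ 2 else 0) = (if 3 dvd i + 1 + 2 * q then 1 else 0)"
      proof (cases "even i")
        case True
        then show ?thesis using e by auto
      next
        case False
        then have "1 \<le> i" "i \<le> 2 * (q - 2) + 1" using i q(3) by (auto elim!: oddE)
        then show ?thesis using False o by auto
      qed
    qed
  qed
  finally show "za (x * y) (x ^ 3 + y ^ 3) (Suc n)
      = form (\<lambda>i. if 3 dvd i + 1 + 2 ^ Suc n then 1 else 0) (2 ^ Suc n - 2) x y"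
    by (simp only: q)
  have "zb (x * y) (x ^ 3 + y ^ 3) (Suc n)
      = x ^ 3 * y ^ 0 * (form ?a (q - 2) x y) ^ 2 + x ^ 0 * y ^ 3 * (form ?a (q - 2) x y) ^ 2"
    by (simp only: zab_simps IH power_0 mult_1_left mult_1_right distrib_right)
  also have "\<dots> = form (\<lambda>i. if 3 dvd i + 2 + 2 * q then 1 else 0) (2 * q - 1) x y"
  proof -
    have d: "2 * (q - 2) + 3 + 0 = 2 * q - 1" "2 * (q - 2) + 0 + 3 = 2 * q - 1" using q(3) by auto
    show ?thesis
      unfolding form_square form_shift d form_add
    proof (rule form_cong)
      fix i assume i: "i \<le> 2 * q - 1"
      have "(i - 3) div 2 + 1 + q = j \<Longrightarrow> 2 * j + 3 = i + 2 + 2 * q" if "odd i" "i \<ge> 3" for j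
        using that by auto
      then have o: "3 dvd (i - 3) div 2 + 1 + q \<longleftrightarrow> 3 dvd i + 2 + 2 * q" if "odd i" "i \<ge> 3"
        using that dvd2 by (metis dvd_add_left_iff dvd_refl)
      have "i div 2 + 1 + q = j \<Longrightarrow> 2 * j = i + 2 + 2 * q" if "even i" for j
        using that by auto
      then have e: "3 dvd i div 2 + 1 + q \<longleftrightarrow> 3 dvd i + 2 + 2 * q" if "even i"
        using that dvd2 by metis
      show "(if 3 \<le> i \<and> i \<le> 2 * (q - 2) + 3 then if even (i - 3) then (?a ((i - 3) div 2)) ^ 2 else 0 else 0)
          + (if 0 \<le> i \<and> i \<le> 2 * (q - 2) + 0 then if even (i - 0) then (?a ((i - 0) div 2)) ^ 2 else 0 else 0)
          = (if 3 dvd i + 2 + 2 * q then 1 else 0)"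
      proof (cases "even i")
        case True
        then have "i = 2 * q - 2 \<or> i \<le> 2 * (q - 2)" using i q(3) by presburger
        moreover have "\<not> 3 dvd i + 2 + 2 * q" if "i = 2 * q - 2"
        proof -
          have "i + 2 + 2 * q = 2 * (2 * q)" using that q(3) by simp
          then show ?thesis using q(4) dvd2 by metis
        qed
        ultimately show ?thesis using True e by auto
      next
        case False
        have "\<not> 3 dvd i + 2 + 2 * q" if "i = 1"
        proof -
          have "i + 2 + 2 * q = 3 + 2 * q" using that by simp
          then show ?thesis using q(4) dvd2 by (metis dvd_add_right_iff dvd_refl)
        qed
        moreover have "i \<le> 2 * (q - 2) + 3" using i q(3) by simp
        moreover have "i = 1 \<or> 3 \<le> i" using False by presburger
        ultimately show ?thesis using False o by auto
      qed
    qed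
  qed
  finally show "zb (x * y) (x ^ 3 + y ^ 3) (Suc n)
      = form (\<lambda>i. if 3 dvd i + 2 + 2 ^ Suc n then 1 else 0) (2 ^ Suc n - 1) x y"
    by (simp only: q)
qed

lemma not_3_dvd_power_2_nat: "\<not> 3 dvd (2::nat) ^ n"
  using not_3_dvd_power_2[of n] by (simp flip: int_dvd_int_iff)

lemma dvd_3_double: "3 dvd 2 * j \<longleftrightarrow> 3 dvd (j::nat)"
  by (rule coprime_dvd_mult_right_iff) simp

text \<open>The coefficients depend only on the class mod 3, so the shifts by \<open>x^3\<close> and
  \<open>y^3\<close> cancel on every monomial whose exponents are both below
  \<open>2 ^ n\<close>.\<close>

lemma in_pow_mult_zb:
  fixes x y :: "'a :: comm_ring_char2"
  shows "in_pow x y (2 ^ n) ((x ^ 3 + y ^ 3) * zb (x * y) (x ^ 3 + y ^ 3) n)"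
proof (cases n)
  case 0
  have "x ^ 3 + y ^ 3 = x ^ 2 * x ^ 1 + y ^ 2 * y ^ 1" by (simp add: eval_nat_numeral)
  then show ?thesis unfolding 0 in_pow_def by auto
next
  case (Suc m)
  define q where "q = (2::nat) ^ n"
  have q: "q \<ge> 2" using Suc by (simp add: q_def)
  let ?b = "\<lambda>i. if 3 dvd i + 2 + q then 1 else 0 :: 'a"
  have "(x ^ 3 + y ^ 3) * zb (x * y) (x ^ 3 + y ^ 3) n
      = x ^ 3 * y ^ 0 * form ?b (q - 1) x y + x ^ 0 * y ^ 3 * form ?b (q - 1) x y"
    using zab_form(2)[of n x y] Suc by (simp only: q_def) (simp add: distrib_right)
  also have "in_pow x y q \<dots>"
  proof -
    have d: "q - 1 + 3 + 0 = q + 2" "q - 1 + 0 + 3 = q + 2" using q by simp_all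
    show ?thesis unfolding form_shift d form_add
    proof (rule in_pow_form)
      fix i assume i: "i \<le> q + 2" "i < q" "q + 2 - i < q"
      then have "i \<ge> 3" by simp
      then have "3 dvd i - 3 + 2 + q \<longleftrightarrow> 3 dvd i - 0 + 2 + q" by presburger
      then show "(if 3 \<le> i \<and> i \<le> q - 1 + 3 then ?b (i - 3) else 0)
          + (if 0 \<le> i \<and> i \<le> q - 1 + 0 then ?b (i - 0) else 0) = 0"
        using i \<open>i \<ge> 3\<close> by simp
    qed
  qed
  finally show ?thesis by (simp only: q_def)
qed

text \<open>As for \<open>zb\<close>, except that at the exponents 2 and \<open>q - 1\<close> of
  \<open>x\<close> one of the shifts can be missing; the other one has coefficient zero there
  because 3 does not divide \<open>q\<close>.\<close>

lemma in_pow_mult_za: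
  fixes x y :: "'a :: comm_ring_char2"
  shows "in_pow x y (2 ^ n) ((x ^ 3 + y ^ 3) * za (x * y) (x ^ 3 + y ^ 3) n)"
proof (cases n)
  case (Suc m)
  define q where "q = (2::nat) ^ n"
  have q: "q \<ge> 2" "\<not> 3 dvd q" using Suc not_3_dvd_power_2_nat[of n] by (simp_all add: q_def)
  let ?a = "\<lambda>i. if 3 dvd i + 1 + q then 1 else 0 :: 'a"
  have "(x ^ 3 + y ^ 3) * za (x * y) (x ^ 3 + y ^ 3) n
      = x ^ 3 * y ^ 0 * form ?a (q - 2) x y + x ^ 0 * y ^ 3 * form ?a (q - 2) x y"
    using zab_form(1)[of n x y] Suc by (simp only: q_def) (simp add: distrib_right)
  also have "in_pow x y q \<dots>"
  proof -
    have d: "q - 2 + 3 + 0 = q + 1" "q - 2 + 0 + 3 = q + 1" using q by simp_all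
    show ?thesis unfolding form_shift d form_add
    proof (rule in_pow_form)
      fix i assume i: "i \<le> q + 1" "i < q" "q + 1 - i < q"
      then have i2: "i \<ge> 2" by simp
      consider "i = 2" | "i = q - 1" "i \<noteq> 2" | "3 \<le> i" "i \<le> q - 2" using i i2 by linarith
      then show "(if 3 \<le> i \<and> i \<le> q - 2 + 3 then ?a (i - 3) else 0)
          + (if 0 \<le> i \<and> i \<le> q - 2 + 0 then ?a (i - 0) else 0) = 0"
      proof cases
        case 1
        have "\<not> 3 dvd 2 + 1 + q" using q(2) by presburger
        then show ?thesis using 1 by simp
      next
        case 2
        have "3 dvd i - 3 + 1 + q \<longleftrightarrow> 3 dvd 2 * q" using 2 i2 by presburger
        then have "\<not> 3 dvd i - 3 + 1 + q" using q(2) dvd_3_double by blast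
        then show ?thesis using 2 i2 by simp
      next
        case 3
        then have "3 dvd i - 3 + 1 + q \<longleftrightarrow> 3 dvd i - 0 + 1 + q" by presburger
        moreover have "i \<le> q - 2 + 3" using 3 by simp
        ultimately show ?thesis using 3 by simp
      qed
    qed
  qed
  finally show ?thesis by (simp only: q_def)
qed simp

lemma mult_za_form:
  fixes x y :: "'a :: comm_ring_char2"
  shows "x * y * za (x * y) (x ^ 3 + y ^ 3) n = form (\<lambda>i. if 3 dvd i + 2 ^ n then 1 else 0) (2 ^ n) x y"
proof (cases n)
  case 0
  then show ?thesis by (simp add: form_def numeral_2_eq_2[symmetric])
next
  case (Suc m)
  define q where "q = (2::nat) ^ n"
  have q: "q \<ge> 2" "\<not> 3 dvd q" using Suc not_3_dvd_power_2_nat[of n] by (simp_all add: q_def)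
  let ?a = "\<lambda>i. if 3 dvd i + 1 + q then 1 else 0 :: 'a"
  have "x * y * za (x * y) (x ^ 3 + y ^ 3) n = x ^ 1 * y ^ 1 * form ?a (q - 2) x y"
    using zab_form(1)[of n x y] Suc by (simp only: q_def) simp
  also have "\<dots> = form (\<lambda>i. if 3 dvd i + q then 1 else 0) q x y"
  proof -
    have d: "q - 2 + 1 + 1 = q" using q by simp
    show ?thesis unfolding form_shift d
    proof (rule form_cong)
      fix i assume i: "i \<le> q"
      consider "i = 0" | "i = q" | "1 \<le> i" "i \<le> q - 2 + 1" using i q by linarith
      then show "(if 1 \<le> i \<and> i \<le> q - 2 + 1 then ?a (i - 1) else 0) = (if 3 dvd i + q then 1 else 0)"
      proof cases
        case 2
        have "\<not> 3 dvd i + q" using q(2) dvd_3_double[of q] 2 by (simp add: mult_2)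
        then show ?thesis using 2 q by simp
      qed (use q in auto)
    qed
  qed
  finally show ?thesis by (simp only: q_def)
qed

text \<open>When \<open>C = (\<delta> x y)\<^sup>2\<close>, the left-hand side is the square root of \<open>zc\<close> at \<open>Suc n\<close>.\<close>

lemma zc_plus_form_eps:
  fixes x y :: "'a :: comm_ring_char2"
  shows "zc (x * y) (x ^ 3 + y ^ 3) ((\<delta> * (x * y)) ^ 2) n + \<delta> * (x * y) * za (x * y) (x ^ 3 + y ^ 3) n
      = form (eps \<delta> n) (2 ^ n) x y"
proof (induction n)
  case (Suc n)
  let ?za = "za (x * y) (x ^ 3 + y ^ 3)" and ?zc = "zc (x * y) (x ^ 3 + y ^ 3) ((\<delta> * (x * y)) ^ 2)"
  have "?zc (Suc n) = (?zc n + \<delta> * (x * y) * ?za n) ^ 2"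
    by (simp only: zc.simps power2_add_char2 power_mult_distrib)
  moreover have "\<delta> * (x * y) * ?za (Suc n) = \<delta> * (x * y * ?za (Suc n))"
    by (simp only: mult.assoc)
  ultimately have "?zc (Suc n) + \<delta> * (x * y) * ?za (Suc n)
      = (form (eps \<delta> n) (2 ^ n) x y) ^ 2 + \<delta> * form (\<lambda>i. if 3 dvd i + 2 ^ Suc n then 1 else 0) (2 ^ Suc n) x y"
    by (simp only: Suc.IH mult_za_form)
  also have "\<dots> = form (eps \<delta> (Suc n)) (2 ^ Suc n) x y"
    unfolding form_square form_scale power_Suc[symmetric] form_add
    by (rule form_cong) simp
  finally show ?case .
qed (simp add: form_def)

section \<open>Toeplitz systems over \<open>L[t]\<close>\<close>

text \<open>\<open>gam n i\<close>, a polynomial in \<open>t\<close>, is the coefficient of \<open>x\<^sup>i y\<^bsup>N - i\<^esup>\<close>, \<open>N = 2\<^sup>n\<close>, in \<open>zc\<close> for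
  \<open>C = t x\<^sup>2 y\<^sup>2\<close>.  Only the middle coefficient attains the top degree in \<open>t\<close>, so the Toeplitz matrix
  is dominated by its diagonal.\<close>

fun gam :: "nat \<Rightarrow> nat \<Rightarrow> 'a :: {idom, comm_ring_char2} poly" where
  "gam 0 i = 0"
| "gam (Suc n) i = (if even i then (gam n (i div 2)) ^ 2
      + (if 3 dvd i div 2 + 2 ^ n then [:0, 1:] else 0) else 0)"

lemma coeff_mult_at_degree_bounds:
  fixes p q :: "'a :: comm_semiring_1 poly"
  assumes "degree p \<le> m" "degree q \<le> k"
  shows "coeff (p * q) (m + k) = coeff p m * coeff q k"
proof -
  have "coeff (p * q) (m + k) = (\<Sum>i\<le>m + k. if i = m then coeff p m * coeff q k else 0)"
    unfolding coeff_mult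
  proof (intro sum.cong refl)
    fix i
    show "coeff p i * coeff q (m + k - i) = (if i = m then coeff p m * coeff q k else 0)"
      using assms coeff_eq_0[of p i] coeff_eq_0[of q "m + k - i"]
      by (cases i m rule: linorder_cases) auto
  qed
  then show ?thesis by simp
qed

text \<open>From \<open>n = 2\<close> on the degree bound doubles with each squaring and stays out
  of reach of the linear term \<open>t\<close>. The top coefficient is therefore just squared, and
  its index doubled.\<close>

lemma gam_leading:
  assumes "n \<ge> 2" "i \<le> 2 ^ n"
  shows "degree (gam n i :: 'a :: {idom, comm_ring_char2} poly) \<le> 2 ^ (n - 2) \<and>
    coeff (gam n i :: 'a poly) (2 ^ (n - 2)) = (if i = 2 ^ (n - 1) then 1 else 0)"
  using assms
proof (induction n arbitrary: i rule: dec_induct)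
  case base
  then have "i = 0 \<or> i = 1 \<or> i = 2 \<or> i = 3 \<or> i = 4" by simp presburger
  then have g: "gam 2 i = (if i = 2 then [:0, 1:] else 0 :: 'a poly)"
    unfolding numeral_2_eq_2 gam.simps(2)
    by (elim disjE; simp; presburger)
  show ?case unfolding g by simp
next
  case (step n)
  define k where "k = (2::nat) ^ (n - 2)"
  have k: "2 ^ (Suc n - 2) = k + k" "2 ^ (Suc n - 1) = 2 * 2 ^ (n - 1)" "k \<ge> 1"
    using step.hyps by (auto simp: k_def Suc_diff_le power_add[symmetric] simp flip: power_Suc mult_2)
  note i = step.prems
    define p where "p = (gam n (i div 2) :: 'a poly)"
    have IH: "degree p \<le> k" "coeff p k = (if i div 2 = 2 ^ (n - 1) then 1 else 0)"
      using step.IH[of "i div 2"] i unfolding p_def k_def by auto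
    define r where "r = (if 3 dvd i div 2 + 2 ^ n then [:0, 1:] else 0 :: 'a poly)"
    have r: "degree r \<le> 1" by (simp add: r_def)
    have "degree (p ^ 2) \<le> k + k" unfolding power2_eq_square
      using degree_mult_le[of p p] IH(1) by linarith
    then have "degree (p ^ 2 + r) \<le> k + k" using r k(3) by (intro degree_add_le) auto
    moreover have "coeff (p ^ 2 + r) (k + k) = (if i div 2 = 2 ^ (n - 1) then 1 else 0)"
    proof -
      have "coeff r (k + k) = 0" using r k(3) by (intro coeff_eq_0) linarith
      then show ?thesis
        using coeff_mult_at_degree_bounds[OF IH(1) IH(1)] IH(2) by (simp add: power2_eq_square)
    qed
    moreover have "even i \<Longrightarrow> i div 2 = 2 ^ (n - 1) \<longleftrightarrow> i = 2 * 2 ^ (n - 1)" by auto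
    ultimately show ?case
      unfolding k gam.simps(2) p_def[symmetric] r_def[symmetric] by auto
qed

text \<open>In the row of an entry \<open>w a0\<close> of maximal degree \<open>K\<close>, only the
  diagonal term reaches degree \<open>K + 2 ^ n\<close> in \<open>t\<close>, so this row cannot sum
  to zero.\<close>

lemma gam_toeplitz_injective:
  fixes w :: "nat \<Rightarrow> 'a :: {idom, comm_ring_char2} poly"
  assumes eq: "\<And>b. b < 2 ^ Suc n \<Longrightarrow> (\<Sum>a<2 ^ Suc n. w a * gam (Suc (Suc n)) (2 ^ Suc n + b - a)) = 0"
  shows "\<forall>a<2 ^ Suc n. w a = 0"
proof (rule ccontr)
  assume "\<not> (\<forall>a<2 ^ Suc n. w a = 0)"
  then obtain a1 where a1: "a1 < 2 ^ Suc n" "w a1 \<noteq> 0" by blast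
  define S where "S = {a. a < 2 ^ Suc n \<and> w a \<noteq> 0}"
  have S: "finite S" "S \<noteq> {}" using a1 by (auto simp: S_def)
  define K where "K = Max ((\<lambda>a. degree (w a)) ` S)"
  have "K \<in> (\<lambda>a. degree (w a)) ` S" unfolding K_def using S by (intro Max_in) auto
  then obtain a0 where a0: "a0 < 2 ^ Suc n" "w a0 \<noteq> 0" "degree (w a0) = K" by (auto simp: S_def)
  have K: "degree (w a) \<le> K" if "a < 2 ^ Suc n" for a
  proof (cases "w a = 0")
    case False
    then have "a \<in> S" using that by (simp add: S_def)
    then show ?thesis unfolding K_def using S by (intro Max_ge) auto
  qed simp
  let ?g = "gam (Suc (Suc n)) :: nat \<Rightarrow> 'a poly"
  have "coeff (w a * ?g (2 ^ Suc n + a0 - a)) (K + 2 ^ n) = (if a = a0 then coeff (w a0) K else 0)"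
    if a: "a < 2 ^ Suc n" for a
  proof -
    have "2 ^ Suc n + a0 - a \<le> 2 ^ Suc (Suc n)" using a0 by simp
    then have "degree (?g (2 ^ Suc n + a0 - a)) \<le> 2 ^ n"
      "coeff (?g (2 ^ Suc n + a0 - a)) (2 ^ n) = (if 2 ^ Suc n + a0 - a = 2 ^ Suc n then 1 else 0)"
      using gam_leading[of "Suc (Suc n)" "2 ^ Suc n + a0 - a", where ?'a = 'a] by (simp_all del: gam.simps)
    then show ?thesis
      using coeff_mult_at_degree_bounds[OF K[OF a]] a by auto
  qed
  then have "coeff (\<Sum>a<2 ^ Suc n. w a * ?g (2 ^ Suc n + a0 - a)) (K + 2 ^ n) = coeff (w a0) K"
    unfolding coeff_sum using a0(1) by (subst sum.cong[OF refl]) (auto simp del: gam.simps)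
  then show False
    using eq[OF a0(1)] a0(2,3) leading_coeff_0_iff[of "w a0"] by (simp del: gam.simps)
qed

text \<open>Solving over \<open>L(t)\<close> up to a denominator: the unit vector at
  \<open>b0\<close> becomes an extra column, and its coefficient \<open>d\<close> is nonzero by
  injectivity of the rest.\<close>

lemma gam_toeplitz_solution:
  assumes "b0 < 2 ^ Suc n"
  obtains d :: "'a :: {idom, comm_ring_char2} poly" and w where "d \<noteq> 0"
    "\<And>b. b < 2 ^ Suc n \<Longrightarrow> (\<Sum>a<2 ^ Suc n. w a * gam (Suc (Suc n)) (2 ^ Suc n + b - a))
        = (if b = b0 then d else 0)"
proof -
  define M where "M b j = (if j < 2 ^ Suc n then gam (Suc (Suc n)) (2 ^ Suc n + b - j)
      else if b = b0 then 1 else (0 :: 'a poly))" for b j :: nat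
  obtain w where w: "\<exists>j\<le>2 ^ Suc n. w j \<noteq> 0"
    "\<And>b. b < 2 ^ Suc n \<Longrightarrow> (\<Sum>j\<le>2 ^ Suc n. M b j * w j) = 0"
    using nontrivial_solution[of "2 ^ Suc n" M] by blast
  define d where "d = w (2 ^ Suc n)"
  have eq: "(\<Sum>a<2 ^ Suc n. w a * gam (Suc (Suc n)) (2 ^ Suc n + b - a)) = (if b = b0 then d else 0)"
    if b: "b < 2 ^ Suc n" for b
  proof -
    have "0 = (\<Sum>j<2 ^ Suc n. M b j * w j) + M b (2 ^ Suc n) * w (2 ^ Suc n)"
      using w(2)[OF b] unfolding lessThan_Suc_atMost[symmetric] by (simp only: sum.lessThan_Suc)
    also have "(\<Sum>j<2 ^ Suc n. M b j * w j) = (\<Sum>a<2 ^ Suc n. w a * gam (Suc (Suc n)) (2 ^ Suc n + b - a))"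
      by (intro sum.cong refl) (simp add: M_def mult.commute del: gam.simps)
    also have "M b (2 ^ Suc n) * w (2 ^ Suc n) = (if b = b0 then d else 0)"
      by (simp add: M_def d_def)
    finally show ?thesis by (simp only: add_eq_0_char2 eq_commute[of 0])
  qed
  have "d \<noteq> 0"
  proof
    assume d: "d = 0"
    then have "\<forall>a<2 ^ Suc n. w a = 0" using eq by (intro gam_toeplitz_injective) simp
    then show False using w(1) d unfolding d_def by (metis le_neq_implies_less)
  qed
  then show thesis using that eq by blast
qed

section \<open>Frobenius powers of \<open>(x, y)\<close> in \<open>L[x, y]\<close>\<close>

definition px :: "'a :: comm_ring_1 poly poly" where "px = [:[:0, 1:]:]"
definition py :: "'a :: comm_ring_1 poly poly" where "py = [:0, 1:]"

definition cf :: "'a :: zero poly poly \<Rightarrow> nat \<Rightarrow> nat \<Rightarrow> 'a" where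
  "cf p i j = coeff (coeff p j) i"

text \<open>Membership in the monomial ideal \<open>(x^M, y^M)\<close>, tested on
  coefficients.\<close>

definition vanish :: "nat \<Rightarrow> 'a :: zero poly poly \<Rightarrow> bool" where
  "vanish M p \<longleftrightarrow> (\<forall>i<M. \<forall>j<M. cf p i j = 0)"

lemma vanish_0 [simp]: "vanish M 0"
  by (simp add: vanish_def cf_def)

lemma vanish_add:
  fixes p :: "'a :: comm_ring_1 poly poly"
  shows "vanish M p \<Longrightarrow> vanish M p' \<Longrightarrow> vanish M (p + p')"
  by (simp add: vanish_def cf_def)

lemma cf_mult: "cf (p * r) i j = (\<Sum>b\<le>j. \<Sum>a\<le>i. cf p a b * cf r (i - a) (j - b))"
  by (simp add: cf_def coeff_mult coeff_sum)

lemma vanish_mult: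
  fixes p :: "'a :: comm_ring_1 poly poly"
  assumes "vanish M p"
  shows "vanish M (r * p)"
  unfolding vanish_def cf_mult
proof (intro allI impI sum.neutral ballI)
  fix i j a b assume "i < M" "j < M" "b \<in> {..j}" "a \<in> {..i}"
  then show "cf r a b * cf p (i - a) (j - b) = 0"
    using assms by (simp add: vanish_def)
qed

lemma px_power: "px ^ n = [:monom 1 n:]"
proof (induction n)
  case (Suc n)
  then show ?case by (simp add: px_def monom_Suc)
qed (simp add: one_pCons)

lemma py_power: "py ^ n = monom 1 n"
proof (induction n)
  case (Suc n)
  then show ?case by (simp add: py_def monom_Suc)
qed (simp add: monom_0 one_pCons)

lemma cf_px_power: "cf (px ^ n * p) i j = (if i < n then 0 else cf p (i - n) j)"
  by (simp add: cf_def px_power coeff_monom_mult)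

lemma cf_py_power: "cf (py ^ n * p) i j = (if j < n then 0 else cf p i (j - n))"
  by (simp add: cf_def py_power coeff_monom_mult)

lemma cf_px: "cf (px * p) i j = (if i = 0 then 0 else cf p (i - 1) j)"
  using cf_px_power[of 1 p i j] by simp

lemma cf_py: "cf (py * p) i j = (if j = 0 then 0 else cf p i (j - 1))"
  using cf_py_power[of 1 p i j] by simp

lemma cf_add: "cf (p + r) i j = cf p i j + cf r i j"
  by (simp add: cf_def)

lemma vanish_in_pow:
  assumes "in_pow px py M p"
  shows "vanish M p"
proof -
  obtain a b where p: "p = px ^ M * a + py ^ M * b"
    using assms by (auto simp: in_pow_def mult.commute)
  show ?thesis unfolding p vanish_def by (simp add: cf_add cf_px_power cf_py_power)
qed

lemma coeff_square_char2:
  fixes p :: "'a :: comm_ring_char2 poly"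
  shows "coeff (p ^ 2) n = (if even n then (coeff p (n div 2)) ^ 2 else 0)"
proof -
  have "p ^ 2 = (\<Sum>i\<le>degree p. monom (coeff p i) i) ^ 2"
    by (simp only: poly_as_sum_of_monoms)
  also have "\<dots> = (\<Sum>i\<le>degree p. monom ((coeff p i) ^ 2) (2 * i))"
    by (simp add: power2_sum_char2 monom_power mult.commute)
  finally have "coeff (p ^ 2) n = (\<Sum>i\<le>degree p. if 2 * i = n then (coeff p i) ^ 2 else 0)"
    by (simp add: coeff_sum)
  also have "\<dots> = (if even n then (coeff p (n div 2)) ^ 2 else 0)"
  proof (cases "even n")
    case True
    then obtain k where k: "n = 2 * k" by blast
    show ?thesis unfolding k by (simp add: coeff_eq_0)
  next
    case False
    then show ?thesis by (auto intro!: sum.neutral)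
  qed
  finally show ?thesis .
qed

lemma cf_square:
  fixes p :: "'a :: comm_ring_char2 poly poly"
  shows "cf (p ^ 2) i j = (if even i \<and> even j then (cf p (i div 2) (j div 2)) ^ 2 else 0)"
  by (simp add: cf_def coeff_square_char2)

lemma cf_frobenius:
  fixes p :: "'a :: comm_ring_char2 poly poly"
  shows "cf (p ^ 2 ^ k) i j
    = (if 2 ^ k dvd i \<and> 2 ^ k dvd j then (cf p (i div 2 ^ k) (j div 2 ^ k)) ^ 2 ^ k else 0)"
proof (induction k arbitrary: i j)
  case (Suc k)
  have d: "2 ^ Suc k dvd n \<longleftrightarrow> even n \<and> 2 ^ k dvd n div 2" for n :: nat
    by (auto elim!: evenE dvdE)
  have pw: "(c ^ 2 ^ k) ^ 2 = c ^ 2 ^ Suc k" for c :: "'b :: monoid_mult"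
    by (simp add: power_mult[symmetric] mult.commute)
  have dv: "n div 2 div 2 ^ k = n div 2 ^ Suc k" for n :: nat
    by (simp only: div_mult2_eq power_Suc)
  have "cf (p ^ 2 ^ Suc k) i j = cf ((p ^ 2 ^ k) ^ 2) i j" by (simp only: pw)
  also have "\<dots> = (if 2 ^ Suc k dvd i \<and> 2 ^ Suc k dvd j
      then (cf p (i div 2 ^ Suc k) (j div 2 ^ Suc k)) ^ 2 ^ Suc k else 0)"
    unfolding cf_square Suc.IH d by (auto simp: pw dv simp del: power_Suc)
  finally show ?case .
qed simp

text \<open>The four summands live on the four parity classes of exponent pairs, so they cannot
  interfere, and each coefficient is the square of one of \<open>a\<close>, \<open>b\<close>,
  \<open>c\<close>, \<open>d\<close>.\<close>

lemma vanish_square_basis: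
  fixes a b c d :: "'a :: {idom, comm_ring_char2} poly poly"
  assumes "vanish (2 * M) (a ^ 2 + px * b ^ 2 + py * c ^ 2 + px * (py * d ^ 2))"
  shows "vanish M b" "vanish M c" "vanish M d"
proof -
  have v: "cf (a ^ 2 + px * b ^ 2 + py * c ^ 2 + px * (py * d ^ 2)) i j = 0" if "i < 2 * M" "j < 2 * M" for i j
    using assms that by (simp add: vanish_def)
  have "cf b i j = 0" if "i < M" "j < M" for i j
    using v[of "2 * i + 1" "2 * j"] that by (cases i; cases j; simp add: cf_add cf_px cf_py cf_square)
  moreover have "cf c i j = 0" if "i < M" "j < M" for i j
    using v[of "2 * i" "2 * j + 1"] that by (cases i; cases j; simp add: cf_add cf_px cf_py cf_square)
  moreover have "cf d i j = 0" if "i < M" "j < M" for i j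
    using v[of "2 * i + 1" "2 * j + 1"] that by (cases i; cases j; simp add: cf_add cf_px cf_py cf_square)
  ultimately show "vanish M b" "vanish M c" "vanish M d" by (auto simp: vanish_def)
qed

lemma exists_nonzero_cf:
  assumes "s \<noteq> (0 :: 'a :: zero poly poly)"
  obtains a b where "cf s a b \<noteq> 0"
proof -
  have "lead_coeff (lead_coeff s) \<noteq> 0" using assms by simp
  then show thesis using that unfolding cf_def by blast
qed

lemma exists_cf_bound: "\<exists>D. \<forall>a b. cf s a b \<noteq> 0 \<longrightarrow> a < D \<and> b < D"
proof -
  define D where "D = Suc (degree s + (\<Sum>b\<le>degree s. degree (coeff s b)))"
  have "a < D \<and> b < D" if "cf s a b \<noteq> 0" for a b
  proof -
    have "coeff s b \<noteq> 0" using that by (auto simp: cf_def)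
    then have b: "b \<le> degree s" by (rule le_degree)
    have "a \<le> degree (coeff s b)" using that unfolding cf_def by (rule le_degree)
    also have "\<dots> \<le> (\<Sum>b\<le>degree s. degree (coeff s b))"
      using b by (intro member_le_sum) auto
    finally show ?thesis using b by (simp add: D_def)
  qed
  then show ?thesis by blast
qed

text \<open>Flatness of Frobenius on the regular ring \<open>L[x, y]\<close>: a fixed multiplier cannot push all
  Frobenius powers of \<open>p\<close> into the Frobenius powers of \<open>(x\<^sup>M, y\<^sup>M)\<close>.\<close>

lemma vanish_frobenius_multiplier:
  fixes s p :: "'a :: {idom, comm_ring_char2} poly poly"
  assumes "s \<noteq> 0" and van: "\<And>k. vanish (M * 2 ^ k) (s * p ^ 2 ^ k)"
  shows "vanish M p"
  unfolding vanish_def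
proof (intro allI impI)
  fix i j assume ij: "i < M" "j < M"
  obtain a b where ab: "cf s a b \<noteq> 0" using exists_nonzero_cf[OF assms(1)] .
  obtain D where D: "\<And>a b. cf s a b \<noteq> 0 \<Longrightarrow> a < D \<and> b < D" using exists_cf_bound[of s] by blast
  \<comment> \<open>Since \<open>q\<close> exceeds every exponent of \<open>s\<close>, distinct
    monomials of \<open>s\<close> have distinct exponents mod \<open>q\<close>, and the coefficient
    of \<open>s * p ^ q\<close> at \<open>(I, J)\<close> is a single product.\<close>
  define q where "q = (2::nat) ^ D"
  have Dq: "D \<le> q" unfolding q_def using less_exp[of D] by simp
  have lt: "a < q" "b < q" using D[OF ab] Dq by auto
  define I J where "I = q * i + a" and "J = q * j + b"
  have bd: "q * i + a < M * q" "q * j + b < M * q"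
  proof -
    have "q * i + a < q * Suc i" "q * j + b < q * Suc j" using lt by simp_all
    moreover have "q * Suc i \<le> q * M" "q * Suc j \<le> q * M" using ij by (intro mult_le_mono2; simp)+
    ultimately show "q * i + a < M * q" "q * j + b < M * q" by (simp_all add: mult.commute)
  qed
  have dvd_eq: "a' = a" if "q dvd q * i + a - a'" "a' < q" "a' \<le> q * i + a" "a < q" for a' a i
  proof -
    have "(q * i + a) mod q = a' mod q"
      using that by (metis mod_eq_dvd_iff_nat)
    then show ?thesis using that by simp
  qed
  have "cf s a' b' * cf (p ^ q) (I - a') (J - b') = (if a' = a \<and> b' = b then cf s a b * (cf p i j) ^ q else 0)"
    if "a' \<le> I" "b' \<le> J" for a' b'
  proof (cases "cf s a' b' = 0 \<or> \<not> (q dvd I - a' \<and> q dvd J - b')")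
    case True
    have "\<not> (a' = a \<and> b' = b)" using True ab by (auto simp: I_def J_def)
    then show ?thesis using True by (auto simp: q_def cf_frobenius)
  next
    case False
    then have "a' < q" "b' < q" using D[of a' b'] Dq by auto
    then have e: "a' = a" "b' = b"
      using False that dvd_eq lt unfolding I_def J_def by blast+
    have "cf (p ^ q) (I - a) (J - b) = (cf p i j) ^ q"
      unfolding I_def J_def q_def by (simp add: cf_frobenius)
    then show ?thesis by (simp add: e)
  qed
  then have "cf (s * p ^ q) I J = (\<Sum>b'\<le>J. \<Sum>a'\<le>I. if a' = a \<and> b' = b then cf s a b * (cf p i j) ^ q else 0)"
    unfolding cf_mult by (intro sum.cong refl) auto
  also have "\<dots> = (\<Sum>b'\<le>J. if b' = b then cf s a b * (cf p i j) ^ q else 0)"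
    by (intro sum.cong refl) (auto simp: I_def)
  also have "\<dots> = cf s a b * (cf p i j) ^ q" by (simp add: J_def)
  finally have "cf s a b * (cf p i j) ^ q = 0"
    using van[of D] bd unfolding vanish_def I_def J_def q_def by simp
  then show "cf p i j = 0" using ab by simp
qed

section \<open>Frobenius on the quartic extension\<close>

type_synonym 'a quad = "'a \<times> 'a \<times> 'a \<times> 'a"

text \<open>Coordinates of the square of \<open>h0 + h1 z + h2 z^2 + h3 z^3\<close> modulo
  \<open>z^4 + A z^2 + B z + C\<close> in characteristic two; \<open>qd_frob\<close> confirms
  this.\<close>

fun frob :: "'a \<Rightarrow> 'a \<Rightarrow> 'a \<Rightarrow> 'a quad \<Rightarrow> 'a :: comm_ring_1 quad" where
  "frob A B C (h0, h1, h2, h3) = (h0 ^ 2 + C * h2 ^ 2 + A * C * h3 ^ 2, A * B * h3 ^ 2 + B * h2 ^ 2,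
     (A ^ 2 + C) * h3 ^ 2 + A * h2 ^ 2 + h1 ^ 2, B * h3 ^ 2)"

definition c1 :: "'a quad \<Rightarrow> 'a" where "c1 h = fst (snd h)"
definition c2 :: "'a quad \<Rightarrow> 'a" where "c2 h = fst (snd (snd h))"
definition c3 :: "'a quad \<Rightarrow> 'a" where "c3 h = snd (snd (snd h))"

lemma frob_components:
  "c1 (frob A B C h) = A * B * (c3 h) ^ 2 + B * (c2 h) ^ 2"
  "c2 (frob A B C h) = (A ^ 2 + C) * (c3 h) ^ 2 + A * (c2 h) ^ 2 + (c1 h) ^ 2"
  "c3 (frob A B C h) = B * (c3 h) ^ 2"
  by (cases h; simp add: c1_def c2_def c3_def)+

text \<open>The top coordinate evolves on its own, each step replacing \<open>c3\<close> by
  \<open>B\<close> times its square.\<close>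

lemma mult_c3_frob_iterate: "B * c3 ((frob A B C ^^ k) h) = (B * c3 h) ^ 2 ^ k"
proof (induction k)
  case (Suc k)
  have "B * c3 ((frob A B C ^^ Suc k) h) = (B * c3 ((frob A B C ^^ k) h)) ^ 2"
    by (simp add: frob_components power2_eq_square mult_ac)
  then show ?case unfolding Suc.IH by (simp add: power_mult[symmetric] mult.commute)
qed simp

text \<open>Multiplication by \<open>B\<close>, the derivative of the quartic, recovers the coordinates from those of
  the Frobenius powers: this is the test element property of the Jacobian.\<close>

lemma c2_from_frob_iterate:
  fixes A B C :: "'a :: comm_ring_char2"
  shows "\<exists>p r t. p * c2 ((frob A B C ^^ k) h) + r * c1 ((frob A B C ^^ k) h) + t * c3 ((frob A B C ^^ k) h)
    = B ^ (2 ^ k - 1) * (c2 h) ^ 2 ^ k"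
proof (induction k)
  case 0
  show ?case by (rule exI[of _ 1], rule exI[of _ 0], rule exI[of _ 0]) simp
next
  case (Suc k)
  define u where "u = (frob A B C ^^ k) h"
  obtain p r t where e: "p * c2 u + r * c1 u + t * c3 u = B ^ (2 ^ k - 1) * (c2 h) ^ 2 ^ k"
    using Suc.IH unfolding u_def by blast
  define v where "v = frob A B C u"
  have "B ^ (2 ^ Suc k - 1) * (c2 h) ^ 2 ^ Suc k = B * (B ^ (2 ^ k - 1) * (c2 h) ^ 2 ^ k) ^ 2"
  proof -
    have "2 ^ Suc k - 1 = Suc (2 * (2 ^ k - 1))" by (cases "(2::nat) ^ k") simp_all
    then show ?thesis by (simp add: power_mult_distrib power_even_eq)
  qed
  also have "\<dots> = B * (p ^ 2 * (c2 u) ^ 2 + r ^ 2 * (c1 u) ^ 2 + t ^ 2 * (c3 u) ^ 2)"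
    unfolding e[symmetric] by (simp add: power2_add_char2 power_mult_distrib)
  \<comment> \<open>The formulas for \<open>frob\<close> solved for the old coordinates:
    \<open>B\<close> times each of their squares is a combination of the new coordinates.\<close>
  also have "\<dots> = r ^ 2 * B * c2 v + (p ^ 2 + r ^ 2 * A) * c1 v
      + (p ^ 2 * A + r ^ 2 * (A ^ 2 + A ^ 2 + C) + t ^ 2) * c3 v"
    unfolding v_def frob_components by (simp add: algebra_simps power2_eq_square)
  finally have eq: "r ^ 2 * B * c2 v + (p ^ 2 + r ^ 2 * A) * c1 v
      + (p ^ 2 * A + r ^ 2 * (A ^ 2 + A ^ 2 + C) + t ^ 2) * c3 v
      = B ^ (2 ^ Suc k - 1) * (c2 h) ^ 2 ^ Suc k" by (rule sym)
  have v: "(frob A B C ^^ Suc k) h = v" by (simp add: u_def v_def)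
  show ?case unfolding v using eq by (intro exI)
qed

lemma vanish_scalar:
  fixes p :: "'a :: field poly poly"
  assumes "vanish M ([:[:c:]:] * p)" "c \<noteq> 0"
  shows "vanish M p"
proof -
  have "[:[:inverse c:]:] * [:[:c:]:] = (1 :: 'a poly poly)" using assms(2) by (simp add: one_pCons)
  then have "p = [:[:inverse c:]:] * ([:[:c:]:] * p)" by (simp only: mult.assoc[symmetric] mult_1_left)
  then show ?thesis using vanish_mult[OF assms(1)] by metis
qed

text \<open>The parameter of the quartic is \<open>\<eta>^4\<close>. One square root is needed to
  make \<open>fC\<close> a square, the other to take the root of \<open>\<delta>\<close> in
  \<open>tight_step2\<close>.\<close>

locale quartic_frobenius =
  fixes \<eta> :: "'a :: {field, comm_ring_char2}"
  assumes eta_nz: "\<eta> \<noteq> 0"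
begin

abbreviation "\<delta> \<equiv> [:[:\<eta> ^ 2:]:] :: 'a poly poly"
abbreviation "fA \<equiv> px * py :: 'a poly poly"
abbreviation "fB \<equiv> px ^ 3 + py ^ 3 :: 'a poly poly"
abbreviation "fC \<equiv> (\<delta> * fA) ^ 2"
abbreviation "fr \<equiv> frob fA fB fC"

text \<open>\<open>h\<close> stands for the element with coordinates \<open>h\<close> in the basis \<open>1, z, z\<^sup>2, z\<^sup>3\<close>; \<open>tight M h\<close> says that
  it lies in the tight closure of \<open>(x\<^sup>M, y\<^sup>M)\<close>, with a multiplier from \<open>L[x, y]\<close>.\<close>

definition tight :: "nat \<Rightarrow> 'a poly poly quad \<Rightarrow> bool" where
  "tight M h \<longleftrightarrow> (\<exists>s. s \<noteq> 0 \<and> (\<forall>k. vanish (M * 2 ^ k) (s * c1 ((fr ^^ k) h)) \<and>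
     vanish (M * 2 ^ k) (s * c2 ((fr ^^ k) h)) \<and> vanish (M * 2 ^ k) (s * c3 ((fr ^^ k) h))))"

lemma tight_frob:
  assumes "tight M h"
  shows "tight (2 * M) (fr h)"
proof -
  obtain s where s: "s \<noteq> 0" "\<And>k. vanish (M * 2 ^ k) (s * c1 ((fr ^^ k) h)) \<and>
     vanish (M * 2 ^ k) (s * c2 ((fr ^^ k) h)) \<and> vanish (M * 2 ^ k) (s * c3 ((fr ^^ k) h))"
    using assms unfolding tight_def by blast
  have "M * 2 ^ Suc k = 2 * M * 2 ^ k" "(fr ^^ Suc k) h = (fr ^^ k) (fr h)" for k
    by (simp_all only: funpow_Suc_right o_apply power_Suc mult_ac)
  then show ?thesis unfolding tight_def using s(1) s(2)[of "Suc _"] by (metis (no_types, lifting))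
qed

text \<open>By \<open>c2_from_frob_iterate\<close>, with one more factor \<open>fB\<close> to
  complete the exponent, \<open>s * (fB * c2 h) ^ 2 ^ k\<close> is a combination of the products
  that vanish by tightness; flatness of Frobenius then removes \<open>s\<close>.\<close>

lemma tight_mult_B:
  assumes "tight M h"
  shows "vanish M (fB * c2 h)"
proof -
  obtain s where s: "s \<noteq> 0" "\<And>k. vanish (M * 2 ^ k) (s * c1 ((fr ^^ k) h))"
     "\<And>k. vanish (M * 2 ^ k) (s * c2 ((fr ^^ k) h))" "\<And>k. vanish (M * 2 ^ k) (s * c3 ((fr ^^ k) h))"
    using assms unfolding tight_def by blast
  show ?thesis
  proof (rule vanish_frobenius_multiplier[OF s(1)])
    fix k
    obtain p r t where e: "p * c2 ((fr ^^ k) h) + r * c1 ((fr ^^ k) h) + t * c3 ((fr ^^ k) h)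
        = fB ^ (2 ^ k - 1) * (c2 h) ^ 2 ^ k"
      using c2_from_frob_iterate by blast
    have "fB * fB ^ (2 ^ k - 1) = fB ^ 2 ^ k"
      by (simp only: power_Suc[symmetric]) simp
    then have "s * (fB * c2 h) ^ 2 ^ k = s * (fB * (fB ^ (2 ^ k - 1) * (c2 h) ^ 2 ^ k))"
      by (simp only: power_mult_distrib mult.assoc[symmetric])
    also have "\<dots> = fB * p * (s * c2 ((fr ^^ k) h)) + fB * r * (s * c1 ((fr ^^ k) h)) + fB * t * (s * c3 ((fr ^^ k) h))"
      unfolding e[symmetric] by (simp only: distrib_left distrib_right mult_ac)
    also have "vanish (M * 2 ^ k) \<dots>"
      by (intro vanish_add vanish_mult s)
    finally show "vanish (M * 2 ^ k) (s * (fB * c2 h) ^ 2 ^ k)" .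
  qed
qed

text \<open>Because \<open>fC\<close> is a square, the part
  \<open>(fA^2 + fC) * (c3 h)^2 + (c1 h)^2\<close> of \<open>c2 (fr h)\<close> is a square; this is
  its root.\<close>

definition cE :: "'a poly poly quad \<Rightarrow> 'a poly poly" where
  "cE h = (1 + \<delta>) * fA * c3 h + c1 h"

lemma c2_frob_cE: "c2 (fr h) = (cE h) ^ 2 + fA * (c2 h) ^ 2"
  unfolding frob_components cE_def
  by (simp only: power2_add_char2 power_mult_distrib power_one distrib_right mult_1_left add_ac)

text \<open>Each step applies the preceding one to the Frobenius image of \<open>h\<close> and compares coordinates with
  respect to the basis \<open>1, x, y, x y\<close> of \<open>L[x, y]\<close> over its squares.\<close>

lemma tight_step1:
  assumes "tight M h"
  shows "vanish M (py * cE h + px ^ 2 * c2 h)"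
proof -
  have "fB * c2 (fr h) = 0 ^ 2 + px * (px * cE h + py ^ 2 * c2 h) ^ 2
      + py * (py * cE h + px ^ 2 * c2 h) ^ 2 + px * (py * 0 ^ 2)"
    unfolding c2_frob_cE power2_add_char2
    by (simp add: algebra_simps power2_eq_square eval_nat_numeral)
  then show ?thesis
    using vanish_square_basis(2)[of M 0 "px * cE h + py ^ 2 * c2 h" "py * cE h + px ^ 2 * c2 h" 0]
      tight_mult_B[OF tight_frob[OF assms]] by metis
qed

lemma cE_frob: "cE (fr h) = \<delta> * fA * fB * (c3 h) ^ 2 + fB * (c2 h) ^ 2"
  unfolding cE_def frob_components
  by (simp only: distrib_right mult_1_left mult.assoc) (simp only: add_self_left_char2 add_ac)

lemma tight_step2:
  assumes "tight M h"
  shows "vanish M (py ^ 2 * c3 h)"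
proof -
  \<comment> \<open>The root of \<open>\<delta>\<close>, which lets the coordinate at
    \<open>x y\<close> be written as a square.\<close>
  define e :: "'a poly poly" where "e = [:[:\<eta>:]:]"
  have d: "\<delta> = e ^ 2" by (simp add: e_def power2_eq_square)
  have id: "y * (e ^ 2 * (x * y) * (x ^ 3 + y ^ 3) * u3 ^ 2 + (x ^ 3 + y ^ 3) * u2 ^ 2)
        + x ^ 2 * (E ^ 2 + x * y * u2 ^ 2)
      = (e * x ^ 2 * y * u3 + y ^ 2 * u2 + x * E) ^ 2
      + x * 0 ^ 2 + y * 0 ^ 2 + x * (y * (e * (y ^ 2 * u3)) ^ 2)"
    for x y u2 u3 E :: "'a poly poly"
    unfolding power2_add_char2 by (simp add: algebra_simps power2_eq_square eval_nat_numeral)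
  have eq: "py * cE (fr h) + px ^ 2 * c2 (fr h)
      = (e * px ^ 2 * py * c3 h + py ^ 2 * c2 h + px * cE h) ^ 2
      + px * 0 ^ 2 + py * 0 ^ 2 + px * (py * (e * (py ^ 2 * c3 h)) ^ 2)"
    unfolding c2_frob_cE cE_frob unfolding d by (rule id)
  have "vanish M (e * (py ^ 2 * c3 h))"
    using tight_step1[OF tight_frob[OF assms]] unfolding eq by (rule vanish_square_basis(3))
  then show ?thesis unfolding e_def using eta_nz by (rule vanish_scalar)
qed

lemma tight_step3:
  assumes "tight M h"
  shows "vanish M (px * py * c3 h)"
proof -
  have e: "py ^ 2 * c3 (fr h) = 0 ^ 2 + px * (px * py * c3 h) ^ 2 + py * (py ^ 2 * c3 h) ^ 2 + px * (py * 0 ^ 2)"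
    unfolding frob_components by (simp add: algebra_simps power2_eq_square eval_nat_numeral)
  show ?thesis
    using tight_step2[OF tight_frob[OF assms]] unfolding e by (rule vanish_square_basis(1))
qed

end

section \<open>Periodicity of the trace sequence\<close>

lemma finite_bounded_degree_bit: "finite {p :: bit poly. degree p \<le> n}"
proof (induction n)
  case 0
  have "{p :: bit poly. degree p \<le> 0} \<subseteq> (\<lambda>a. [:a:]) ` {0, 1}"
  proof
    fix p :: "bit poly" assume "p \<in> {p. degree p \<le> 0}"
    then obtain a where "p = [:a:]" by (auto elim: degree_eq_zeroE)
    then show "p \<in> (\<lambda>a. [:a:]) ` {0, 1}" by (cases a) auto
  qed
  then show ?case by (rule finite_subset) simp
next
  case (Suc n)
  have "{p :: bit poly. degree p \<le> Suc n} \<subseteq> (\<lambda>(a, p). pCons a p) ` ({0, 1} \<times> {p. degree p \<le> n})"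
  proof
    fix p :: "bit poly" assume p: "p \<in> {p. degree p \<le> Suc n}"
    obtain a q where q: "p = pCons a q" by (cases p)
    then have "degree q \<le> n" using p by (auto split: if_splits)
    moreover have "a \<in> {0, 1}" by (cases a) auto
    ultimately show "p \<in> (\<lambda>(a, p). pCons a p) ` ({0, 1} \<times> {p. degree p \<le> n})"
      using q by auto
  qed
  then show ?case by (rule finite_subset) (use Suc in simp)
qed

lemma to_ac_eval_add:
  "poly (map_poly to_ac (p + q)) x = poly (map_poly to_ac p) x + poly (map_poly to_ac q) x"
proof -
  have "map_poly to_ac (p + q) = map_poly to_ac p + map_poly to_ac q"
    by (intro poly_eqI) (simp add: coeff_map_poly)
  then show ?thesis by simp
qed

lemma to_ac_eval_mult:
  "poly (map_poly to_ac (p * q)) x = poly (map_poly to_ac p) x * poly (map_poly to_ac q) x"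
proof -
  have "map_poly to_ac (p * q) = map_poly to_ac p * map_poly to_ac q"
    by (intro poly_eqI) (simp add: coeff_map_poly coeff_mult to_ac_sum)
  then show ?thesis by simp
qed

text \<open>As \<open>x\<close> is algebraic over the field with two elements, division by a
  polynomial annihilating it leaves remainders of bounded degree, of which there are finitely
  many.\<close>

lemma finite_eval_bit_poly: "finite (range (\<lambda>p. poly (map_poly to_ac p) (x :: L)))"
proof -
  obtain m :: "bit poly" where m: "m \<noteq> 0" "poly (map_poly to_ac m) x = 0"
    using alg_closure_algebraic[of x] by blast
  have "range (\<lambda>p. poly (map_poly to_ac p) x)
      \<subseteq> (\<lambda>p. poly (map_poly to_ac p) x) ` {p. degree p \<le> degree m}"
  proof clarify
    fix p
    have "degree (p mod m) \<le> degree m"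
      using degree_mod_less[of m p] m(1) by auto
    moreover have "poly (map_poly to_ac p) x = poly (map_poly to_ac (p div m * m + p mod m)) x"
      by simp
    then have "poly (map_poly to_ac p) x = poly (map_poly to_ac (p mod m)) x"
      by (simp only: to_ac_eval_add to_ac_eval_mult m(2) mult_zero_right add_0_left)
    ultimately show "poly (map_poly to_ac p) x \<in> (\<lambda>p. poly (map_poly to_ac p) x) ` {p. degree p \<le> degree m}"
      by blast
  qed
  then show ?thesis using finite_bounded_degree_bit by (rule finite_subset[OF _ finite_imageI])
qed

text \<open>All values are polynomials in \<open>\<delta>\<close> over the field with two elements,
  so two of them agree. Cancelling \<open>\<delta>\<close> and a square moves the coincidence down
  to index 0.\<close>

lemma trs_periodic: "\<exists>k\<ge>1. trs (\<delta> :: L) k = 0"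
proof -
  let ?F = "range (\<lambda>p. poly (map_poly to_ac p) \<delta>)"
  have "trs \<delta> k \<in> ?F" for k
  proof (induction k)
    case 0
    show ?case by (rule range_eqI[of _ _ 0]) simp
  next
    case (Suc k)
    then obtain p where p: "trs \<delta> k = poly (map_poly to_ac p) \<delta>" by blast
    have "poly (map_poly to_ac [:0, 1:]) \<delta> = \<delta>"
      by (simp add: map_poly_pCons)
    then have "trs \<delta> (Suc k) = poly (map_poly to_ac ([:0, 1:] + p * p)) \<delta>"
      by (simp only: trs.simps p to_ac_eval_add to_ac_eval_mult power2_eq_square)
    then show ?case by blast
  qed
  then have "range (trs \<delta>) \<subseteq> ?F" by blast
  then have "finite (range (trs \<delta>))" using finite_eval_bit_poly by (rule finite_subset)
  then have "\<not> inj (trs \<delta>)" using finite_imageD[of "trs \<delta>" UNIV] by auto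
  then obtain i j where ij: "i < j" "trs \<delta> i = trs \<delta> j"
    unfolding inj_def by (metis linorder_neqE_nat)
  have "trs \<delta> i = trs \<delta> (i + d) \<Longrightarrow> trs \<delta> d = 0" for i d
  proof (induction i)
    case (Suc i)
    then have "(trs \<delta> i) ^ 2 + (trs \<delta> (i + d)) ^ 2 = 0" by (simp add: add_eq_0_char2)
    then have "(trs \<delta> i + trs \<delta> (i + d)) ^ 2 = 0" by (simp only: power2_add_char2)
    then have "trs \<delta> i = trs \<delta> (i + d)" by (simp add: add_eq_0_char2)
    then show ?case by (rule Suc.IH)
  qed simp
  from this[of i "j - i"] ij show ?thesis by (intro exI[of _ "j - i"]) auto
qed

lemma first_zero_trs:
  assumes "\<delta> \<noteq> (0 :: L)"
  obtains n where "\<And>k. 1 \<le> k \<Longrightarrow> k \<le> Suc n \<Longrightarrow> trs \<delta> k \<noteq> 0" "trs \<delta> (Suc (Suc n)) = 0"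
proof -
  define k0 where "k0 = (LEAST k. 1 \<le> k \<and> trs \<delta> k = 0)"
  have k0: "1 \<le> k0" "trs \<delta> k0 = 0"
    using LeastI_ex[of "\<lambda>k. 1 \<le> k \<and> trs \<delta> k = 0"] trs_periodic[of \<delta>] unfolding k0_def by blast+
  have least: "trs \<delta> k \<noteq> 0" if "1 \<le> k" "k < k0" for k
    using not_less_Least[of k "\<lambda>k. 1 \<le> k \<and> trs \<delta> k = 0"] that unfolding k0_def by blast
  \<comment> \<open>\<open>trs \<delta> 1\<close> is \<open>\<delta>\<close> itself.\<close>
  have "k0 \<noteq> 1" using k0(2) assms by auto
  then have "k0 = Suc (Suc (k0 - 2))" using k0(1) by simp
  then show thesis using that[of "k0 - 2"] k0(2) least by (metis less_Suc_eq_le)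
qed

section \<open>Polynomials in \<open>z\<close> modulo a monic quartic\<close>

lemma eps_const: "eps [:[:c:]:] m i = [:[:eps c m i:]:]"
  by (induction m arbitrary: i) (simp_all add: power2_eq_square)

definition qd :: "'a quad \<Rightarrow> 'a :: comm_ring_1 poly" where
  "qd h = [:fst h, c1 h, c2 h, c3 h:]"

definition quart :: "'a \<Rightarrow> 'a \<Rightarrow> 'a \<Rightarrow> 'a :: comm_ring_1 poly" where
  "quart A B C = [:C, B, A, 0, 1:]"

lemma const_poly_hom:
  "[:a + b:] = [:a:] + [:b:]" "[:a * b:] = [:a:] * [:b:]" "[:a ^ n:] = [:a:] ^ n"
  for a :: "'a :: comm_ring_1"
proof -
  show "[:a ^ n:] = [:a:] ^ n"
  proof (induction n)
    case (Suc n)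
    have "[:a ^ Suc n:] = [:a:] * [:a ^ n:]" by simp
    then show ?case by (simp only: Suc.IH power_Suc)
  qed (simp add: one_pCons)
qed simp_all

lemma qd_expand: "qd h = [:fst h:] + [:c1 h:] * [:0, 1:] + [:c2 h:] * [:0, 1:] ^ 2 + [:c3 h:] * [:0, 1:] ^ 3"
  by (simp add: qd_def eval_nat_numeral)

lemma quart_expand: "quart A B C = [:0, 1:] ^ 4 + [:A:] * [:0, 1:] ^ 2 + [:B:] * [:0, 1:] + [:C:]"
  by (simp add: quart_def eval_nat_numeral)

lemma frob_fst: "fst (frob A B C h) = (fst h) ^ 2 + C * (c2 h) ^ 2 + A * C * (c3 h) ^ 2"
  by (cases h) (simp add: c2_def c3_def)

lemma qd_frob:
  fixes A B C :: "'a :: comm_ring_char2"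
  shows "quart A B C dvd (qd h) ^ 2 + qd (frob A B C h)"
proof -
  have id: "(a0 + a1 * z + a2 * z ^ 2 + a3 * z ^ 3) ^ 2 +
     ((a0 ^ 2 + C * a2 ^ 2 + A * C * a3 ^ 2) + (A * B * a3 ^ 2 + B * a2 ^ 2) * z
      + ((A ^ 2 + C) * a3 ^ 2 + A * a2 ^ 2 + a1 ^ 2) * z ^ 2 + (B * a3 ^ 2) * z ^ 3)
     = (z ^ 4 + A * z ^ 2 + B * z + C) * (a3 ^ 2 * z ^ 2 + a2 ^ 2 + A * a3 ^ 2)"
    for a0 a1 a2 a3 z A B C :: "'a poly"
    unfolding power2_add_char2 by (simp add: algebra_simps power2_eq_square eval_nat_numeral)
  show ?thesis
    unfolding qd_expand quart_expand frob_components frob_fst const_poly_hom id by simp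
qed

lemma qd_frob_iterate:
  fixes A B C :: "'a :: comm_ring_char2"
  assumes "quart A B C dvd p + qd h"
  shows "quart A B C dvd p ^ 2 ^ k + qd ((frob A B C ^^ k) h)"
proof (induction k)
  case (Suc k)
  define u where "u = (frob A B C ^^ k) h"
  have "quart A B C dvd (p ^ 2 ^ k + qd u) ^ 2"
    using Suc.IH unfolding u_def power2_eq_square by (rule dvd_mult)
  then have "quart A B C dvd (p ^ 2 ^ k + qd u) ^ 2 + ((qd u) ^ 2 + qd (frob A B C u))"
    using qd_frob by (rule dvd_add)
  also have "(p ^ 2 ^ k + qd u) ^ 2 + ((qd u) ^ 2 + qd (frob A B C u)) = p ^ 2 ^ Suc k + qd (frob A B C u)"
    by (simp add: power2_add_char2 power_mult[symmetric] mult.commute)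
  finally show ?case by (simp add: u_def)
qed (use assms in simp)

lemma vanish_sum:
  fixes f :: "'b \<Rightarrow> 'a :: comm_ring_1 poly poly"
  shows "(\<And>i. i \<in> I \<Longrightarrow> vanish M (f i)) \<Longrightarrow> vanish M (sum f I)"
  by (induction I rule: infinite_finite_induct) (auto intro: vanish_add)

text \<open>The quartic is monic of degree 4 and \<open>qd u\<close> has degree at most 3.
  Descending from the top, every coefficient of \<open>k\<close> lies in \<open>(x^M, y^M)\<close>;
  hence so does \<open>quart A B C * k\<close>, and with it \<open>qd u\<close>.\<close>

lemma vanish_mod_quart:
  fixes A B C :: "'a :: comm_ring_char2 poly poly"
  assumes van: "\<And>l. vanish M (coeff (qd u + quart A B C * k) l)"
  shows "vanish M (c1 u)" "vanish M (c2 u)" "vanish M (c3 u)"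
proof -
  have g: "coeff (quart A B C * k) (l + 4) = C * coeff k (l + 4) + (B * coeff k (l + 3) + (A * coeff k (l + 2) + coeff k l))" for l
    by (simp add: quart_def eval_nat_numeral)
  have q: "coeff (qd u) (l + 4) = 0" for l by (simp add: qd_def eval_nat_numeral)
  have top: "vanish M (coeff k l)" if "degree k < l + d" for l d
    using that
  proof (induction d arbitrary: l)
    case 0
    then show ?case by (simp add: coeff_eq_0)
  next
    case (Suc d)
    have "coeff k l = coeff (qd u + quart A B C * k) (l + 4)
        + (C * coeff k (l + 4) + (B * coeff k (l + 3) + A * coeff k (l + 2)))"
      unfolding coeff_add g q by (simp add: add_ac)
    moreover have "vanish M (coeff k (l + 4))" "vanish M (coeff k (l + 3))" "vanish M (coeff k (l + 2))"
      using Suc.prems by (auto intro!: Suc.IH)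
    then have "vanish M (coeff (qd u + quart A B C * k) (l + 4)
        + (C * coeff k (l + 4) + (B * coeff k (l + 3) + A * coeff k (l + 2))))"
      by (intro vanish_add vanish_mult van)
    ultimately show ?case by (simp only:)
  qed
  have "vanish M (coeff k l)" for l by (rule top[of _ "Suc (degree k)"]) simp
  then have "vanish M (coeff (quart A B C * k) l)" for l
    unfolding coeff_mult by (intro vanish_sum vanish_mult)
  then have "vanish M (coeff (qd u + quart A B C * k) l + coeff (quart A B C * k) l)" for l
    using van by (intro vanish_add)
  then have "vanish M (coeff (qd u) l)" for l by (simp add: add.assoc)
  from this[of 1] this[of 2] this[of 3] show "vanish M (c1 u)" "vanish M (c2 u)" "vanish M (c3 u)"
    by (simp_all add: qd_def eval_nat_numeral)
qed

section \<open>The ideals \<open>(x^N, y^N)\<close> and \<open>(x^N, y^N, z^N)\<close> modulo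
  \<open>g\<close>\<close>

definition in_pow_mod :: "'a :: comm_ring_char2 \<Rightarrow> 'a \<Rightarrow> 'a \<Rightarrow> nat \<Rightarrow> 'a \<Rightarrow> bool" where
  "in_pow_mod g x y N p \<longleftrightarrow> (\<exists>r. in_pow x y N r \<and> g dvd p + r)"

lemma in_pow_mod_in_pow: "in_pow x y N p \<Longrightarrow> in_pow_mod g x y N p"
  unfolding in_pow_mod_def by (intro exI[of _ p]) simp

lemma in_pow_mod_cong:
  assumes "in_pow_mod g x y N p" "g dvd p + p'"
  shows "in_pow_mod g x y N p'"
proof -
  obtain r where r: "in_pow x y N r" "g dvd p + r" using assms(1) by (auto simp: in_pow_mod_def)
  have "g dvd (p + p') + (p + r)" using assms(2) r(2) by (rule dvd_add)
  also have "(p + p') + (p + r) = p' + r" by (simp add: add_ac)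
  finally show ?thesis using r(1) by (auto simp: in_pow_mod_def)
qed

lemma in_pow_mod_add:
  assumes "in_pow_mod g x y N p" "in_pow_mod g x y N p'"
  shows "in_pow_mod g x y N (p + p')"
proof -
  obtain r r' where r: "in_pow x y N r" "g dvd p + r" "in_pow x y N r'" "g dvd p' + r'"
    using assms by (auto simp: in_pow_mod_def)
  have "g dvd (p + r) + (p' + r')" using r(2,4) by (rule dvd_add)
  also have "(p + r) + (p' + r') = (p + p') + (r + r')" by (simp only: add_ac)
  finally show ?thesis using in_pow_add[OF r(1,3)] by (auto simp: in_pow_mod_def)
qed

lemma in_pow_mod_mult:
  assumes "in_pow_mod g x y N p"
  shows "in_pow_mod g x y N (c * p)"
proof -
  obtain r where r: "in_pow x y N r" "g dvd p + r" using assms(1) by (auto simp: in_pow_mod_def)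
  have "g dvd c * p + c * r" using r(2) by (simp flip: distrib_left)
  then show ?thesis using in_pow_mult[OF r(1)] by (auto simp: in_pow_mod_def)
qed

lemma in_pow_mod_frobenius:
  assumes "in_pow_mod g x y N p"
  shows "in_pow_mod g x y (N * 2 ^ k) (p ^ 2 ^ k)"
proof (induction k)
  case (Suc k)
  then obtain r where r: "in_pow x y (N * 2 ^ k) r" "g dvd p ^ 2 ^ k + r"
    by (auto simp: in_pow_mod_def)
  have "g dvd (p ^ 2 ^ k + r) ^ 2" using r(2) unfolding power2_eq_square by (rule dvd_mult)
  also have "(p ^ 2 ^ k + r) ^ 2 = p ^ 2 ^ Suc k + r ^ 2"
    by (simp add: power2_add_char2 power_mult[symmetric] mult.commute)
  finally show ?case
    using in_pow_square[OF r(1)] unfolding in_pow_mod_def by (auto simp: mult_ac)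
qed (use assms in simp)

text \<open>The ideal \<open>(x^N, y^N, z^N)\<close> modulo \<open>g\<close>. In characteristic two
  a sum is also a difference, so \<open>g dvd p + p'\<close> is congruence modulo
  \<open>g\<close>.\<close>

definition in_frob :: "'a :: comm_ring_char2 \<Rightarrow> 'a \<Rightarrow> 'a \<Rightarrow> 'a \<Rightarrow> nat \<Rightarrow> 'a \<Rightarrow> bool" where
  "in_frob g x y z N p \<longleftrightarrow> (\<exists>r c. in_pow x y N r \<and> g dvd p + (r + c * z ^ N))"

lemma in_frob_in_pow: "in_pow x y N p \<Longrightarrow> in_frob g x y z N p"
  unfolding in_frob_def by (rule exI[of _ p], rule exI[of _ 0]) simp

lemma in_frob_0: "in_frob g x y z N 0"
  by (intro in_frob_in_pow in_pow_0)

lemma in_frob_add: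
  assumes "in_frob g x y z N p" "in_frob g x y z N p'"
  shows "in_frob g x y z N (p + p')"
proof -
  obtain r c r' c' where r: "in_pow x y N r" "g dvd p + (r + c * z ^ N)"
    "in_pow x y N r'" "g dvd p' + (r' + c' * z ^ N)"
    using assms unfolding in_frob_def by blast
  have id: "(p + (r + c * Z)) + (p' + (r' + c' * Z)) = (p + p') + ((r + r') + (c + c') * Z)" for Z
    by (simp only: distrib_right add_ac)
  have "g dvd (p + p') + ((r + r') + (c + c') * z ^ N)"
    using dvd_add[OF r(2) r(4)] unfolding id .
  then show ?thesis using in_pow_add[OF r(1,3)] unfolding in_frob_def by blast
qed

lemma in_frob_mult:
  assumes "in_frob g x y z N p"
  shows "in_frob g x y z N (s * p)"
proof -
  obtain r c where r: "in_pow x y N r" "g dvd p + (r + c * z ^ N)"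
    using assms unfolding in_frob_def by blast
  have id: "s * (p + (r + c * Z)) = s * p + (s * r + s * c * Z)" for Z
    by (simp only: distrib_left mult.assoc)
  have "g dvd s * p + (s * r + s * c * z ^ N)"
    using dvd_mult[OF r(2), of s] unfolding id .
  then show ?thesis using in_pow_mult[OF r(1)] unfolding in_frob_def by blast
qed

lemma in_frob_cong:
  assumes "in_frob g x y z N p" "g dvd p + p'"
  shows "in_frob g x y z N p'"
proof -
  obtain r c where r: "in_pow x y N r" "g dvd p + (r + c * z ^ N)"
    using assms unfolding in_frob_def by blast
  have "g dvd (p + p') + (p + (r + c * z ^ N))" by (rule dvd_add[OF assms(2) r(2)])
  also have "(p + p') + (p + (r + c * z ^ N)) = p' + (r + c * z ^ N)" by (simp add: add_ac)
  finally show ?thesis using r(1) unfolding in_frob_def by blast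
qed

lemma in_frob_frobenius:
  assumes "in_frob g x y z N p"
  shows "in_frob g x y z (N * 2 ^ k) (p ^ 2 ^ k)"
proof (induction k)
  case (Suc k)
  then obtain r c where r: "in_pow x y (N * 2 ^ k) r" "g dvd p ^ 2 ^ k + (r + c * z ^ (N * 2 ^ k))"
    unfolding in_frob_def by blast
  have e: "(p ^ 2 ^ k + (r + c * z ^ (N * 2 ^ k))) ^ 2 = p ^ 2 ^ Suc k + (r ^ 2 + c ^ 2 * z ^ (N * 2 ^ Suc k))"
    by (simp add: power2_add_char2 power_mult_distrib power_mult[symmetric] mult_ac)
  have "g dvd (p ^ 2 ^ k + (r + c * z ^ (N * 2 ^ k))) ^ 2"
    by (rule dvd_trans[OF r(2) dvd_power]) simp
  then have "g dvd p ^ 2 ^ Suc k + (r ^ 2 + c ^ 2 * z ^ (N * 2 ^ Suc k))"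
    unfolding e .
  moreover have "in_pow x y (N * 2 ^ Suc k) (r ^ 2)"
    using in_pow_square[OF r(1)] by (simp add: mult_ac)
  ultimately show ?case unfolding in_frob_def by blast
qed (use assms in simp)

lemma vanish_in_pow_mod:
  fixes A B C :: "'a :: comm_ring_char2 poly poly"
  assumes "in_pow_mod (quart A B C) [:px:] [:py:] M (qd u)"
  shows "vanish M (c1 u)" "vanish M (c2 u)" "vanish M (c3 u)"
proof -
  obtain a b k where k: "qd u + (a * [:px:] ^ M + b * [:py:] ^ M) = quart A B C * k"
    using assms unfolding in_pow_mod_def in_pow_def by (auto elim!: dvdE)
  have "qd u + quart A B C * k = a * [:px:] ^ M + b * [:py:] ^ M"
    unfolding k[symmetric] by simp
  also have "\<dots> = smult (px ^ M) a + smult (py ^ M) b"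
    unfolding const_poly_hom[symmetric] by simp
  finally have e: "qd u + quart A B C * k = smult (px ^ M) a + smult (py ^ M) b" .
  have "in_pow px py M (coeff (qd u + quart A B C * k) l)" for l
    unfolding e in_pow_def
    by (rule exI[of _ "coeff a l"], rule exI[of _ "coeff b l"]) (simp add: mult.commute)
  then have v: "vanish M (coeff (qd u + quart A B C * k) l)" for l by (rule vanish_in_pow)
  show "vanish M (c1 u)" "vanish M (c2 u)" "vanish M (c3 u)"
    by (rule vanish_mod_quart[of M u A B C k], rule v)+
qed

lemma cf_form:
  "cf (form (\<lambda>a. [:[:v a:]:]) d px py) i j = (if i + j = d then v i else (0 :: 'a :: comm_ring_1))"
proof -
  have t: "cf ([:[:c:]:] * px ^ a * py ^ b) i j = (if i = a \<and> j = b then c else 0)" for c :: 'a and a b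
    by (simp add: cf_def px_power py_power mult_monom smult_monom flip: monom_0)
  have "cf (form (\<lambda>a. [:[:v a:]:]) d px py) i j = (\<Sum>a\<le>d. if i = a \<and> j = d - a then v a else 0)"
    unfolding form_def by (simp add: cf_def coeff_sum flip: t)
  also have "\<dots> = (\<Sum>a\<le>d. if a = i then (if i + j = d then v i else 0) else 0)"
    by (intro sum.cong) auto
  finally show ?thesis by auto
qed

section \<open>Failure of tight closure membership at an algebraic parameter\<close>

context
  fixes \<eta> :: L
  assumes eta: "\<eta> \<noteq> 0"
begin

interpretation quartic_frobenius \<eta>
  by unfold_locales (rule eta)

abbreviation (input) "gq \<equiv> quart fA fB fC :: L_xyz"

text \<open>The multiplier has degree only \<open>N / 2 - 1\<close>, where \<open>N = 2\<^bsup>n + 3\<^esup>\<close>: it witnesses that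
  the Frobenius pull-backs of the syzygy bundle of \<open>(x, y, z)\<close> are not all semistable.\<close>

lemma destabilizing_multiplier:
  obtains n V where "in_pow_mod gq [:px:] [:py:] (2 ^ (n + 3)) ([:fB * V ^ 2:] * [:0, 1:] ^ 2 ^ (n + 3))"
    "cf V (2 ^ n - 1) (2 ^ n - 1) \<noteq> 0"
proof -
  have d0: "\<eta> ^ 2 \<noteq> 0" using eta by simp
  obtain n where n: "\<And>k. 1 \<le> k \<Longrightarrow> k \<le> Suc n \<Longrightarrow> trs (\<eta> ^ 2) k \<noteq> 0" "trs (\<eta> ^ 2) (Suc (Suc n)) = 0"
    using first_zero_trs[OF d0] by blast
  obtain v where v: "v (2 ^ n - 1) \<noteq> 0" "\<And>p. 2 ^ Suc n - 1 \<le> p \<Longrightarrow> p < 2 ^ Suc (Suc n) \<Longrightarrow>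
       (\<Sum>a<2 ^ Suc n - 1. v a * eps (\<eta> ^ 2) (Suc (Suc n)) (p - a)) = 0"
    using toeplitz_kernel[OF n] by blast
  define q where "q = (2::nat) ^ Suc (Suc n)"
  define d where "d = (2::nat) ^ Suc n - 2"
  have qd: "q = 2 * 2 ^ Suc n" "Suc d = 2 ^ Suc n - 1" "d + 2 = 2 ^ Suc n"
  proof -
    have "(2::nat) ^ Suc n \<ge> 2" using one_le_power[of "2::nat" n] by simp
    then show "q = 2 * 2 ^ Suc n" "Suc d = 2 ^ Suc n - 1" "d + 2 = 2 ^ Suc n"
      by (simp_all add: q_def d_def del: power_Suc) simp
  qed
  define V where "V = form (\<lambda>a. [:[:v a:]:]) d px py"
  define E where "E = form (eps \<delta> (Suc (Suc n))) q px py"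
  \<comment> \<open>A monomial \<open>x^k y^(d + q - k)\<close> with both exponents below
    \<open>q\<close> has \<open>d < k < q\<close>, and there its coefficient is one of the kernel
    equations for \<open>v\<close>.\<close>
  have VE: "in_pow px py q (V * E)"
    unfolding V_def E_def form_mult
  proof (rule in_pow_form)
    fix k assume k: "k \<le> d + q" "k < q" "d + q - k < q"
    have "(\<Sum>a\<le>d. if a \<le> k \<and> k \<le> a + q then [:[:v a:]:] * eps \<delta> (Suc (Suc n)) (k - a) else 0)
        = (\<Sum>a\<le>d. [:[:v a * eps (\<eta> ^ 2) (Suc (Suc n)) (k - a):]:])"
      using k unfolding eps_const by (intro sum.cong refl) (simp del: eps.simps)
    also have "\<dots> = [:[:\<Sum>a\<le>d. v a * eps (\<eta> ^ 2) (Suc (Suc n)) (k - a):]:]"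
    proof -
      have h: "[:[:sum f I:]:] = (\<Sum>a\<in>I. [:[:f a:]:])" for f :: "nat \<Rightarrow> L" and I
      proof (induction I rule: infinite_finite_induct)
        case (insert x F)
        have "[:[:f x + sum f F:]:] = [:[:f x:]:] + [:[:sum f F:]:]" by simp
        then show ?case unfolding sum.insert[OF insert.hyps] insert.IH .
      qed simp_all
      show ?thesis unfolding h ..
    qed
    also have "(\<Sum>a\<le>d. v a * eps (\<eta> ^ 2) (Suc (Suc n)) (k - a)) = 0"
      using v(2)[of k] k qd unfolding lessThan_Suc_atMost[symmetric] qd(2)
      by (simp add: q_def del: eps.simps)
    finally show "(\<Sum>a\<le>d. if a \<le> k \<and> k \<le> a + q then [:[:v a:]:] * eps \<delta> (Suc (Suc n)) (k - a) else 0) = 0"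
      by simp
  qed
  define m where "m = Suc (Suc n)"
  have E: "E = zc fA fB fC m + \<delta> * fA * za fA fB m"
    unfolding E_def q_def m_def by (rule zc_plus_form_eps[symmetric])
  have zcE: "zc fA fB fC (Suc m) = E ^ 2"
    unfolding E power2_add_char2 zc.simps power_mult_distrib ..
  let ?N = "(2::nat) ^ Suc m"
  \<comment> \<open>In the expansion of \<open>z ^ ?N\<close> the factor \<open>V ^ 2\<close>
    disposes of \<open>zc\<close>, which is \<open>E ^ 2\<close>, while \<open>fB\<close> disposes
    of \<open>za\<close> and \<open>zb\<close>.\<close>
  have c: "in_pow px py ?N (fB * V ^ 2 * zc fA fB fC (Suc m))"
  proof -
    have "fB * V ^ 2 * zc fA fB fC (Suc m) = fB * (V * E) ^ 2"
      unfolding zcE by (simp only: power_mult_distrib mult.assoc)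
    then show ?thesis
      using in_pow_mult[OF in_pow_square[OF VE], of fB] by (simp only: q_def m_def power_Suc)
  qed
  have a: "in_pow px py ?N (fB * V ^ 2 * za fA fB (Suc m))"
    using in_pow_mult[OF in_pow_mult_za[where n = "Suc m" and x = px and y = py], where r = "V ^ 2"]
    by (simp only: mult_ac)
  have b: "in_pow px py ?N (fB * V ^ 2 * zb fA fB (Suc m))"
    using in_pow_mult[OF in_pow_mult_zb[where n = "Suc m" and x = px and y = py], where r = "V ^ 2"]
    by (simp only: mult_ac)
  have lift: "in_pow [:px:] [:py:] M ([:p:] * r)" if in_p: "in_pow px py M p" for M p and r :: L_xyz
  proof -
    obtain a b where "p = a * px ^ M + b * py ^ M" using in_p unfolding in_pow_def by blast
    then have "[:p:] = [:a:] * [:px:] ^ M + [:b:] * [:py:] ^ M" by (simp only: const_poly_hom)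
    then have "in_pow [:px:] [:py:] M [:p:]" unfolding in_pow_def by blast
    then show ?thesis by (rule in_pow_mult2)
  qed
  let ?z = "[:0, 1:] :: L_xyz"
  let ?exp = "[:za fA fB (Suc m):] * ?z ^ 2 + [:zb fA fB (Suc m):] * ?z + [:zc fA fB fC (Suc m):]"
  have "in_pow [:px:] [:py:] ?N ([:fB * V ^ 2 * za fA fB (Suc m):] * ?z ^ 2
      + [:fB * V ^ 2 * zb fA fB (Suc m):] * ?z + [:fB * V ^ 2 * zc fA fB fC (Suc m):] * 1)"
    by (intro in_pow_add lift a b c)
  also have "[:fB * V ^ 2 * za fA fB (Suc m):] * ?z ^ 2
      + [:fB * V ^ 2 * zb fA fB (Suc m):] * ?z + [:fB * V ^ 2 * zc fA fB fC (Suc m):] * 1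
      = [:fB * V ^ 2:] * ?exp"
  proof -
    have id: "W * a * y + W * b * z + W * c * 1 = W * (a * y + b * z + c)" for W a b c y z :: L_xyz
      by (simp add: distrib_left mult.assoc)
    show ?thesis by (simp only: const_poly_hom(2)[of "fB * V ^ 2"] id)
  qed
  finally have "in_pow_mod gq [:px:] [:py:] ?N ([:fB * V ^ 2:] * ?exp)"
    by (rule in_pow_mod_in_pow)
  moreover have "gq dvd [:fB * V ^ 2:] * ?exp + [:fB * V ^ 2:] * ?z ^ ?N"
  proof -
    have zab: "[:za A B k:] = za [:A:] [:B:] k \<and> [:zb A B k:] = zb [:A:] [:B:] k"
      for A B :: "L poly poly" and k
      by (induction k) (simp_all add: const_poly_hom one_pCons del: mult_pCons_left mult_pCons_right pCons_one)
    have zcc: "[:zc A B C k:] = zc [:A:] [:B:] [:C:] k" for A B C :: "L poly poly" and k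
      using zab by (induction k) (simp_all add: const_poly_hom del: mult_pCons_left mult_pCons_right)
    have "gq dvd ?z ^ ?N + ?exp"
      using power_z_expansion[of ?z "[:fA:]" "[:fB:]" "[:fC:]" "Suc m"] zab zcc
      unfolding quart_expand by (simp only:)
    then have "gq dvd [:fB * V ^ 2:] * (?z ^ ?N + ?exp)" by (rule dvd_mult)
    then show ?thesis by (simp only: distrib_left add_ac)
  qed
  ultimately have "in_pow_mod gq [:px:] [:py:] ?N ([:fB * V ^ 2:] * ?z ^ ?N)"
    by (rule in_pow_mod_cong)
  moreover have "?N = 2 ^ (n + 3)" by (simp add: m_def power_add)
  moreover have "cf V (2 ^ n - 1) (2 ^ n - 1) \<noteq> 0"
  proof -
    have "(2 ^ n - 1) + (2 ^ n - 1) = d" by (simp add: d_def)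
    then show ?thesis unfolding V_def cf_form using v(1) by simp
  qed
  ultimately show thesis using that by metis
qed

text \<open>Since \<open>w = fB * V ^ 2\<close> multiplies \<open>z ^ N\<close> into
  \<open>(x^N, y^N)\<close>, the element \<open>w f^Q\<close> would be tight at level
  \<open>N\<close> with the same multiplier \<open>s\<close>. By \<open>tight_step3\<close> its top
  coordinate then satisfies a vanishing condition, one coefficient of which is the square of the
  middle coefficient of \<open>V\<close>.\<close>

lemma not_tight:
  assumes s: "s \<noteq> (0 :: L poly poly)"
    and mem: "\<And>e. in_frob gq [:px:] [:py:] [:0, 1:] (4 * 2 ^ e)
       ([:s:] * ([:py:] ^ 3 * [:0, 1:] ^ 3) ^ 2 ^ e)"
  shows False
proof -
  obtain n V where w: "in_pow_mod gq [:px:] [:py:] (2 ^ (n + 3)) ([:fB * V ^ 2:] * [:0, 1:] ^ 2 ^ (n + 3))"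
    and V: "cf V (2 ^ n - 1) (2 ^ n - 1) \<noteq> 0"
    using destabilizing_multiplier by blast
  define K where "K = Suc n"
  define Q where "Q = (2::nat) ^ K"
  define N where "N = 4 * Q"
  have N: "N = 2 ^ (n + 3)" by (simp add: N_def Q_def K_def power_add)
  define w where "w = fB * V ^ 2"
  \<comment> \<open>The coordinates of \<open>z^(3 Q)\<close>, obtained from those of
    \<open>z^3\<close>; so \<open>h\<close> below holds the coordinates of
    \<open>w f^Q\<close>.\<close>
  define u0 where "u0 = (fr ^^ K) (0, 0, 0, 1)"
  define c where "c = w * py ^ (3 * Q)"
  define h where "h = (c * fst u0, c * c1 u0, c * c2 u0, c * c3 u0)"
  let ?z = "[:0, 1:] :: L_xyz" and ?f = "[:py:] ^ 3 * [:0, 1:] ^ 3 :: L_xyz"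
  have scale: "qd (b * fst u, b * c1 u, b * c2 u, b * c3 u) = [:b:] * qd u" for b and u :: "L poly poly quad"
    by (simp add: qd_def c1_def c2_def c3_def)
  have "qd (0, 0, 0, 1) = (?z ^ 3)" by (simp add: qd_def c1_def c2_def c3_def eval_nat_numeral)
  then have "gq dvd ?z ^ 3 + qd (0, 0, 0, 1)" by simp
  then have "gq dvd (?z ^ 3) ^ Q + qd u0"
    unfolding Q_def u0_def by (rule qd_frob_iterate)
  then have "gq dvd [:c:] * ((?z ^ 3) ^ Q + qd u0)" by (rule dvd_mult)
  also have "[:c:] * ((?z ^ 3) ^ Q + qd u0) = [:w:] * ?f ^ Q + qd h"
    unfolding h_def scale c_def by (simp only: const_poly_hom power_mult_distrib power_mult distrib_left mult.assoc)
  finally have h: "gq dvd [:w:] * ?f ^ Q + qd h" .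
  have "tight N h"
    unfolding tight_def
  proof (intro exI[of _ s] conjI allI)
    fix k
    define u where "u = (fr ^^ k) h"
    have u: "gq dvd ([:w:] * ?f ^ Q) ^ 2 ^ k + qd u" unfolding u_def by (rule qd_frob_iterate[OF h])
    obtain r b where r: "in_pow [:px:] [:py:] (4 * 2 ^ (K + k)) r"
      "gq dvd [:s:] * ?f ^ 2 ^ (K + k) + (r + b * ?z ^ (4 * 2 ^ (K + k)))"
      using mem[of "K + k"] unfolding in_frob_def by blast
    have Qk: "2 ^ (K + k) = Q * 2 ^ k" "4 * (Q * 2 ^ k) = N * 2 ^ k" by (simp_all add: Q_def N_def power_add)
    have r': "in_pow [:px:] [:py:] (N * 2 ^ k) r"
      "gq dvd [:s:] * ?f ^ (Q * 2 ^ k) + (r + b * ?z ^ (N * 2 ^ k))"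
      using r unfolding Qk by simp_all
    \<comment> \<open>The Frobenius power of \<open>w\<close> absorbs
      \<open>z ^ (N * 2 ^ k)\<close>, leaving an ideal generated by powers of \<open>x\<close> and
      \<open>y\<close> alone.\<close>
    have "in_pow_mod gq [:px:] [:py:] (N * 2 ^ k) ([:w:] ^ 2 ^ k * r + b * ([:w:] * ?z ^ N) ^ 2 ^ k)"
      by (rule in_pow_mod_add[OF in_pow_mod_in_pow[OF in_pow_mult[OF r'(1)]]
            in_pow_mod_mult[OF in_pow_mod_frobenius[OF w[folded N w_def]]]])
    moreover have "gq dvd ([:w:] ^ 2 ^ k * r + b * ([:w:] * ?z ^ N) ^ 2 ^ k) + [:s:] * qd u"
    proof -
      have "gq dvd [:w:] ^ 2 ^ k * ([:s:] * ?f ^ (Q * 2 ^ k) + (r + b * ?z ^ (N * 2 ^ k)))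
          + [:s:] * (([:w:] * ?f ^ Q) ^ 2 ^ k + qd u)"
        by (rule dvd_add[OF dvd_mult[OF r'(2)] dvd_mult[OF u]])
      also have "[:w:] ^ 2 ^ k * ([:s:] * ?f ^ (Q * 2 ^ k) + (r + b * ?z ^ (N * 2 ^ k)))
          + [:s:] * (([:w:] * ?f ^ Q) ^ 2 ^ k + qd u)
          = ([:w:] ^ 2 ^ k * r + b * ([:w:] * ?z ^ N) ^ 2 ^ k) + [:s:] * qd u"
      proof -
        have id: "W * (S * F + (R + b * Z)) + S * (W * F + U) = (W * R + b * (W * Z)) + S * U"
          for W S F R b Z U :: L_xyz
          by (simp add: algebra_simps)
        have "([:w:] * ?f ^ Q) ^ 2 ^ k = [:w:] ^ 2 ^ k * ?f ^ (Q * 2 ^ k)"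
          "([:w:] * ?z ^ N) ^ 2 ^ k = [:w:] ^ 2 ^ k * ?z ^ (N * 2 ^ k)"
          by (simp_all only: power_mult_distrib power_mult)
        then show ?thesis by (simp only: id)
      qed
      finally show ?thesis .
    qed
    ultimately have "in_pow_mod gq [:px:] [:py:] (N * 2 ^ k) ([:s:] * qd u)"
      by (rule in_pow_mod_cong)
    then have m: "in_pow_mod gq [:px:] [:py:] (N * 2 ^ k) (qd (s * fst u, s * c1 u, s * c2 u, s * c3 u))"
      by (simp only: scale)
    show "vanish (N * 2 ^ k) (s * c1 ((fr ^^ k) h))" "vanish (N * 2 ^ k) (s * c2 ((fr ^^ k) h))"
      "vanish (N * 2 ^ k) (s * c3 ((fr ^^ k) h))"
      using vanish_in_pow_mod[OF m] unfolding u_def by (simp_all add: c1_def c2_def c3_def)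
  qed (rule s)
  then have van: "vanish N (px * py * c3 h)" by (rule tight_step3)
  have c3u: "fB * c3 u0 = fB ^ Q"
    unfolding u0_def Q_def mult_c3_frob_iterate by (simp add: c3_def)
  have BQ: "fB ^ Q = px ^ (3 * Q) + py ^ (3 * Q)"
    unfolding Q_def frobenius_add_char2 by (simp add: power_mult[symmetric])
  have "px * py * c3 h = px ^ 1 * (py ^ 1 * (V ^ 2 * py ^ (3 * Q) * (fB * c3 u0)))"
    by (simp add: h_def c_def w_def c3_def mult_ac)
  also have "\<dots> = px ^ (3 * Q + 1) * (py ^ (3 * Q + 1) * V ^ 2) + px ^ 1 * (py ^ (6 * Q + 1) * V ^ 2)"
    unfolding c3u BQ by (simp add: algebra_simps power_add[symmetric])
  finally have e: "px * py * c3 h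
      = px ^ (3 * Q + 1) * (py ^ (3 * Q + 1) * V ^ 2) + px ^ 1 * (py ^ (6 * Q + 1) * V ^ 2)" .
  have Q2: "Q = 2 * 2 ^ n" "Q \<ge> 2" using one_le_power[of "2::nat" n] by (simp_all add: Q_def K_def)
  \<comment> \<open>The last corner of the vanishing range, \<open>N - 1 = 4 Q - 1\<close>: the
    summand with \<open>y^(6 Q + 1)\<close> does not reach it, and the other one contributes the
    coefficient of \<open>V ^ 2\<close> at \<open>(Q - 2, Q - 2)\<close>.\<close>
  have "0 = cf (px * py * c3 h) (N - 1) (N - 1)"
    using van Q2 unfolding vanish_def N_def by simp
  also have "\<dots> = cf (V ^ 2) (Q - 2) (Q - 2)"
  proof -
    have "N - 1 - (3 * Q + 1) = Q - 2" "\<not> N - 1 < 3 * Q + 1" "N - 1 < 6 * Q + 1" using Q2(2) by (simp_all add: N_def)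
    then show ?thesis unfolding e by (simp only: cf_add cf_px_power cf_py_power if_True if_False) simp
  qed
  also have "\<dots> = (cf V (2 ^ n - 1) (2 ^ n - 1)) ^ 2"
  proof -
    have "Q - 2 = 2 * (2 ^ n - 1)" using Q2 by simp
    then show ?thesis by (simp only: cf_square) simp
  qed
  finally show False using V by simp
qed

end

section \<open>Irreducibility of the quartics\<close>

abbreviation qC :: "'a \<Rightarrow> 'a :: comm_ring_1 poly poly" where
  "qC \<alpha> \<equiv> [:[:\<alpha>:]:] * px ^ 2 * py ^ 2"

lemma qC_eq: "qC \<alpha> = [:0, 0, [:0, 0, \<alpha>:]:]" for \<alpha> :: "'a :: comm_ring_1"
  by (simp add: px_def py_def eval_nat_numeral)

lemma fAB_eq:
  "px * py = [:0, [:0, 1:]:]" "px ^ 3 + py ^ 3 = [:[:0, 0, 0, 1:], 0, 0, 1 :: 'a :: comm_ring_1 poly:]"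
  by (simp_all add: px_def py_def eval_nat_numeral one_pCons)

lemma degree_one_cases:
  assumes "degree p = 1"
  obtains a b where "p = [:a, b:]" "b \<noteq> 0"
proof -
  obtain a p' where p: "p = pCons a p'" by (cases p)
  then have "p' \<noteq> 0" "degree p' = 0" using assms by (auto split: if_splits)
  then show thesis using that p by (auto elim!: degree_eq_zeroE)
qed

text \<open>Everything is compared in the outer variable \<open>y\<close>. A constant
  \<open>r\<close> is read off at \<open>y^3\<close>, a linear one contributes nothing at
  \<open>y^2\<close>, and from degree two on \<open>r ^ 4\<close> dominates.\<close>

lemma quartic_no_root:
  fixes r :: "'a :: {idom, comm_ring_char2} poly poly"
  assumes "\<alpha> \<noteq> 0"
  shows "r ^ 4 + px * py * r ^ 2 + (px ^ 3 + py ^ 3) * r \<noteq> qC \<alpha>"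
proof
  assume eq: "r ^ 4 + px * py * r ^ 2 + (px ^ 3 + py ^ 3) * r = qC \<alpha>"
  consider "degree r = 0" | "degree r = 1" | "degree r \<ge> 2" by linarith
  then show False
  proof cases
    case 1
    then obtain a where r: "r = [:a:]" by (auto elim: degree_eq_zeroE)
    have "coeff (r ^ 4 + px * py * r ^ 2 + (px ^ 3 + py ^ 3) * r) 3 = a"
      unfolding r fAB_eq by (simp add: eval_nat_numeral)
    then have "a = 0" unfolding eq qC_eq by (simp add: eval_nat_numeral)
    then show False using eq assms r unfolding qC_eq by simp
  next
    case 2
    then obtain a b where r: "r = [:a, b:]" by (rule degree_one_cases)
    have "coeff (r ^ 4 + px * py * r ^ 2 + (px ^ 3 + py ^ 3) * r) 2 = 0"
    proof -
      have r2: "r ^ 2 = [:a ^ 2, 0, b ^ 2:]" unfolding r by (simp add: power2_eq_square mult.commute)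
      have "r ^ 4 = (r ^ 2) ^ 2" by (simp flip: power_mult)
      then have "r ^ 4 = [:a ^ 4, 0, 0, 0, b ^ 4:]"
        unfolding r2 by (simp add: power2_eq_square eval_nat_numeral mult_ac)
      then show ?thesis unfolding r2 fAB_eq r by (simp add: eval_nat_numeral)
    qed
    then show False using assms unfolding eq qC_eq by (simp add: eval_nat_numeral)
  next
    case 3
    define d where "d = degree r"
    have "r ^ 4 = px * py * r ^ 2 + (px ^ 3 + py ^ 3) * r + qC \<alpha>"
      unfolding eq[symmetric] by (simp add: add_ac)
    moreover have "degree (px * py * r ^ 2) \<le> 1 + 2 * d"
      using degree_mult_le[of "px * py" "r ^ 2"] degree_power_le[of r 2] unfolding fAB_eq d_def by simp
    moreover have "degree ((px ^ 3 + py ^ 3) * r) \<le> 3 + d"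
      using degree_mult_le[of "px ^ 3 + py ^ 3" r] unfolding fAB_eq d_def by simp
    moreover have "degree (qC \<alpha>) \<le> 2" unfolding qC_eq by simp
    ultimately have "degree (r ^ 4) < 4 * d"
      using 3 by (auto simp: d_def intro!: le_less_trans[OF degree_add_le_max])
    moreover have "r \<noteq> 0" using 3 by auto
    ultimately show False using degree_power_eq[of r 4] by (simp add: d_def)
  qed
qed

text \<open>The hypotheses are the coefficient conditions for the factors
  \<open>z^2 + p z + r\<close> and \<open>z^2 + p z + s\<close>. They force \<open>p\<close> to be
  linear in \<open>y\<close>, so \<open>r + s\<close> has terms in both \<open>y^2\<close> and
  \<open>y\<close>; but \<open>r * s\<close> is a multiple of \<open>y^2\<close> of degree two,
  which excludes every splitting of degrees.\<close>

lemma quartic_no_quadratic_factor: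
  fixes p r s :: "'a :: {idom, comm_ring_char2} poly poly"
  assumes "\<alpha> \<noteq> 0" and sum: "r + s = px * py + p ^ 2"
    and lin: "p * (r + s) = px ^ 3 + py ^ 3" and prod: "r * s = qC \<alpha>"
  shows False
proof -
  have eq: "p ^ 3 + px * py * p = px ^ 3 + py ^ 3"
    using lin unfolding sum by (simp add: algebra_simps eval_nat_numeral)
  have "degree p = 1"
  proof -
    consider "degree p = 0" | "degree p = 1" | "degree p \<ge> 2" by linarith
    then show ?thesis
    proof cases
      case 1
      then obtain a where p: "p = [:a:]" by (auto elim: degree_eq_zeroE)
      have "coeff (p ^ 3 + px * py * p) 3 = 0" unfolding p fAB_eq by (simp add: eval_nat_numeral)
      then show ?thesis unfolding eq unfolding fAB_eq by (simp add: eval_nat_numeral)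
    next
      case 3
      define d where "d = degree p"
      have "p ^ 3 = px * py * p + (px ^ 3 + py ^ 3)"
        unfolding eq[symmetric] by (simp add: add_ac)
      moreover have "degree (px * py * p) \<le> 1 + d"
        using degree_mult_le[of "px * py" p] unfolding fAB_eq d_def by simp
      moreover have "degree (px ^ 3 + py ^ 3 :: 'a poly poly) \<le> 3" unfolding fAB_eq by simp
      ultimately have "degree (p ^ 3) < 3 * d"
        using 3 by (auto simp: d_def intro!: le_less_trans[OF degree_add_le_max])
      moreover have "p \<noteq> 0" using 3 by auto
      ultimately show ?thesis using degree_power_eq[of p 3] by (simp add: d_def)
    qed
  qed
  then obtain a b where p: "p = [:a, b:]" "b \<noteq> 0" by (rule degree_one_cases)
  have p2: "p ^ 2 = [:a ^ 2, 0, b ^ 2:]" unfolding p by (simp add: power2_eq_square mult.commute)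
  have c: "coeff (r + s) 2 = b ^ 2" "coeff (r + s) 1 = [:0, 1:]"
    unfolding sum p2 fAB_eq by (simp_all add: eval_nat_numeral)
  have nz: "r \<noteq> 0" "s \<noteq> 0" using prod assms(1) unfolding qC_eq by auto
  have deg: "degree r + degree s = 2"
    using degree_mult_eq[OF nz] assms(1) unfolding prod qC_eq by simp
  have contra: False if rs: "degree s = 0" "r * s = qC \<alpha>" "coeff (r + s) 1 = [:0, 1:]" "s \<noteq> 0"
    for r s :: "'a poly poly"
  proof -
    obtain k where k: "s = [:k:]" using rs(1) by (auto elim: degree_eq_zeroE)
    have "coeff (r * s) 1 = k * coeff r 1" unfolding k by simp
    then have "k * coeff r 1 = 0" unfolding rs(2) qC_eq by simp
    then have "coeff r 1 = 0" using rs(4) k by simp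
    then show False using rs(3) k by simp
  qed
  have "\<not> (degree r = 1 \<and> degree s = 1)"
  proof
    assume "degree r = 1 \<and> degree s = 1"
    then have "coeff (r + s) 2 = 0" by (simp add: coeff_eq_0)
    then show False using c(1) p(2) by simp
  qed
  then have "degree r = 0 \<or> degree s = 0" using deg by linarith
  then show False
    using contra[of s r] contra[of r s] prod c(2) nz by (auto simp: mult.commute add.commute)
qed

lemma irreducible_quart:
  fixes \<alpha> :: "'a :: {field, comm_ring_char2}"
  assumes "\<alpha> \<noteq> 0"
  shows "irreducible (quart (px * py) (px ^ 3 + py ^ 3) (qC \<alpha>))"
proof (rule irreducibleI)
  let ?A = "px * py :: 'a poly poly" and ?B = "px ^ 3 + py ^ 3 :: 'a poly poly"
  let ?g = "quart ?A ?B (qC \<alpha>)"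
  have dg: "degree ?g = 4" by (simp add: quart_def)
  then show "?g \<noteq> 0" by auto
  show "\<not> ?g dvd 1" using dg by (auto dest!: dvd_imp_degree_le)
  fix a b assume ab: "?g = a * b"
  have main: "a dvd 1 \<or> b dvd 1" if ab: "?g = a * b" and le: "degree a \<le> degree b" for a b
  proof -
    have nz: "a \<noteq> 0" "b \<noteq> 0" using ab \<open>?g \<noteq> 0\<close> by auto
    have deg: "degree a + degree b = 4" using degree_mult_eq[OF nz] dg ab by simp
    have lead: "lead_coeff a * lead_coeff b = 1"
      using lead_coeff_mult[of a b] unfolding ab[symmetric] by (simp add: quart_def)
    consider "degree a = 0" | "degree a = 1" | "degree a = 2" "degree b = 2" using deg le by linarith
    then show ?thesis
    proof cases
      case 1
      then obtain k where k: "a = [:k:]" by (auto elim: degree_eq_zeroE)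
      have kl: "k * lead_coeff b = 1" using lead unfolding k by simp
      have "a * [:lead_coeff b:] = [:k * lead_coeff b:]" unfolding k by simp
      then have "a * [:lead_coeff b:] = 1" by (simp only: kl pCons_one)
      then show ?thesis by (metis dvd_triv_left)
    next
      case 2
      then obtain a0 a1 where a: "a = [:a0, a1:]" "a1 \<noteq> 0" by (rule degree_one_cases)
      \<comment> \<open>The leading coefficients are inverse to each other, so this is the root of
        \<open>a\<close>.\<close>
      define r where "r = a0 * lead_coeff b"
      have "a1 * lead_coeff b = 1" using lead a by simp
      then have "poly a r = 0" unfolding a r_def by (simp add: mult_ac flip: mult.assoc)
      then have "poly ?g r = 0" unfolding ab by simp
      then have "r ^ 4 + ?A * r ^ 2 + ?B * r = qC \<alpha>"
        unfolding quart_def by (simp add: algebra_simps eval_nat_numeral add_eq_0_char2)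
      then show ?thesis using quartic_no_root[OF assms] by blast
    next
      case 3
      have q: "\<exists>u v w. f = [:u, v, w:]" if "degree f = 2" for f :: "'a poly poly poly"
      proof -
        obtain u f' where f: "f = pCons u f'" by (cases f)
        then have "degree f' = 1" using that by (auto split: if_splits)
        then show ?thesis using f by (metis degree_one_cases)
      qed
      obtain a0 a1 a2 where a: "a = [:a0, a1, a2:]" using q 3 by blast
      obtain b0 b1 b2 where b: "b = [:b0, b1, b2:]" using q 3 by blast
      have e: "a0 * b0 = qC \<alpha>" "a0 * b1 + a1 * b0 = ?B" "a0 * b2 + (a1 * b1 + a2 * b0) = ?A"
        "a1 * b2 + a2 * b1 = 0" "a2 * b2 = 1"
      proof -
        have "a * b = [:a0 * b0, a0 * b1 + a1 * b0, a0 * b2 + (a1 * b1 + a2 * b0), a1 * b2 + a2 * b1, a2 * b2:]"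
          unfolding a b by simp
        then have "[:a0 * b0, a0 * b1 + a1 * b0, a0 * b2 + (a1 * b1 + a2 * b0), a1 * b2 + a2 * b1, a2 * b2:]
            = [:qC \<alpha>, ?B, ?A, 0, 1:]"
          using ab unfolding quart_def by (simp only:)
        then show "a0 * b0 = qC \<alpha>" "a0 * b1 + a1 * b0 = ?B" "a0 * b2 + (a1 * b1 + a2 * b0) = ?A"
          "a1 * b2 + a2 * b1 = 0" "a2 * b2 = 1"
          by (simp_all only: pCons_eq_iff)
      qed
      \<comment> \<open>Multiplying each factor by the leading coefficient of the other makes both
        monic, with common linear coefficient \<open>a1 * b2\<close>.\<close>
      have pp: "b1 * a2 = a1 * b2" using e(4) by (simp add: add_eq_0_char2 mult.commute)
      have s: "a0 * b2 + b0 * a2 = ?A + (a1 * b2) ^ 2"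
      proof -
        have "(a1 * b2) ^ 2 = (a1 * b2) * (b1 * a2)" unfolding pp by (rule power2_eq_square)
        also have "\<dots> = a1 * b1 * (a2 * b2)" by (simp only: mult_ac)
        finally show ?thesis unfolding e(3)[symmetric] e(5) by (simp add: add_ac mult.commute)
      qed
      have l: "a1 * b2 * (a0 * b2 + b0 * a2) = ?B"
      proof -
        have "a1 * b2 * (a0 * b2 + b0 * a2) = (a1 * b2) * (a0 * b2) + a1 * b0 * (a2 * b2)"
          by (simp add: algebra_simps)
        also have "(a1 * b2) * (a0 * b2) = a0 * b1 * (a2 * b2)"
          unfolding pp[symmetric] by (simp only: mult_ac)
        finally show ?thesis unfolding e(5) e(2)[symmetric] by simp
      qed
      have m: "a0 * b2 * (b0 * a2) = qC \<alpha>"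
      proof -
        have "a0 * b2 * (b0 * a2) = a0 * b0 * (a2 * b2)" by (simp only: mult_ac)
        then show ?thesis unfolding e by simp
      qed
      show ?thesis using quartic_no_quadratic_factor[OF assms s l m] ..
    qed
  qed
  show "a dvd 1 \<or> b dvd 1"
  proof (cases "degree a \<le> degree b")
    case False
    then show ?thesis using main[of b a] ab by (auto simp: mult.commute)
  qed (use main[of a b] ab in auto)
qed

section \<open>Replacing a multiplier by one from \<open>L[x, y]\<close>\<close>

lemma reduce_mod_quart:
  fixes A B C :: "'a :: comm_ring_char2"
  shows "\<exists>u. quart A B C dvd p + qd u"
proof (induction p)
  case 0
  have "qd (0, 0, 0, 0) = (0 :: 'a poly)" by (simp add: qd_def c1_def c2_def c3_def)
  then show ?case by (metis add.right_neutral dvd_0_right)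
next
  case (pCons a p)
  obtain u where u: "quart A B C dvd p + qd u" using pCons.IH by blast
  define v where "v = (a + C * c3 u, fst u + B * c3 u, c1 u + A * c3 u, c2 u)"
  have "quart A B C dvd [:0, 1:] * (p + qd u) + [:c3 u:] * quart A B C"
    by (rule dvd_add[OF dvd_mult[OF u] dvd_triv_right])
  also have "[:0, 1:] * (p + qd u) + [:c3 u:] * quart A B C = pCons a p + qd v"
    by (simp add: qd_def v_def c1_def c2_def c3_def quart_def mult.commute add_ac)
  finally show ?case by blast
qed

text \<open>Factors \<open>t\<close> are cancelled from the relation, which is possible modulo a
  prime, until its constant term is nonzero.\<close>

lemma prime_dvd_combination:
  fixes g t :: "'a :: comm_ring_char2 poly"
  assumes "prime_elem g" "\<not> g dvd t" "\<exists>j\<le>n. x j \<noteq> 0" "g dvd (\<Sum>j\<le>n. [:x j:] * t ^ j)"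
  shows "\<exists>s r. s \<noteq> 0 \<and> g dvd [:s:] + r * t"
  using assms(3,4)
proof (induction n arbitrary: x)
  case 0
  then show ?case by (intro exI[of _ "x 0"] exI[of _ 0]) auto
next
  case (Suc n)
  define r where "r = (\<Sum>j\<le>n. [:x (Suc j):] * t ^ j)"
  have e: "(\<Sum>j\<le>Suc n. [:x j:] * t ^ j) = [:x 0:] + r * t"
    unfolding r_def sum.atMost_Suc_shift by (simp add: sum_distrib_left mult_ac)
  show ?case
  proof (cases "x 0 = 0")
    case True
    then have "g dvd r * t" using Suc.prems(2) unfolding e by simp
    then have "g dvd r" using assms(1,2) by (simp add: prime_elem_dvd_mult_iff)
    moreover have "\<exists>j\<le>n. x (Suc j) \<noteq> 0"
      using Suc.prems(1) True by (metis Suc_le_mono not0_implies_Suc)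
    ultimately show ?thesis using Suc.IH[of "\<lambda>j. x (Suc j)"] unfolding r_def by blast
  next
    case False
    then show ?thesis using Suc.prems(2) unfolding e by blast
  qed
qed

text \<open>The five powers \<open>1, t, ..., t^4\<close> have only four coordinates each, hence
  satisfy a nontrivial relation over the base.\<close>

lemma multiple_in_base:
  fixes A B C :: "'a :: {idom, comm_ring_char2}"
  assumes "prime_elem (quart A B C)" "\<not> quart A B C dvd t"
  shows "\<exists>s r. s \<noteq> 0 \<and> quart A B C dvd [:s:] + r * t"
proof -
  obtain u where u: "\<And>j. quart A B C dvd t ^ j + qd (u j)"
    using choice[of "\<lambda>j u. quart A B C dvd t ^ j + qd u"] reduce_mod_quart by blast
  define M where "M i j = coeff (qd (u j)) i" for i j
  obtain x where x: "\<exists>j\<le>4. x j \<noteq> 0" "\<And>i. i < 4 \<Longrightarrow> (\<Sum>j\<le>4. M i j * x j) = 0"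
    using nontrivial_solution[of 4 M] by blast
  have z: "(\<Sum>j\<le>4. [:x j:] * qd (u j)) = 0"
  proof (rule poly_eqI)
    fix i
    have "coeff (\<Sum>j\<le>4. [:x j:] * qd (u j)) i = (\<Sum>j\<le>4. M i j * x j)"
      by (simp add: coeff_sum M_def mult.commute)
    also have "\<dots> = 0"
    proof (cases "i < 4")
      case False
      then have "coeff (qd (u j)) i = 0" for j
        by (intro coeff_eq_0) (simp add: qd_def)
      then show ?thesis by (simp add: M_def)
    qed (rule x)
    finally show "coeff (\<Sum>j\<le>4. [:x j:] * qd (u j)) i = coeff 0 i" by simp
  qed
  have "quart A B C dvd (\<Sum>j\<le>4. [:x j:] * (t ^ j + qd (u j)))"
    by (intro dvd_sum dvd_mult u)
  also have "(\<Sum>j\<le>4. [:x j:] * (t ^ j + qd (u j))) = (\<Sum>j\<le>4. [:x j:] * t ^ j)"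
    using z by (simp only: distrib_left sum.distrib add_0_right)
  finally show ?thesis by (rule prime_dvd_combination[OF assms x(1)])
qed

text \<open>Primality of the quartic moves the multiplier into \<open>L[x, y]\<close>, and a fourth
  root of \<open>\<alpha>\<close> brings the quartic into the shape of
  \<open>not_tight\<close>.\<close>

lemma no_multiplier_quart:
  fixes \<alpha> :: L and t :: L_xyz
  defines "g \<equiv> quart (px * py) (px ^ 3 + py ^ 3) (qC \<alpha>)"
  assumes a: "\<alpha> \<noteq> 0" and t: "\<not> g dvd t"
    and mem: "\<And>e. in_frob g [:px:] [:py:] [:0, 1:] (4 * 2 ^ e) (t * ([:py:] ^ 3 * [:0, 1:] ^ 3) ^ 2 ^ e)"
  shows False
proof -
  have "prime_elem g"
    unfolding g_def using irreducible_quart[OF a] by (rule irreducible_imp_prime_elem)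
  then obtain s r where s: "s \<noteq> 0" "g dvd [:s:] + r * t"
    using multiple_in_base t unfolding g_def by blast
  obtain \<eta> :: L where eta: "\<eta> ^ 4 = \<alpha>" using nth_root_exists[of 4 \<alpha>] by auto
  then have "\<eta> \<noteq> 0" using a by auto
  moreover have g: "g = quart (px * py) (px ^ 3 + py ^ 3) (([:[:\<eta> ^ 2:]:] * (px * py)) ^ 2)"
    unfolding g_def eta[symmetric]
    by (simp add: power_mult_distrib power2_eq_square eval_nat_numeral mult_ac)
  moreover have "in_frob g [:px:] [:py:] [:0, 1:] (4 * 2 ^ e) ([:s:] * ([:py:] ^ 3 * [:0, 1:] ^ 3) ^ 2 ^ e)" for e
  proof -
    let ?F = "([:py:] ^ 3 * [:0, 1:] ^ 3) ^ 2 ^ e :: L_xyz"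
    have id: "([:s:] + r * t) * F = r * (t * F) + [:s:] * F" for F :: L_xyz
      by (simp only: distrib_right mult.assoc add.commute)
    have "g dvd ([:s:] + r * t) * ?F" by (rule dvd_mult2[OF s(2)])
    then show ?thesis unfolding id by (rule in_frob_cong[OF in_frob_mult[OF mem]])
  qed
  ultimately show False using not_tight[of \<eta> s] s(1) by metis
qed

section \<open>The generic quartic\<close>

abbreviation "tX \<equiv> [:var_x:] :: L_xyzt"
abbreviation "tY \<equiv> [:var_y:] :: L_xyzt"
abbreviation "tZ \<equiv> [:var_z:] :: L_xyzt"
abbreviation "tA \<equiv> tX * tY"
abbreviation "tB \<equiv> tX ^ 3 + tY ^ 3"
abbreviation "tC \<equiv> var_t * tA ^ 2"

definition gen_quartic :: L_xyzt where
  "gen_quartic = tZ ^ 4 + tA * tZ ^ 2 + tB * tZ + tC"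

definition emb :: "L poly \<Rightarrow> L_xyzt" where "emb c = map_poly constL c"

lemma constL_hom: "constL 0 = 0" "constL 1 = 1" "constL (a + b) = constL a + constL b"
  "constL (a * b) = constL a * constL b"
  by (simp_all add: constL_def one_pCons)

lemma emb_hom: "emb 0 = 0" "emb 1 = 1" "emb [:0, 1:] = var_t" "emb (c + d) = emb c + emb d"
  "emb (c * d) = emb c * emb d" "emb (c ^ n) = emb c ^ n"
proof -
  show "emb 0 = 0" by (simp add: emb_def)
  show one: "emb 1 = 1" by (simp add: emb_def constL_hom one_pCons map_poly_pCons)
  show "emb [:0, 1:] = var_t" by (simp add: emb_def var_t_def constL_hom map_poly_pCons)
  show "emb (c + d) = emb c + emb d" for c d
    unfolding emb_def by (intro poly_eqI) (simp add: coeff_map_poly constL_hom)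
  show mult: "emb (c * d) = emb c * emb d" for c d
    unfolding emb_def by (rule map_poly_constL_mult)
  show "emb (c ^ n) = emb c ^ n" by (induction n) (simp_all add: one mult)
qed

lemma emb_sum: "emb (sum f I) = (\<Sum>i\<in>I. emb (f i))"
  by (induction I rule: infinite_finite_induct) (simp_all add: emb_hom)

lemma zc_gam:
  "zc tA tB tC n = form (\<lambda>i. emb (gam n i)) (2 ^ n) tX tY"
proof (induction n)
  case (Suc n)
  have "zc tA tB tC (Suc n) = (zc tA tB tC n) ^ 2 + var_t * (tX * tY * za tA tB n) ^ 2"
    by (simp only: zc.simps power_mult_distrib mult.assoc)
  also have "\<dots> = form (\<lambda>i. emb (gam (Suc n) i)) (2 ^ Suc n) tX tY"
    unfolding Suc.IH mult_za_form form_square form_scale form_add power_Suc[symmetric]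
    by (rule form_cong) (simp add: emb_hom)
  finally show ?case .
qed (simp add: form_def emb_hom)

abbreviation "in_ideal \<equiv> in_frob gen_quartic tX tY tZ"

text \<open>In the expansion of \<open>z^(2^n)\<close>, multiplied by \<open>tB\<close>, all terms
  except this one are already known to lie in the ideal.\<close>

lemma in_ideal_B_zc: "in_ideal (2 ^ n) (tB * zc tA tB tC n)"
proof -
  have e: "gen_quartic dvd tZ ^ 2 ^ n + (za tA tB n * tZ ^ 2 + zb tA tB n * tZ + zc tA tB tC n)"
    unfolding gen_quartic_def by (rule power_z_expansion)
  define r where "r = tB * za tA tB n * tZ ^ 2 + tB * zb tA tB n * tZ"
  have r: "in_pow tX tY (2 ^ n) r"
    unfolding r_def by (intro in_pow_add in_pow_mult2 in_pow_mult_za in_pow_mult_zb)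
  have id: "B * (Z + (a * z ^ 2 + b * z + c)) = B * c + ((B * a * z ^ 2 + B * b * z) + B * Z)"
    for B Z a b c z :: L_xyzt by (simp only: distrib_left mult.assoc add_ac)
  have "gen_quartic dvd tB * zc tA tB tC n + (r + tB * tZ ^ 2 ^ n)"
    using dvd_mult[OF e, of tB] unfolding id r_def .
  then show ?thesis using r unfolding in_frob_def by blast
qed

text \<open>Membership in \<open>(x\<^sup>N, y\<^sup>N, z\<^sup>N)\<close> after inverting \<open>L[t] - {0}\<close>.\<close>

definition in_sat :: "nat \<Rightarrow> L_xyzt \<Rightarrow> bool" where
  "in_sat N p \<longleftrightarrow> (\<exists>d. d \<noteq> 0 \<and> in_ideal N (emb d * p))"

lemma in_sat_in_ideal: "in_ideal N p \<Longrightarrow> in_sat N p"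
  unfolding in_sat_def by (rule exI[of _ 1]) (simp add: emb_hom)

lemma in_sat_add:
  assumes "in_sat N p" "in_sat N p'"
  shows "in_sat N (p + p')"
proof -
  obtain d d' where d: "d \<noteq> 0" "in_ideal N (emb d * p)" "d' \<noteq> 0" "in_ideal N (emb d' * p')"
    using assms unfolding in_sat_def by blast
  have "in_ideal N (emb d' * (emb d * p) + emb d * (emb d' * p'))"
    by (intro in_frob_add in_frob_mult d)
  also have "emb d' * (emb d * p) + emb d * (emb d' * p') = emb (d * d') * (p + p')"
    by (simp only: emb_hom distrib_left mult_ac)
  finally show ?thesis unfolding in_sat_def using d by (metis no_zero_divisors)
qed

lemma in_sat_mult:
  assumes "in_sat N p"
  shows "in_sat N (s * p)"
proof -
  obtain d where d: "d \<noteq> 0" "in_ideal N (emb d * p)" using assms unfolding in_sat_def by blast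
  have "in_ideal N (s * (emb d * p))" by (rule in_frob_mult[OF d(2)])
  then show ?thesis using d(1) unfolding in_sat_def by (metis mult.left_commute)
qed

lemma in_sat_cong:
  assumes "in_sat N p" "gen_quartic dvd p + p'"
  shows "in_sat N p'"
proof -
  obtain d where d: "d \<noteq> 0" "in_ideal N (emb d * p)" using assms unfolding in_sat_def by blast
  have "gen_quartic dvd emb d * p + emb d * p'" using dvd_mult[OF assms(2), of "emb d"] by (simp only: distrib_left)
  then show ?thesis using d in_frob_cong unfolding in_sat_def by blast
qed

lemma in_sat_0: "in_sat N 0"
  by (intro in_sat_in_ideal in_frob_in_pow in_pow_0)

lemma in_sat_sum: "(\<And>i. i \<in> I \<Longrightarrow> in_sat N (f i)) \<Longrightarrow> in_sat N (sum f I)"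
  by (induction I rule: infinite_finite_induct)
    (auto intro: in_sat_add in_sat_0)

text \<open>The Toeplitz solution gives a form \<open>W\<close> of degree \<open>M - 1\<close> such
  that \<open>W\<close> times \<open>zc\<close> is \<open>emb d\<close> times the monomial modulo
  \<open>(x^(2 M), y^(2 M))\<close>, and \<open>tB\<close> times \<open>zc\<close> lies in the
  ideal.\<close>

lemma in_sat_monomial_exact:
  assumes i: "2 ^ Suc n \<le> i" "i < 2 * 2 ^ Suc n"
  shows "in_sat (2 ^ Suc (Suc n)) (tB * (tX ^ i * tY ^ (3 * 2 ^ Suc n - 1 - i)))"
proof -
  define M where "M = (2::nat) ^ Suc n"
  have M: "M \<ge> 1" "2 ^ Suc (Suc n) = 2 * M" by (simp_all add: M_def)
  define b0 where "b0 = i - M"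
  have b0: "b0 < 2 ^ Suc n" "i = M + b0" using i by (simp_all add: b0_def M_def)
  obtain d w where d: "d \<noteq> 0" and w: "\<And>b. b < 2 ^ Suc n \<Longrightarrow>
      (\<Sum>a<2 ^ Suc n. w a * gam (Suc (Suc n)) (2 ^ Suc n + b - a)) = (if b = b0 then d else (0 :: L poly))"
    using gam_toeplitz_solution[OF b0(1)] by blast
  define W where "W = form (\<lambda>a. emb (w a)) (M - 1) tX tY"
  define mono where "mono = tX ^ i * tY ^ (3 * M - 1 - i)"
  have deg: "M - 1 + 2 * M = 3 * M - 1" using M by simp
  have mono: "emb d * mono = form (\<lambda>k. if k = i then emb d else 0) (3 * M - 1) tX tY"
  proof -
    have "i \<le> 3 * M - 1" using i M by (simp add: M_def)
    moreover have "form (\<lambda>k. if k = i then emb d else 0) (3 * M - 1) tX tY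
        = (\<Sum>k\<le>3 * M - 1. if k = i then emb d * tX ^ k * tY ^ (3 * M - 1 - k) else 0)"
      unfolding form_def by (intro sum.cong) auto
    ultimately show ?thesis by (simp add: mono_def mult.assoc)
  qed
  have pow: "in_pow tX tY (2 * M) (W * zc tA tB tC (Suc (Suc n)) + emb d * mono)"
    unfolding W_def zc_gam M(2) form_mult mono deg form_add
  proof (rule in_pow_form)
    fix k assume k: "k \<le> 3 * M - 1" "k < 2 * M" "3 * M - 1 - k < 2 * M"
    define b where "b = k - M"
    have b: "k = M + b" "b < 2 ^ Suc n" using k M(1) by (simp_all add: b_def M_def)
    have "(\<Sum>a\<le>M - 1. if a \<le> k \<and> k \<le> a + 2 * M then emb (w a) * emb (gam (Suc (Suc n)) (k - a)) else 0)
        = (\<Sum>a<M. emb (w a * gam (Suc (Suc n)) (M + b - a)))"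
    proof (intro sum.cong)
      show "{..M - 1} = {..<M}" using M(1) by auto
      fix a assume "a \<in> {..<M}"
      then have "a \<le> k \<and> k \<le> a + 2 * M" using b k by auto
      then show "(if a \<le> k \<and> k \<le> a + 2 * M then emb (w a) * emb (gam (Suc (Suc n)) (k - a)) else 0)
          = emb (w a * gam (Suc (Suc n)) (M + b - a))"
        by (simp add: emb_hom b del: gam.simps)
    qed
    also have "\<dots> = emb (if b = b0 then d else 0)"
      unfolding emb_sum[symmetric] M_def w[OF b(2)] ..
    also have "\<dots> = (if k = i then emb d else 0)" by (simp add: b(1) b0(2) emb_hom)
    finally show "(\<Sum>a\<le>M - 1. if a \<le> k \<and> k \<le> a + 2 * M
        then emb (w a) * emb (gam (Suc (Suc n)) (k - a)) else 0) + (if k = i then emb d else 0) = 0"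
      by simp
  qed
  have "in_ideal (2 * M) (W * (tB * zc tA tB tC (Suc (Suc n))) + tB * (W * zc tA tB tC (Suc (Suc n)) + emb d * mono))"
    by (rule in_frob_add[OF in_frob_mult[OF in_ideal_B_zc[of "Suc (Suc n)", unfolded M(2)]]
          in_frob_mult[OF in_frob_in_pow[OF pow]]])
  also have "W * (tB * zc tA tB tC (Suc (Suc n))) + tB * (W * zc tA tB tC (Suc (Suc n)) + emb d * mono)
      = emb d * (tB * mono)"
  proof -
    have id: "W * (B * c) + B * (W * c + e * m) = e * (B * m)" for W B c e m :: L_xyzt
      by (simp add: algebra_simps)
    show ?thesis by (rule id)
  qed
  finally show ?thesis using d unfolding in_sat_def M(2) mono_def M_def by blast
qed

lemma in_sat_monomial:
  assumes "3 * 2 ^ Suc n - 1 \<le> i + j"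
  shows "in_sat (2 ^ Suc (Suc n)) (tB * (tX ^ i * tY ^ j))"
proof (cases "i < 2 * 2 ^ Suc n \<and> j < 2 * 2 ^ Suc n")
  case True
  define j' where "j' = 3 * 2 ^ Suc n - 1 - i"
  have ge: "(2::nat) ^ Suc n \<ge> 1" by simp
  have i: "2 ^ Suc n \<le> i" and j': "j' \<le> j"
    using True assms ge unfolding j'_def by linarith+
  have "in_sat (2 ^ Suc (Suc n)) (tY ^ (j - j') * (tB * (tX ^ i * tY ^ j')))"
    using True i unfolding j'_def by (intro in_sat_mult in_sat_monomial_exact) auto
  also have "tY ^ (j - j') * (tB * (tX ^ i * tY ^ j')) = tB * (tX ^ i * (tY ^ (j - j') * tY ^ j'))"
    by (simp only: mult_ac)
  also have "tY ^ (j - j') * tY ^ j' = tY ^ j" using j' by (simp only: power_add[symmetric] le_add_diff_inverse2)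
  finally show ?thesis .
next
  case False
  have "in_pow tX tY (2 ^ Suc (Suc n)) (tB * tX ^ i * tY ^ j)"
    using False by (intro in_pow_monomial) auto
  then show ?thesis by (intro in_sat_in_ideal in_frob_in_pow) (simp only: mult.assoc)
qed

section \<open>Forms of large degree and generic membership\<close>

definition is_form :: "nat \<Rightarrow> L_xyzt \<Rightarrow> bool" where
  "is_form D p \<longleftrightarrow> (\<exists>r. p = form r D tX tY)"

lemma is_formI: "p = form r D tX tY \<Longrightarrow> is_form D p"
  by (auto simp: is_form_def)

lemma in_sat_form:
  assumes "is_form D p" "3 * 2 ^ Suc n - 1 \<le> D"
  shows "in_sat (2 ^ Suc (Suc n)) (tB * p)"
proof -
  obtain r where p: "p = form r D tX tY" using assms(1) by (auto simp: is_form_def)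
  have "in_sat (2 ^ Suc (Suc n)) (\<Sum>i\<le>D. r i * (tB * (tX ^ i * tY ^ (D - i))))"
    using assms(2) by (intro in_sat_sum in_sat_mult in_sat_monomial) auto
  also have "(\<Sum>i\<le>D. r i * (tB * (tX ^ i * tY ^ (D - i)))) = tB * p"
    unfolding p form_def sum_distrib_left by (simp only: mult_ac)
  finally show ?thesis .
qed

lemma is_form_mult: "is_form D p \<Longrightarrow> is_form D' p' \<Longrightarrow> is_form (D + D') (p * p')"
  unfolding is_form_def by (elim exE) (simp only: form_mult, rule exI, rule refl)

lemma is_form_monomial: "is_form (i + j) (tX ^ i * tY ^ j)"
proof -
  have one: "form (\<lambda>_. 1) 0 tX tY = 1" by (simp add: form_def)
  have "tX ^ i * tY ^ j = form (\<lambda>k. if i \<le> k \<and> k \<le> 0 + i then 1 else 0) (i + j) tX tY"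
    using form_shift[of tX i tY j "\<lambda>_. 1" 0] unfolding one mult_1_right add_0 .
  then show ?thesis by (rule is_formI)
qed

lemma is_form_z:
  "is_form (2 ^ n - 2) (za tA tB n)" "is_form (2 ^ n - 1) (zb tA tB n)" "is_form (2 ^ n) (zc tA tB tC n)"
proof -
  show "is_form (2 ^ n) (zc tA tB tC n)" by (rule is_formI[OF zc_gam])
  have z: "is_form (2 ^ 0 - 2) (za tA tB 0)" "is_form (2 ^ 0 - 1) (zb tA tB 0)"
    by (rule is_formI[where r = "\<lambda>_. 0"], simp)
      (rule is_formI[where r = "\<lambda>_. 1"], simp add: form_def)
  show "is_form (2 ^ n - 2) (za tA tB n)"
  proof (cases "n \<ge> 1")
    case True
    then show ?thesis by (rule is_formI[OF zab_form(1)])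
  next
    case False
    then have "n = 0" by simp
    then show ?thesis using z(1) by (simp only:)
  qed
  show "is_form (2 ^ n - 1) (zb tA tB n)"
  proof (cases "n \<ge> 1")
    case True
    then show ?thesis by (rule is_formI[OF zab_form(2)])
  next
    case False
    then have "n = 0" by simp
    then show ?thesis using z(2) by (simp only:)
  qed
qed

text \<open>With \<open>Q = 2 ^ e\<close>, expand both factors of
  \<open>z^(3 Q) = z^Q z^(2 Q)\<close>. The coefficient products have degree at least
  \<open>3 Q - 4\<close>, and \<open>x^3 y^(3 Q)\<close> raises this to the bound
  \<open>6 Q - 1\<close> of \<open>in_sat_form\<close>; this is why the multiplier contains
  \<open>x^3\<close>.\<close>

lemma in_sat_generic:
  "in_sat (4 * 2 ^ e) (tB * tX ^ 3 * (tY ^ 3 * tZ ^ 3) ^ 2 ^ e)"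
proof -
  define Q where "Q = (2::nat) ^ e"
  have N: "4 * 2 ^ e = (2::nat) ^ Suc (Suc e)" by simp
  have Q: "Q \<ge> 1" "2 ^ Suc e = 2 * Q" by (simp_all add: Q_def)
  define m where "m = tX ^ 3 * tY ^ (3 * Q)"
  have m: "is_form (3 + 3 * Q) m" unfolding m_def by (rule is_form_monomial)
  have sat: "in_sat (4 * 2 ^ e) (tB * (m * (p * p')) * s)"
    if "is_form D p" "is_form D' p'" "2 * Q - 2 \<le> D" "Q - 2 \<le> D'" for D D' p p' s
  proof -
    have "in_sat (2 ^ Suc (Suc e)) (tB * (m * (p * p')))"
      by (rule in_sat_form[OF is_form_mult[OF m is_form_mult[OF that(1,2)]]])
        (use that(3,4) Q in auto)
    from in_sat_mult[OF this, of s] show ?thesis by (simp only: N mult.commute[of s])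
  qed
  define a b c a' b' c' where defs: "a = za tA tB e" "b = zb tA tB e" "c = zc tA tB tC e"
    "a' = za tA tB (Suc e)" "b' = zb tA tB (Suc e)" "c' = zc tA tB tC (Suc e)"
  have f: "is_form (Q - 2) a" "is_form (Q - 1) b" "is_form Q c"
    "is_form (2 * Q - 2) a'" "is_form (2 * Q - 1) b'" "is_form (2 * Q) c'"
    unfolding defs Q(2)[symmetric] unfolding Q_def by (rule is_form_z)+
  define P P' where "P = a * tZ ^ 2 + b * tZ + c" and "P' = a' * tZ ^ 2 + b' * tZ + c'"
  have s_aa: "in_sat (4 * 2 ^ e) (tB * (m * (a' * a)) * s)" for s
    by (rule sat[OF f(4) f(1)]) simp_all
  have s_ab: "in_sat (4 * 2 ^ e) (tB * (m * (a' * b)) * s)" for s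
    by (rule sat[OF f(4) f(2)]) simp_all
  have s_ac: "in_sat (4 * 2 ^ e) (tB * (m * (a' * c)) * s)" for s
    by (rule sat[OF f(4) f(3)]) simp_all
  have s_ba: "in_sat (4 * 2 ^ e) (tB * (m * (b' * a)) * s)" for s
    by (rule sat[OF f(5) f(1)]) simp_all
  have s_bb: "in_sat (4 * 2 ^ e) (tB * (m * (b' * b)) * s)" for s
    by (rule sat[OF f(5) f(2)]) simp_all
  have s_bc: "in_sat (4 * 2 ^ e) (tB * (m * (b' * c)) * s)" for s
    by (rule sat[OF f(5) f(3)]) simp_all
  have s_ca: "in_sat (4 * 2 ^ e) (tB * (m * (c' * a)) * s)" for s
    by (rule sat[OF f(6) f(1)]) simp_all
  have s_cb: "in_sat (4 * 2 ^ e) (tB * (m * (c' * b)) * s)" for s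
    by (rule sat[OF f(6) f(2)]) simp_all
  have s_cc: "in_sat (4 * 2 ^ e) (tB * (m * (c' * c)) * s)" for s
    by (rule sat[OF f(6) f(3)]) simp_all
  have "in_sat (4 * 2 ^ e) (tB * (m * (a' * a)) * (tZ ^ 2 * tZ ^ 2) + tB * (m * (a' * b)) * (tZ ^ 2 * tZ)
      + tB * (m * (a' * c)) * tZ ^ 2 + tB * (m * (b' * a)) * (tZ * tZ ^ 2) + tB * (m * (b' * b)) * (tZ * tZ)
      + tB * (m * (b' * c)) * tZ + tB * (m * (c' * a)) * tZ ^ 2 + tB * (m * (c' * b)) * tZ
      + tB * (m * (c' * c)) * 1)"
    by (rule in_sat_add[OF in_sat_add[OF in_sat_add[OF in_sat_add[OF in_sat_add[OF in_sat_add[OF in_sat_add[OF in_sat_add[OF s_aa s_ab] s_ac] s_ba] s_bb] s_bc] s_ca] s_cb] s_cc])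
  also have "tB * (m * (a' * a)) * (tZ ^ 2 * tZ ^ 2) + tB * (m * (a' * b)) * (tZ ^ 2 * tZ)
      + tB * (m * (a' * c)) * tZ ^ 2 + tB * (m * (b' * a)) * (tZ * tZ ^ 2) + tB * (m * (b' * b)) * (tZ * tZ)
      + tB * (m * (b' * c)) * tZ + tB * (m * (c' * a)) * tZ ^ 2 + tB * (m * (c' * b)) * tZ
      + tB * (m * (c' * c)) * 1 = tB * m * (P' * P)"
  proof -
    have id: "B * (m * (a' * a)) * (Z ^ 2 * Z ^ 2) + B * (m * (a' * b)) * (Z ^ 2 * Z)
      + B * (m * (a' * c)) * Z ^ 2 + B * (m * (b' * a)) * (Z * Z ^ 2) + B * (m * (b' * b)) * (Z * Z)
      + B * (m * (b' * c)) * Z + B * (m * (c' * a)) * Z ^ 2 + B * (m * (c' * b)) * Z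
      + B * (m * (c' * c)) * 1 = B * m * ((a' * Z ^ 2 + b' * Z + c') * (a * Z ^ 2 + b * Z + c))"
      for B m a b c a' b' c' Z :: L_xyzt
      by (simp only: distrib_left distrib_right mult_ac add_ac mult_1_right mult_1_left)
    show ?thesis unfolding P_def P'_def by (rule id)
  qed
  finally have s: "in_sat (4 * 2 ^ e) (tB * m * (P' * P))" .
  have "gen_quartic dvd tZ ^ Q + P" "gen_quartic dvd tZ ^ (2 * Q) + P'"
    unfolding P_def P'_def defs gen_quartic_def Q(2)[symmetric] unfolding Q_def by (rule power_z_expansion)+
  then have "gen_quartic dvd P' * (tZ ^ Q + P) + tZ ^ Q * (tZ ^ (2 * Q) + P')"
    by (intro dvd_add[OF dvd_mult dvd_mult])
  also have "P' * (tZ ^ Q + P) + tZ ^ Q * (tZ ^ (2 * Q) + P') = P' * P + tZ ^ Q * tZ ^ (2 * Q)"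
    by (simp add: algebra_simps)
  finally have "gen_quartic dvd tB * m * (P' * P + tZ ^ Q * tZ ^ (2 * Q))" by (rule dvd_mult)
  then have "in_sat (4 * 2 ^ e) (tB * m * (tZ ^ Q * tZ ^ (2 * Q)))"
    using in_sat_cong[OF s] by (simp only: distrib_left)
  also have "tB * m * (tZ ^ Q * tZ ^ (2 * Q)) = tB * tX ^ 3 * (tY ^ 3 * tZ ^ 3) ^ 2 ^ e"
  proof -
    have "tZ ^ Q * tZ ^ (2 * Q) = (tZ ^ 3) ^ Q" by (simp only: power_add[symmetric] power_mult[symmetric]) simp
    moreover have "tY ^ (3 * Q) = (tY ^ 3) ^ Q" by (rule power_mult)
    ultimately show ?thesis unfolding m_def Q_def by (simp only: power_mult_distrib mult_ac)
  qed
  finally show ?thesis .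
qed

section \<open>Ideals of the quotient rings\<close>

text \<open>Common interface to the quotients \<open>A\<close> and \<open>R\<^sub>\<alpha>\<close>:
  their ideals are handled as predicates on polynomial representatives.\<close>

locale cls_ring = cring R for R (structure) +
  fixes cls :: "'c :: comm_ring_1 \<Rightarrow> 'a"
  assumes carr: "carrier R = range cls"
    and cls_mult: "cls g \<otimes> cls h = cls (g * h)"
    and cls_add: "cls g \<oplus> cls h = cls (g + h)"
    and cls_one: "\<one> = cls 1"
begin

lemma cls_closed [simp]: "cls g \<in> carrier R"
  by (simp add: carr)

lemma cls_zero: "\<zero> = cls 0"
proof -
  have "cls 0 \<oplus> cls 0 = cls 0" by (simp add: cls_add)
  then show ?thesis using add.l_cancel_one[of "cls 0" "cls 0"] by simp
qed

lemma cls_pow: "cls g [^] (n :: nat) = cls (g ^ n)"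
  by (induction n) (simp_all add: cls_one cls_mult mult.commute)

lemma cls_ideal:
  assumes P: "P 0" "\<And>p p'. P p \<Longrightarrow> P p' \<Longrightarrow> P (p + p')" "\<And>s p. P p \<Longrightarrow> P (s * p)"
  shows "ideal {cls p |p. P p} R"
proof (rule idealI)
  show "ring R" by (rule ring_axioms)
  show "subgroup {cls p |p. P p} (add_monoid R)"
  proof (rule add.subgroupI)
    show "{cls p |p. P p} \<subseteq> carrier R" by auto
    show "{cls p |p. P p} \<noteq> {}" using P(1) by blast
  next
    fix a assume "a \<in> {cls p |p. P p}"
    then obtain p where p: "a = cls p" "P p" by blast
    have "cls (- 1 * p) \<oplus> cls p = \<zero>" by (simp add: cls_add cls_zero)
    then have "\<ominus> a = cls (- 1 * p)" unfolding p(1) by (intro sum_zero_eq_neg[symmetric]) auto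
    then show "\<ominus> a \<in> {cls p |p. P p}" using P(3)[OF p(2)] by blast
  next
    fix a b assume "a \<in> {cls p |p. P p}" "b \<in> {cls p |p. P p}"
    then obtain p p' where p: "a = cls p" "P p" "b = cls p'" "P p'" by blast
    then show "a \<oplus> b \<in> {cls p |p. P p}" using P(2)[OF p(2,4)] cls_add by blast
  qed
next
  fix a x assume "a \<in> {cls p |p. P p}" "x \<in> carrier R"
  then obtain p s where p: "a = cls p" "P p" "x = cls s" using carr by auto
  have "x \<otimes> a = cls (s * p)" unfolding p by (rule cls_mult)
  then show "x \<otimes> a \<in> {cls p |p. P p}" using P(3)[OF p(2)] by blast
  then show "a \<otimes> x \<in> {cls p |p. P p}" using p by (simp add: m_comm)
qed

lemma frobenius_power_subset:
  assumes I: "I \<subseteq> {cls p |p. P p}" and PQ: "\<And>p. P p \<Longrightarrow> Q (p ^ q)"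
    and Q: "Q 0" "\<And>p p'. Q p \<Longrightarrow> Q p' \<Longrightarrow> Q (p + p')" "\<And>s p. Q p \<Longrightarrow> Q (s * p)"
  shows "frobenius_power R q I \<subseteq> {cls p |p. Q p}"
  unfolding frobenius_power_def
proof (rule genideal_minimal[OF cls_ideal[OF Q]])
  show "{g [^] q |g. g \<in> I} \<subseteq> {cls p |p. Q p}"
  proof clarify
    fix g assume "g \<in> I"
    then obtain p where "g = cls p" "P p" using I by blast
    then have "g [^] q = cls (p ^ q)" "Q (p ^ q)" using PQ cls_pow by auto
    then show "\<exists>p. g [^] q = cls p \<and> Q p" by blast
  qed
qed

end

lemma cls_ring_A: "cls_ring ringA clsA"
  by (intro cls_ring.intro cls_ring_axioms.intro cring_ringA carrier_ringA clsA_ops)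

lemma cls_ring_R: "cls_ring (ringR \<alpha>) (clsR \<alpha>)"
  by (intro cls_ring.intro cls_ring_axioms.intro cring_ringR carrier_ringR clsR_ops)

lemma var_eqs: "var_x = [:px:]" "var_y = [:py:]" "var_z = [:0, 1:]"
  by (simp_all add: var_x_def var_y_def var_z_def px_def py_def)

lemma relation_A: "[:quartic:] + var_t * [:var_x ^ 2 * var_y ^ 2:] = gen_quartic"
proof -
  have "[:quartic:] = tZ ^ 4 + tA * tZ ^ 2 + tX ^ 3 * tZ + tY ^ 3 * tZ"
    unfolding quartic_def by (simp only: const_poly_hom)
  moreover have "[:var_x ^ 2 * var_y ^ 2:] = tA ^ 2"
    by (simp only: const_poly_hom power_mult_distrib)
  ultimately show ?thesis
    unfolding gen_quartic_def by (simp only: distrib_right add.assoc)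
qed

abbreviation quartR :: "L \<Rightarrow> L_xyz" where
  "quartR \<alpha> \<equiv> quart (px * py) (px ^ 3 + py ^ 3) (qC \<alpha>)"

lemma relation_R: "quartic + constL \<alpha> * var_x ^ 2 * var_y ^ 2 = quartR \<alpha>"
  unfolding quart_expand quartic_def var_eqs constL_def
  by (simp only: const_poly_hom distrib_right add.assoc)

lemma clsA_eq: "clsA g = clsA h \<longleftrightarrow> gen_quartic dvd g + h"
  unfolding clsA_eq_iff relation_A by simp

lemma clsR_eq: "clsR \<alpha> g = clsR \<alpha> h \<longleftrightarrow> quartR \<alpha> dvd g + h"
  unfolding clsR_eq_iff relation_R by simp

lemma poly_gen_quartic: "poly gen_quartic (constL \<alpha>) = quartR \<alpha>"
  unfolding relation_A[symmetric] relation_R[symmetric] by (simp add: var_t_def mult.assoc)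

abbreviation "in_idealR \<alpha> \<equiv> in_frob (quartR \<alpha>) [:px:] [:py:] [:0, 1:]"

lemma in_idealR_specialize:
  assumes "in_ideal N p"
  shows "in_idealR \<alpha> N (poly p (constL \<alpha>))"
proof -
  obtain r c where r: "in_pow tX tY N r" "gen_quartic dvd p + (r + c * tZ ^ N)"
    using assms unfolding in_frob_def by blast
  obtain a b where ab: "r = a * tX ^ N + b * tY ^ N" using r(1) unfolding in_pow_def by blast
  obtain k where k: "p + (r + c * tZ ^ N) = gen_quartic * k" using r(2) by blast
  let ?ev = "\<lambda>p. poly p (constL \<alpha>)"
  have const: "?ev [:v:] = v" for v by simp
  have "?ev (p + (r + c * tZ ^ N)) = ?ev (gen_quartic * k)" by (simp only: k)
  then have "?ev p + (?ev r + ?ev c * [:0, 1:] ^ N) = quartR \<alpha> * ?ev k"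
    by (simp only: poly_add poly_mult poly_power poly_gen_quartic const var_eqs)
  moreover have "?ev r = ?ev a * [:px:] ^ N + ?ev b * [:py:] ^ N"
    by (simp only: ab poly_add poly_mult poly_power const var_eqs)
  ultimately show ?thesis unfolding in_frob_def in_pow_def by (metis dvd_triv_left)
qed

lemma in_ideal_gens: "in_ideal N (tX ^ N)" "in_ideal N (tY ^ N)" "in_ideal N (tZ ^ N)"
proof -
  have "in_pow tX tY N (tX ^ N)" "in_pow tX tY N (tY ^ N)"
    unfolding in_pow_def
    by (rule exI[of _ 1], rule exI[of _ 0], simp) (rule exI[of _ 0], rule exI[of _ 1], simp)
  then show "in_ideal N (tX ^ N)" "in_ideal N (tY ^ N)" by (simp_all add: in_frob_in_pow)
  show "in_ideal N (tZ ^ N)" unfolding in_frob_def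
    by (rule exI[of _ 0], rule exI[of _ 1]) simp
qed

lemma idealI_subset: "idealI \<subseteq> {clsA p |p. in_ideal 4 p}"
proof -
  interpret A: cls_ring ringA clsA by (rule cls_ring_A)
  show ?thesis unfolding idealI_def
  proof (rule A.genideal_minimal)
    show "ideal {clsA p |p. in_ideal 4 p} ringA"
      by (rule A.cls_ideal, rule in_frob_0, rule in_frob_add, assumption+, rule in_frob_mult, assumption)
    show "{clsA (tX ^ 4), clsA (tY ^ 4), clsA (tZ ^ 4)} \<subseteq> {clsA p |p. in_ideal 4 p}"
      using in_ideal_gens[of 4] by auto
  qed
qed

lemma frobenius_power_A_subset:
  "frobenius_power ringA (2 ^ e) idealI \<subseteq> {clsA p |p. in_ideal (4 * 2 ^ e) p}"
  by (rule cls_ring.frobenius_power_subset[OF cls_ring_A idealI_subset],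
      rule in_frob_frobenius, assumption, rule in_frob_0, rule in_frob_add, assumption+, rule in_frob_mult, assumption)

lemma frobenius_power_R_subset:
  "frobenius_power (ringR \<alpha>) (2 ^ e) (genideal (ringR \<alpha>) (specialize \<alpha> ` idealI))
     \<subseteq> {clsR \<alpha> p |p. in_idealR \<alpha> (4 * 2 ^ e) p}"
proof -
  interpret R: cls_ring "ringR \<alpha>" "clsR \<alpha>" by (rule cls_ring_R)
  have sub: "genideal (ringR \<alpha>) (specialize \<alpha> ` idealI) \<subseteq> {clsR \<alpha> p |p. in_idealR \<alpha> 4 p}"
  proof (rule R.genideal_minimal)
    show "ideal {clsR \<alpha> p |p. in_idealR \<alpha> 4 p} (ringR \<alpha>)"
      by (rule R.cls_ideal, rule in_frob_0, rule in_frob_add, assumption+, rule in_frob_mult, assumption)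
    show "specialize \<alpha> ` idealI \<subseteq> {clsR \<alpha> p |p. in_idealR \<alpha> 4 p}"
      using idealI_subset in_idealR_specialize[of 4 _ \<alpha>] specialize_clsA by blast
  qed
  show ?thesis
    by (rule R.frobenius_power_subset[OF sub], rule in_frob_frobenius, assumption,
        rule in_frob_0, rule in_frob_add, assumption+, rule in_frob_mult, assumption)
qed

abbreviation "fpoly \<equiv> [:py:] ^ 3 * [:0, 1:] ^ 3 :: L_xyz"

lemma elemf_eq: "elemf = clsA (tY ^ 3 * tZ ^ 3)"
  by (simp only: elemf_def)

lemma specialize_elemf: "specialize \<alpha> elemf = clsR \<alpha> fpoly"
proof -
  have const: "poly [:v:] (constL \<alpha>) = v" for v by simp
  show ?thesis
    unfolding elemf_eq specialize_clsA by (simp only: poly_mult poly_power const var_eqs)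
qed

lemma no_multiplier:
  assumes "\<alpha> \<noteq> 0" "\<not> quartR \<alpha> dvd t" "\<And>e. in_idealR \<alpha> (4 * 2 ^ e) (t * fpoly ^ 2 ^ e)"
  shows False
  using assms by (rule no_multiplier_quart)

lemma specialize_not_in_tight_closure:
  assumes "\<alpha> \<noteq> 0"
  shows "specialize \<alpha> elemf
    \<notin> tight_closure 2 (ringR \<alpha>) (genideal (ringR \<alpha>) (specialize \<alpha> ` idealI))"
proof
  interpret R: cls_ring "ringR \<alpha>" "clsR \<alpha>" by (rule cls_ring_R)
  assume "specialize \<alpha> elemf \<in> tight_closure 2 (ringR \<alpha>) (genideal (ringR \<alpha>) (specialize \<alpha> ` idealI))"
  then obtain T where T: "T \<in> carrier (ringR \<alpha>)" "T \<noteq> \<zero>\<^bsub>ringR \<alpha>\<^esub>"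
    "\<And>e. T \<otimes>\<^bsub>ringR \<alpha>\<^esub> clsR \<alpha> fpoly [^]\<^bsub>ringR \<alpha>\<^esub> ((2::nat) ^ e)
        \<in> frobenius_power (ringR \<alpha>) (2 ^ e) (genideal (ringR \<alpha>) (specialize \<alpha> ` idealI))"
    unfolding tight_closure_def specialize_elemf by blast
  obtain t where t: "T = clsR \<alpha> t" using T(1) R.carr by auto
  have "\<not> quartR \<alpha> dvd t"
    using T(2) unfolding t R.cls_zero clsR_eq by simp
  moreover have "in_idealR \<alpha> (4 * 2 ^ e) (t * fpoly ^ 2 ^ e)" for e
  proof -
    have "clsR \<alpha> (t * fpoly ^ 2 ^ e) \<in> {clsR \<alpha> p |p. in_idealR \<alpha> (4 * 2 ^ e) p}"
      using T(3)[of e] frobenius_power_R_subset[of \<alpha> e] unfolding t R.cls_pow R.cls_mult by blast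
    then obtain p where p: "clsR \<alpha> (t * fpoly ^ 2 ^ e) = clsR \<alpha> p" "in_idealR \<alpha> (4 * 2 ^ e) p" by blast
    have "quartR \<alpha> dvd p + t * fpoly ^ 2 ^ e" using p(1) unfolding clsR_eq by (simp only: add.commute)
    then show ?thesis by (rule in_frob_cong[OF p(2)])
  qed
  ultimately show False using no_multiplier[OF assms] by blast
qed

section \<open>Localization\<close>

text \<open>Otherwise the product of all \<open>X + a\<close> would vanish everywhere, and adding 1
  would give a nonconstant polynomial without roots.\<close>

lemma infinite_L: "infinite (UNIV :: L set)"
proof
  assume fin: "finite (UNIV :: L set)"
  define p :: "L poly" where "p = (\<Prod>a\<in>UNIV. [:a, 1:])"
  have "poly p x = 0" for x
  proof -
    have "\<exists>a\<in>UNIV. poly [:a, 1:] x = 0" by (rule bexI[of _ x]) simp_all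
    then show ?thesis unfolding p_def poly_prod by (rule prod_zero[OF fin])
  qed
  then have no_root: "poly (p + 1) x \<noteq> 0" for x by simp
  have "degree p = card (UNIV :: L set)"
    unfolding p_def by (subst degree_prod_eq_sum_degree) auto
  moreover have "card (UNIV :: L set) > 0" using fin by (simp add: card_gt_0_iff)
  ultimately have "degree (p + 1) > 0" by (subst degree_add_eq_left) auto
  then show False using alg_closed_imp_poly_has_root no_root by blast
qed

lemma poly_emb: "poly (emb c) (constL \<alpha>) = constL (poly c \<alpha>)"
proof (induction c)
  case (pCons a c)
  have "emb (pCons a c) = pCons (constL a) (emb c)"
    unfolding emb_def by (cases "pCons a c = 0") (auto simp: map_poly_pCons constL_hom)
  then show ?case using pCons.IH by (simp add: constL_hom)
qed (simp add: emb_hom constL_hom)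

lemma finite_constL_roots:
  assumes "p \<noteq> (0 :: L_xyzt)"
  shows "finite {\<alpha>. poly p (constL \<alpha>) = 0}"
proof -
  have "inj constL" by (auto simp: inj_def constL_def)
  then have "finite (constL -` {x. poly p x = 0})"
    using poly_roots_finite[OF assms] by (intro finite_vimageI) (auto intro: inj_on_subset)
  then show ?thesis by (simp add: vimage_def)
qed

lemma not_dvd_low_degree:
  assumes "degree p < 4" "p \<noteq> 0"
  shows "\<not> quartR \<alpha> dvd p"
proof
  assume "quartR \<alpha> dvd p"
  then have "degree (quartR \<alpha>) \<le> degree p" using assms(2) by (rule dvd_imp_degree_le)
  then show False using assms(1) by (simp add: quart_def)
qed

text \<open>Division by the generic quartic with respect to \<open>z\<close>, which is not the outermost variable.\<close>

lemma reduce_gen_quartic: "\<exists>p'. gen_quartic dvd p + p' \<and> (\<forall>j. degree (coeff p' j) < 4)"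
proof (induction p)
  case 0
  show ?case by (rule exI[of _ 0]) simp
next
  case (pCons a p)
  have base: "\<exists>p'. gen_quartic dvd [:a:] + p' \<and> (\<forall>j. degree (coeff p' j) < 4)" for a
  proof (induction a)
    case 0
    show ?case by (rule exI[of _ 0]) simp
  next
    case (pCons s a)
    then obtain \<sigma> where \<sigma>: "gen_quartic dvd [:a:] + \<sigma>" "\<And>j. degree (coeff \<sigma> j) < 4" by blast
    \<comment> \<open>Collects the coefficients of \<open>z^3\<close>, which become those of
      \<open>z^4\<close> after multiplication by \<open>z\<close>. Adding
      \<open>k * gen_quartic\<close> cancels them, since \<open>z^4\<close> occurs in
      \<open>gen_quartic\<close> only with coefficient 1.\<close>
    define k where "k = map_poly (\<lambda>c. [:coeff c 3:]) \<sigma>"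
    define p' where "p' = [:[:s:]:] + (tZ * \<sigma> + k * gen_quartic)"
    have "gen_quartic dvd tZ * ([:a:] + \<sigma>) + k * gen_quartic"
      by (rule dvd_add[OF dvd_mult[OF \<sigma>(1)] dvd_triv_right])
    also have "tZ * ([:a:] + \<sigma>) + k * gen_quartic = [:pCons s a:] + p'"
    proof -
      have e: "[:pCons s a:] = [:[:s:]:] + tZ * [:a:]" by (simp add: var_z_def)
      have id: "Z * (a + g) + m = (s + Z * a) + (s + (Z * g + m))" for Z a g m s :: L_xyzt
        by (simp add: distrib_left add_ac)
      show ?thesis unfolding e p'_def by (rule id)
    qed
    finally have "gen_quartic dvd [:pCons s a:] + p'" .
    moreover have "degree (coeff p' j) < 4" for j
    proof -
      have g: "gen_quartic = [:quartic, var_x ^ 2 * var_y ^ 2:]"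
        unfolding relation_A[symmetric] by (simp add: var_t_def)
      have ck: "coeff k j = [:coeff (coeff \<sigma> j) 3:]" for j
        unfolding k_def by (simp add: coeff_map_poly)
      have cg: "coeff (k * gen_quartic) j = coeff k j * quartic
          + (if j = 0 then 0 else coeff k (j - 1) * (var_x ^ 2 * var_y ^ 2))"
        unfolding g by (cases j) (simp_all add: mult.commute[of k] mult.commute[of "coeff k _"])
      have dk: "degree (coeff k (j - 1) * (var_x ^ 2 * var_y ^ 2)) \<le> 3"
        unfolding ck var_eqs const_poly_hom[symmetric] by simp
      have z: "coeff (tZ * \<sigma>) j = pCons 0 (coeff \<sigma> j)" by (simp add: var_z_def)
      have q4: "quartic = [:0, px ^ 3 + py ^ 3, px * py, 0, 1:]"
        unfolding quartic_def var_eqs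
        by (simp add: eval_nat_numeral algebra_simps)
      have d2: "degree (coeff (tZ * \<sigma>) j + coeff k j * quartic) \<le> 3"
      proof (rule degree_le, intro allI impI)
        fix i :: nat assume i: "3 < i"
        show "coeff (coeff (tZ * \<sigma>) j + coeff k j * quartic) i = 0"
        proof (cases "i = 4")
          case True
          then show ?thesis unfolding z ck q4 by (simp add: eval_nat_numeral)
        next
          case False
          then have "i > 4" using i by simp
          have "degree (coeff \<sigma> j) < i - 1" using \<sigma>(2)[of j] \<open>i > 4\<close> by linarith
          then have "coeff (pCons 0 (coeff \<sigma> j)) i = 0"
            using \<open>i > 4\<close> by (cases i) (simp_all add: coeff_eq_0)
          moreover have "degree ([:coeff (coeff \<sigma> j) 3:] * quartic) \<le> 0 + 4"
            by (rule order_trans[OF degree_mult_le add_mono]) (simp_all add: q4)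
          then have "coeff ([:coeff (coeff \<sigma> j) 3:] * quartic) i = 0"
            using \<open>i > 4\<close> by (intro coeff_eq_0) linarith
          ultimately show ?thesis unfolding z ck coeff_add by (simp only: add_0_left)
        qed
      qed
      have d1: "degree (coeff [:[:s:]:] j) \<le> 3" by (cases j) simp_all
      have d3: "degree (if j = 0 then 0 else coeff k (j - 1) * (var_x ^ 2 * var_y ^ 2)) \<le> 3"
        using dk by simp
      have "degree (coeff [:[:s:]:] j + ((coeff (tZ * \<sigma>) j + coeff k j * quartic)
          + (if j = 0 then 0 else coeff k (j - 1) * (var_x ^ 2 * var_y ^ 2)))) \<le> 3"
        by (rule degree_add_le[OF d1 degree_add_le[OF d2 d3]])
      then show ?thesis unfolding p'_def coeff_add cg by (simp add: add.assoc)
    qed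
    ultimately show ?case by blast
  qed
  obtain p1 where p1: "gen_quartic dvd [:a:] + p1" "\<And>j. degree (coeff p1 j) < 4" using base by blast
  obtain p2 where p2: "gen_quartic dvd p + p2" "\<And>j. degree (coeff p2 j) < 4" using pCons.IH by blast
  have "gen_quartic dvd ([:a:] + p1) + [:0, 1:] * (p + p2)"
    by (rule dvd_add[OF p1(1) dvd_mult[OF p2(1)]])
  also have "([:a:] + p1) + [:0, 1:] * (p + p2) = pCons a p + (p1 + pCons 0 p2)"
    by (simp add: add_ac)
  finally have "gen_quartic dvd pCons a p + (p1 + pCons 0 p2)" .
  moreover have "degree (coeff (p1 + pCons 0 p2) j) < 4" for j
    using p1(2)[of j] p2(2) by (cases j) (auto intro: degree_add_less)
  ultimately show ?case by blast
qed

text \<open>The remainder \<open>t'\<close> is nonzero and has degree below 4 in \<open>z\<close>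
  for every \<open>\<alpha>\<close>, so divisibility means that its specialization is zero. This
  happens for finitely many \<open>\<alpha>\<close> only.\<close>

lemma not_dvd_specialize:
  assumes "\<not> gen_quartic dvd t"
  shows "finite {\<alpha>. quartR \<alpha> dvd poly t (constL \<alpha>)}"
proof -
  obtain t' where t': "gen_quartic dvd t + t'" "\<And>j. degree (coeff t' j) < 4"
    using reduce_gen_quartic by blast
  have "t' \<noteq> 0" using t'(1) assms by auto
  have "{\<alpha>. quartR \<alpha> dvd poly t (constL \<alpha>)} \<subseteq> {\<alpha>. poly t' (constL \<alpha>) = 0}"
  proof clarify
    fix \<alpha> assume d: "quartR \<alpha> dvd poly t (constL \<alpha>)"
    obtain k where k: "t + t' = gen_quartic * k" using t'(1) by blast
    have "poly (t + t') (constL \<alpha>) = quartR \<alpha> * poly k (constL \<alpha>)"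
      unfolding k by (simp only: poly_mult poly_gen_quartic)
    then have "quartR \<alpha> dvd poly (t + t') (constL \<alpha>)" by (metis dvd_triv_left)
    then have "quartR \<alpha> dvd poly t (constL \<alpha>) + poly (t + t') (constL \<alpha>)"
      using d by (intro dvd_add)
    then have dv: "quartR \<alpha> dvd poly t' (constL \<alpha>)" by simp
    have "degree (poly t' (constL \<alpha>)) \<le> 3"
      unfolding poly_altdef
    proof (rule degree_sum_le)
      fix j
      have "constL \<alpha> ^ j = constL (\<alpha> ^ j)" by (induction j) (simp_all add: constL_hom)
      then show "degree (coeff t' j * constL \<alpha> ^ j) \<le> 3"
        using degree_mult_le[of "coeff t' j" "constL (\<alpha> ^ j)"] t'(2)[of j] by (simp add: constL_def)
    qed simp
    then show "poly t' (constL \<alpha>) = 0" using not_dvd_low_degree[of "poly t' (constL \<alpha>)" \<alpha>] dv by auto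
  qed
  then show ?thesis using finite_constL_roots[OF \<open>t' \<noteq> 0\<close>] by (rule finite_subset)
qed

section \<open>Passage between \<open>A\<close>, its localization and the special fibres\<close>

abbreviation "locA \<equiv> localization ringA multS"

lemma loc_frac_eq_zero_iff:
  assumes "p \<in> carrier ringA"
  shows "loc_frac ringA multS p \<one>\<^bsub>ringA\<^esub> = \<zero>\<^bsub>locA\<^esub> \<longleftrightarrow> (\<exists>u\<in>multS. u \<otimes>\<^bsub>ringA\<^esub> p = \<zero>\<^bsub>ringA\<^esub>)"
proof -
  interpret localization_at ringA multS by (rule localization_at_multS)
  have "\<one>\<^bsub>ringA\<^esub> \<otimes>\<^bsub>ringA\<^esub> p \<ominus>\<^bsub>ringA\<^esub> \<one>\<^bsub>ringA\<^esub> \<otimes>\<^bsub>ringA\<^esub> \<zero>\<^bsub>ringA\<^esub> = p"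
    using assms by algebra
  then show ?thesis
    unfolding zero_loc using loc_frac_eq_iff[OF assms one_closed zero_closed one_closed] by simp
qed

lemma multS_emb: "s \<in> multS \<longleftrightarrow> (\<exists>d. d \<noteq> 0 \<and> s = clsA (emb d))"
  unfolding multS_def emb_def by auto

lemma elemf_in_tight_closure_localization:
  "loc_frac ringA multS elemf \<one>\<^bsub>ringA\<^esub> \<in> tight_closure 2 locA (loc_ideal ringA multS idealI)"
proof -
  interpret A: cls_ring ringA clsA by (rule cls_ring_A)
  interpret loc: localization_at ringA multS by (rule localization_at_multS)
  interpret LA: cring locA by (rule loc.cring_localization)
  define \<phi> where "\<phi> p = loc_frac ringA multS (clsA p) \<one>\<^bsub>ringA\<^esub>" for p
  have hom: "(\<lambda>a. loc_frac ringA multS a \<one>\<^bsub>ringA\<^esub>) \<in> ring_hom ringA locA"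
    by (rule loc.loc_map_ring_hom)
  have closed: "\<phi> p \<in> carrier locA" for p
    unfolding \<phi>_def by (rule ring_hom_closed[OF hom A.cls_closed])
  have mult: "\<phi> p \<otimes>\<^bsub>locA\<^esub> \<phi> p' = \<phi> (p * p')" for p p'
    unfolding \<phi>_def A.cls_mult[symmetric] by (rule ring_hom_mult[OF hom A.cls_closed A.cls_closed, symmetric])
  have add: "\<phi> p \<oplus>\<^bsub>locA\<^esub> \<phi> p' = \<phi> (p + p')" for p p'
    unfolding \<phi>_def A.cls_add[symmetric] by (rule ring_hom_add[OF hom A.cls_closed A.cls_closed, symmetric])
  have one: "\<one>\<^bsub>locA\<^esub> = \<phi> 1"
    unfolding \<phi>_def A.cls_one[symmetric] by (rule ring_hom_one[OF hom, symmetric])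
  have pow: "\<phi> p [^]\<^bsub>locA\<^esub> (n::nat) = \<phi> (p ^ n)" for p n
    by (induction n) (simp_all add: one mult mult.commute)
  have cong: "\<phi> p = \<phi> p'" if "gen_quartic dvd p + p'" for p p'
    using that unfolding \<phi>_def clsA_eq[symmetric] by (simp only:)
  define T where "T = tB * tX ^ 3"
  have T_nz: "\<phi> T \<noteq> \<zero>\<^bsub>locA\<^esub>"
  proof
    assume "\<phi> T = \<zero>\<^bsub>locA\<^esub>"
    then have "\<exists>u\<in>multS. u \<otimes>\<^bsub>ringA\<^esub> clsA T = \<zero>\<^bsub>ringA\<^esub>"
      unfolding \<phi>_def loc_frac_eq_zero_iff[OF A.cls_closed] .
    then obtain u where u: "u \<in> multS" "u \<otimes>\<^bsub>ringA\<^esub> clsA T = \<zero>\<^bsub>ringA\<^esub>" ..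
    obtain d where d: "d \<noteq> 0" "u = clsA (emb d)" using u(1) unfolding multS_emb by blast
    have "gen_quartic dvd emb d * T"
      using u(2) unfolding d(2) A.cls_mult A.cls_zero clsA_eq add_0_right .
    then obtain k where k: "emb d * T = gen_quartic * k" ..
    \<comment> \<open>Specialize away from the roots of \<open>d\<close>: the left side becomes
      nonzero and constant in \<open>z\<close>, which the monic quartic cannot divide.\<close>
    have "finite {\<alpha>. poly d \<alpha> = 0}" using d(1) by (rule poly_roots_finite)
    then have "\<exists>\<alpha>. \<alpha> \<notin> {\<alpha>. poly d \<alpha> = 0}" by (rule ex_new_if_finite[OF infinite_L])
    then obtain \<alpha> where \<alpha>: "poly d \<alpha> \<noteq> 0" by auto
    define c where "c = [:[:poly d \<alpha>:]:] * ((px ^ 3 + py ^ 3) * px ^ 3)"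
    have const: "poly [:v:] (constL \<alpha>) = v" for v by simp
    have "poly (emb d * T) (constL \<alpha>) = poly (gen_quartic * k) (constL \<alpha>)" by (simp only: k)
    then have "constL (poly d \<alpha>) * (([:px:] ^ 3 + [:py:] ^ 3) * [:px:] ^ 3) = quartR \<alpha> * poly k (constL \<alpha>)"
      unfolding T_def by (simp only: poly_mult poly_add poly_power poly_emb poly_gen_quartic const var_eqs)
    moreover have "[:c:] = constL (poly d \<alpha>) * (([:px:] ^ 3 + [:py:] ^ 3) * [:px:] ^ 3)"
      unfolding c_def constL_def by (simp only: const_poly_hom)
    ultimately have dv: "quartR \<alpha> dvd [:c:]" by (metis dvd_triv_left)
    have "px \<noteq> (0 :: L poly poly)" by (simp add: px_def)
    moreover have "px ^ 3 + py ^ 3 \<noteq> (0 :: L poly poly)" unfolding fAB_eq by simp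
    moreover have "[:[:poly d \<alpha>:]:] \<noteq> 0" using \<alpha> by simp
    ultimately have "c \<noteq> 0" unfolding c_def by (intro no_zero_divisors) simp_all
    then show False using not_dvd_low_degree[of "[:c:]" \<alpha>] dv by simp
  qed
  have T_mem: "\<phi> T \<otimes>\<^bsub>locA\<^esub> \<phi> (tY ^ 3 * tZ ^ 3) [^]\<^bsub>locA\<^esub> ((2::nat) ^ e)
      \<in> frobenius_power locA (2 ^ e) (loc_ideal ringA multS idealI)" for e
  proof -
    define q where "q = (2::nat) ^ e"
    define S where "S = {g [^]\<^bsub>locA\<^esub> q |g. g \<in> loc_ideal ringA multS idealI}"
    have gens: "clsA ([:var_x:] ^ 4) \<in> idealI" "clsA ([:var_y:] ^ 4) \<in> idealI" "clsA ([:var_z:] ^ 4) \<in> idealI"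
      unfolding idealI_def
      using A.genideal_self[of "{clsA ([:var_x:] ^ 4), clsA ([:var_y:] ^ 4), clsA ([:var_z:] ^ 4)}"] by auto
    have Icarr: "idealI \<subseteq> carrier ringA" using idealI_subset by auto
    have Scarr: "S \<subseteq> carrier locA"
    proof
      fix h assume "h \<in> S"
      then obtain g where g: "h = g [^]\<^bsub>locA\<^esub> q" "g \<in> loc_ideal ringA multS idealI" unfolding S_def by blast
      then obtain a s where "g = loc_frac ringA multS a s" "a \<in> idealI" "s \<in> multS"
        unfolding loc_ideal_def by blast
      then have "g \<in> carrier locA" using loc.loc_frac_closed[of a s] Icarr by blast
      then show "h \<in> carrier locA" unfolding g(1) by (rule LA.nat_pow_closed)
    qed
    interpret J: ideal "genideal locA S" locA by (rule LA.genideal_ideal[OF Scarr])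
    have gen: "\<phi> (v ^ (4 * q)) \<in> genideal locA S" if "clsA (v ^ 4) \<in> idealI" for v
    proof -
      have "\<phi> (v ^ 4) \<in> loc_ideal ringA multS idealI"
        unfolding \<phi>_def loc_ideal_def using that loc.one_closed by blast
      then have "\<phi> (v ^ 4) [^]\<^bsub>locA\<^esub> q \<in> S" unfolding S_def by blast
      then show ?thesis using LA.genideal_self[OF Scarr] unfolding pow power_mult by blast
    qed
    obtain d where d: "d \<noteq> 0" "in_ideal (4 * q) (emb d * (T * (tY ^ 3 * tZ ^ 3) ^ q))"
      using in_sat_generic[of e] unfolding in_sat_def q_def T_def by blast
    obtain r c where r: "in_pow tX tY (4 * q) r"
      "gen_quartic dvd emb d * (T * (tY ^ 3 * tZ ^ 3) ^ q) + (r + c * tZ ^ (4 * q))"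
      using d(2) unfolding in_frob_def by blast
    obtain a b where ab: "r = a * tX ^ (4 * q) + b * tY ^ (4 * q)" using r(1) unfolding in_pow_def by blast
    have "\<phi> (emb d * (T * (tY ^ 3 * tZ ^ 3) ^ q)) = \<phi> (r + c * tZ ^ (4 * q))"
      by (rule cong[OF r(2)])
    also have "\<dots> \<in> genideal locA S"
      unfolding ab add[symmetric] mult[symmetric]
      by (rule J.a_closed[OF J.a_closed[OF J.I_l_closed[OF gen[OF gens(1)] closed]
              J.I_l_closed[OF gen[OF gens(2)] closed]] J.I_l_closed[OF gen[OF gens(3)] closed]])
    finally have mem: "\<phi> (emb d * (T * (tY ^ 3 * tZ ^ 3) ^ q)) \<in> genideal locA S" .
    \<comment> \<open>The denominator \<open>d\<close> varies with \<open>e\<close>, but it is a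
      unit in the localization; so the multiplier \<open>T\<close> can stay the same for all
      \<open>e\<close>.\<close>
    define i where "i = loc_frac ringA multS \<one>\<^bsub>ringA\<^esub> (clsA (emb d))"
    have dS: "clsA (emb d) \<in> multS" using d(1) multS_emb by blast
    have i: "i \<in> carrier locA" unfolding i_def by (rule loc.loc_frac_closed[OF A.one_closed dS])
    have unit: "\<phi> (emb d) \<otimes>\<^bsub>locA\<^esub> i = \<one>\<^bsub>locA\<^esub>" unfolding \<phi>_def i_def by (rule loc.loc_map_unit[OF dS])
    have "i \<otimes>\<^bsub>locA\<^esub> \<phi> (emb d * (T * (tY ^ 3 * tZ ^ 3) ^ q)) \<in> genideal locA S"
      by (rule J.I_l_closed[OF mem i])
    also have "i \<otimes>\<^bsub>locA\<^esub> \<phi> (emb d * (T * (tY ^ 3 * tZ ^ 3) ^ q))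
        = (\<phi> (emb d) \<otimes>\<^bsub>locA\<^esub> i) \<otimes>\<^bsub>locA\<^esub> \<phi> (T * (tY ^ 3 * tZ ^ 3) ^ q)"
      unfolding mult[of "emb d", symmetric] LA.m_assoc[OF i closed closed, symmetric]
        LA.m_comm[OF i closed] ..
    also have "\<dots> = \<phi> T \<otimes>\<^bsub>locA\<^esub> \<phi> (tY ^ 3 * tZ ^ 3) [^]\<^bsub>locA\<^esub> q"
      unfolding unit pow mult by (rule LA.l_one[OF closed])
    finally show ?thesis unfolding frobenius_power_def S_def q_def .
  qed
  have "\<phi> (tY ^ 3 * tZ ^ 3) \<in> tight_closure 2 locA (loc_ideal ringA multS idealI)"
    unfolding tight_closure_def
  proof (rule CollectI, rule conjI)
    show "\<phi> (tY ^ 3 * tZ ^ 3) \<in> carrier locA" by (rule closed)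
    show "\<exists>t\<in>carrier locA. t \<noteq> \<zero>\<^bsub>locA\<^esub> \<and> (\<forall>e. t \<otimes>\<^bsub>locA\<^esub> \<phi> (tY ^ 3 * tZ ^ 3) [^]\<^bsub>locA\<^esub> ((2::nat) ^ e)
        \<in> frobenius_power locA (2 ^ e) (loc_ideal ringA multS idealI))"
    proof (rule bexI[OF _ closed[of T]], rule conjI[OF T_nz], rule allI)
      fix e show "\<phi> T \<otimes>\<^bsub>locA\<^esub> \<phi> (tY ^ 3 * tZ ^ 3) [^]\<^bsub>locA\<^esub> ((2::nat) ^ e)
        \<in> frobenius_power locA (2 ^ e) (loc_ideal ringA multS idealI)" by (rule T_mem)
    qed
  qed
  then show ?thesis unfolding \<phi>_def elemf_eq .
qed

text \<open>Otherwise a multiple of \<open>f\<close> by a nonzero element of \<open>L[t]\<close>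
  would lie in \<open>I^*\<close> with some multiplier \<open>t\<close>. At almost every
  \<open>\<alpha>\<close> both remain nonzero, and \<open>t\<close> would become a multiplier for
  \<open>f\<close> in \<open>R\<^sub>\<alpha>\<close>.\<close>

lemma elemf_not_in_localized_tight_closure:
  "loc_frac ringA multS elemf \<one>\<^bsub>ringA\<^esub> \<notin> loc_ideal ringA multS (tight_closure 2 ringA idealI)"
proof
  interpret A: cls_ring ringA clsA by (rule cls_ring_A)
  interpret loc: localization_at ringA multS by (rule localization_at_multS)
  assume "loc_frac ringA multS elemf \<one>\<^bsub>ringA\<^esub> \<in> loc_ideal ringA multS (tight_closure 2 ringA idealI)"
  then obtain a s where as: "loc_frac ringA multS elemf \<one>\<^bsub>ringA\<^esub> = loc_frac ringA multS a s"
    "a \<in> tight_closure 2 ringA idealI" "s \<in> multS"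
    unfolding loc_ideal_def mem_Collect_eq by (elim exE conjE)
  have a: "a \<in> carrier ringA \<and> (\<exists>T\<in>carrier ringA. T \<noteq> \<zero>\<^bsub>ringA\<^esub> \<and>
      (\<forall>e::nat. T \<otimes>\<^bsub>ringA\<^esub> a [^]\<^bsub>ringA\<^esub> ((2::nat) ^ e) \<in> frobenius_power ringA (2 ^ e) idealI))"
    using as(2) unfolding tight_closure_def mem_Collect_eq .
  from conjunct2[OF a] obtain T where T: "T \<in> carrier ringA" "T \<noteq> \<zero>\<^bsub>ringA\<^esub> \<and>
      (\<forall>e::nat. T \<otimes>\<^bsub>ringA\<^esub> a [^]\<^bsub>ringA\<^esub> ((2::nat) ^ e) \<in> frobenius_power ringA (2 ^ e) idealI)"
    by (rule bexE)
  obtain p where p: "a = clsA p" using conjunct1[OF a] unfolding A.carr by (rule rangeE)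
  obtain t where t: "T = clsA t" using T(1) unfolding A.carr by (rule rangeE)
  note pt = p t
  let ?f = "tY ^ 3 * tZ ^ 3"
  have fc: "elemf \<in> carrier ringA" unfolding elemf_eq by (rule A.cls_closed)
  have "\<exists>u\<in>multS. u \<otimes>\<^bsub>ringA\<^esub> (s \<otimes>\<^bsub>ringA\<^esub> elemf \<ominus>\<^bsub>ringA\<^esub> \<one>\<^bsub>ringA\<^esub> \<otimes>\<^bsub>ringA\<^esub> a) = \<zero>\<^bsub>ringA\<^esub>"
    using as(1) unfolding loc.loc_frac_eq_iff[OF fc loc.one_closed conjunct1[OF a] as(3)] .
  then obtain u where u: "u \<in> multS"
    "u \<otimes>\<^bsub>ringA\<^esub> (s \<otimes>\<^bsub>ringA\<^esub> elemf \<ominus>\<^bsub>ringA\<^esub> \<one>\<^bsub>ringA\<^esub> \<otimes>\<^bsub>ringA\<^esub> a) = \<zero>\<^bsub>ringA\<^esub>"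
    by (rule bexE)
  obtain d1 where d1: "d1 \<noteq> 0" "u = clsA (emb d1)" using u(1) unfolding multS_emb by (elim exE conjE)
  obtain d2 where d2: "d2 \<noteq> 0" "s = clsA (emb d2)" using as(3) unfolding multS_emb by (elim exE conjE)
  define D where "D = emb (d1 * d2)"
  have "clsA (D * ?f) = clsA (emb d1 * p)"
  proof -
    have c: "u \<in> carrier ringA" "s \<in> carrier ringA" "a \<in> carrier ringA"
      unfolding d1 d2 p by (rule A.cls_closed)+
    have "u \<otimes>\<^bsub>ringA\<^esub> (s \<otimes>\<^bsub>ringA\<^esub> elemf)
        = u \<otimes>\<^bsub>ringA\<^esub> (s \<otimes>\<^bsub>ringA\<^esub> elemf \<ominus>\<^bsub>ringA\<^esub> \<one>\<^bsub>ringA\<^esub> \<otimes>\<^bsub>ringA\<^esub> a) \<oplus>\<^bsub>ringA\<^esub> u \<otimes>\<^bsub>ringA\<^esub> a"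
      using c fc by algebra
    also have "\<dots> = u \<otimes>\<^bsub>ringA\<^esub> a" unfolding u(2) using c by simp
    finally show ?thesis
      unfolding d1(2) d2(2) pt elemf_eq A.cls_mult D_def emb_hom by (simp only: mult.assoc)
  qed
  then have f: "gen_quartic dvd D * ?f + emb d1 * p" unfolding clsA_eq .
  have "\<not> gen_quartic dvd t" using conjunct1[OF T(2)] unfolding pt A.cls_zero clsA_eq add_0_right .
  then have "finite ({\<alpha>. quartR \<alpha> dvd poly t (constL \<alpha>)} \<union> {\<alpha>. poly (d1 * d2) \<alpha> = 0} \<union> {0})"
    using not_dvd_specialize poly_roots_finite[of "d1 * d2"] d1(1) d2(1) by simp
  from ex_new_if_finite[OF infinite_L this] obtain \<alpha> where \<alpha>: "\<not> quartR \<alpha> dvd poly t (constL \<alpha>)" "poly (d1 * d2) \<alpha> \<noteq> 0" "\<alpha> \<noteq> 0"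
    by auto
  have "in_idealR \<alpha> (4 * 2 ^ e) (poly t (constL \<alpha>) * fpoly ^ 2 ^ e)" for e
  proof -
    define q where "q = (2::nat) ^ e"
    have "clsA (t * p ^ q) \<in> {clsA p |p. in_ideal (4 * q) p}"
      using subsetD[OF frobenius_power_A_subset spec[OF conjunct2[OF T(2)]], of e]
      unfolding pt A.cls_pow A.cls_mult q_def .
    then obtain p' where p': "clsA (t * p ^ q) = clsA p'" "in_ideal (4 * q) p'"
      unfolding mem_Collect_eq by (elim exE conjE)
    have "gen_quartic dvd p' + t * p ^ q" using p'(1) unfolding clsA_eq by (simp only: add.commute)
    then have "in_ideal (4 * q) (t * p ^ q)" by (rule in_frob_cong[OF p'(2)])
    then have m: "in_ideal (4 * q) (emb d1 ^ q * (t * p ^ q))" by (rule in_frob_mult)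
    \<comment> \<open>The congruence between \<open>D * ?f\<close> and \<open>emb d1 * p\<close>
      raised to the power \<open>q\<close>, which trades \<open>p ^ q\<close> for
      \<open>?f ^ q\<close>.\<close>
    have "gen_quartic dvd (D * ?f + emb d1 * p) ^ q"
      by (rule dvd_trans[OF f dvd_power]) (simp add: q_def)
    then have fq: "gen_quartic dvd (D * ?f) ^ q + (emb d1 * p) ^ q"
      unfolding q_def frobenius_add_char2 .
    have "gen_quartic dvd t * ((D * ?f) ^ q + (emb d1 * p) ^ q)" by (rule dvd_mult[OF fq])
    then have "gen_quartic dvd emb d1 ^ q * (t * p ^ q) + D ^ q * (t * ?f ^ q)"
      by (simp only: distrib_left power_mult_distrib mult_ac add_ac)
    then have "in_ideal (4 * q) (D ^ q * (t * ?f ^ q))" by (rule in_frob_cong[OF m])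
    then have "in_idealR \<alpha> (4 * q) (poly (D ^ q * (t * ?f ^ q)) (constL \<alpha>))" by (rule in_idealR_specialize)
    also have "poly (D ^ q * (t * ?f ^ q)) (constL \<alpha>)
        = constL (poly (d1 * d2) \<alpha>) ^ q * (poly t (constL \<alpha>) * fpoly ^ q)"
    proof -
      have const: "poly [:v:] (constL \<alpha>) = v" for v by simp
      show ?thesis unfolding D_def by (simp only: poly_mult poly_power poly_emb const var_eqs)
    qed
    \<comment> \<open>At the chosen \<open>\<alpha>\<close> the factor \<open>D\<close> has become a
      nonzero constant and is divided out.\<close>
    finally have "in_idealR \<alpha> (4 * q) (constL (inverse (poly (d1 * d2) \<alpha>)) ^ q *
        (constL (poly (d1 * d2) \<alpha>) ^ q * (poly t (constL \<alpha>) * fpoly ^ q)))"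
      by (rule in_frob_mult)
    also have "constL (inverse (poly (d1 * d2) \<alpha>)) ^ q *
        (constL (poly (d1 * d2) \<alpha>) ^ q * (poly t (constL \<alpha>) * fpoly ^ q)) = poly t (constL \<alpha>) * fpoly ^ q"
    proof -
      have "constL (inverse (poly (d1 * d2) \<alpha>)) * constL (poly (d1 * d2) \<alpha>) = 1"
        unfolding constL_hom(4)[symmetric] left_inverse[OF \<alpha>(2)] by (rule constL_hom)
      then show ?thesis by (simp only: mult.assoc[symmetric] power_mult_distrib[symmetric] power_one mult_1_left)
    qed
    finally show ?thesis unfolding q_def .
  qed
  then show False using no_multiplier[OF \<alpha>(3,1)] by blast
qed

theorem theorem2p5:
  shows "loc_frac ringA multS elemf \<one>\<^bsub>ringA\<^esub>
           \<in> tight_closure 2 (localization ringA multS) (loc_ideal ringA multS idealI)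
       \<and> (\<forall>\<alpha>::L. \<alpha> \<noteq> 0 \<longrightarrow>
           specialize \<alpha> elemf
             \<notin> tight_closure 2 (ringR \<alpha>) (genideal (ringR \<alpha>) (specialize \<alpha> ` idealI)))
       \<and> loc_frac ringA multS elemf \<one>\<^bsub>ringA\<^esub>
           \<notin> loc_ideal ringA multS (tight_closure 2 ringA idealI)
       \<and> tight_closure 2 (localization ringA multS) (loc_ideal ringA multS idealI)
           \<noteq> loc_ideal ringA multS (tight_closure 2 ringA idealI)"
  using elemf_in_tight_closure_localization elemf_not_in_localized_tight_closure
    specialize_not_in_tight_closure by metis

end
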